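(* Let $\hat H$ be an infinite-dimensional symplectic Hilbert space whose symplectic form is $\omega(\xi,\eta)=\langle J\xi,\eta\rangle$ with $J$ a skew-adjoint unitary operator. Let $M$ be a Lagrangian subspace and $\Gamma$ a closed isotropic subspace of $\hat H$, with $\omega$-annihilator $\Gamma^*$. Suppose that $M$ is transversal to $(\Gamma,\Gamma^* )$. Let $\mathcal V=\Gamma^*/\Gamma$, let $\gamma:\Gamma^*\to\mathcal V$ be the quotient map, and put $\gamma_!M=\gamma(M\cap\Gamma^* )$. Let $X$ be a topological space and $L=(L_x)_{x\in X}$ a continuous family of Lagrangian subspaces of $\mathcal V$ which are Fredholm with respect to $\gamma_!M$. Then $$\operatorname{ind}_{\hat H}(\gamma^{-1}L,M)=\operatorname{ind}_{\mathcal V}(L,\gamma_!M)\in K^1(X),$$ where $\gamma^{-1}L$ is the family $(\gamma^{-1}(L_x))_{x\in X}$.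
   Context: All Hilbert spaces are complex and separable. The $\omega$-annihilator of a subspace $L$ is $L^*=\{\xi:\omega(\xi,\eta)=0\ \forall\eta\in L\}$; $L$ is isotropic if $L\subset L^*$ and Lagrangian if $L=L^*$. The quotient $\mathcal V=\Gamma^*/\Gamma$ carries the induced symplectic form $\omega(\xi+\Gamma,\eta+\Gamma)=\omega(\xi,\eta)$; identifying $\mathcal V$ with $\Gamma^*\ominus\Gamma$, this is the restriction of $\omega$, and $J$ preserves $\Gamma^*\ominus\Gamma$. $M$ is transversal to $(\Gamma,\Gamma^* )$ if $M+\Gamma$ is closed, $M\cap\Gamma=0$, and $M+\Gamma^*=\hat H$. A pair $(L,M)$ of closed subspaces is Fredholm if $L+M$ is closed and $\dim(L\cap M)$, $\operatorname{codim}(L+M)$ are finite. Families of closed subspaces are continuous when the orthogonal projections are norm continuous. Under the hypotheses, $\gamma_!M$ is Lagrangian in $\mathcal V$ and $(\gamma^{-1}(L_x),M)$ are Fredholm Lagrangian pairs in $\hat H$. $K^1$ index. For a Hilbert space $W$ let $\mathcal U(W)$ be the unitary group with the norm topology, $\mathcal U_K(W)=\{u\in\mathcal U(W): u-1\text{ compact}\}$ and $\mathcal U_F(W)=\{u\in\mathcal U(W): u+1\text{ Fredholm}\}$. For an infinite-dimensional separable Hilbert space $H$ and arbitrary $X$, $K^1(X):=[X,\mathcal U_K(H)]=[X,\mathcal U_F(H)]$ (the inclusion is a homotopy equivalence), with addition given by direct sum and zero element the constant map $1$. The index of a continuous $f:X\to\mathcal U_F(W)$ is the class of $f\oplus1:X\to\mathcal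 U_F(W\oplus H')$, $H'$ an auxiliary infinite-dimensional separable Hilbert space. For a Hilbert space $\Lambda$ with skew-adjoint unitary $J$ and $\omega(\xi,\eta)=\langle J\xi,\eta\rangle$, put $\Lambda^\pm=\ker(J\mp i)$. Each Lagrangian subspace $L$ is the graph of a unitary $u_L:\Lambda^+\to\Lambda^-$. For a continuous family $(L_x,M_x)$ of Fredholm pairs of Lagrangian subspaces of $\Lambda$ one has $-u_{M_x}^{-1}u_{L_x}\in\mathcal U_F(\Lambda^+)$, and $\operatorname{ind}_\Lambda(L,M)\in K^1(X)$ is the index of the family $x\mapsto-u_{M_x}^{-1}u_{L_x}$. *)

theory Defs
  imports "HOL-Analysis.Analysis"
begin

section \<open>Complex Hilbert spaces\<close>

text \<open>
  A complex Hilbert space is a complete real inner product space with a compatible complex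
  structure.  The inner product is linear in its first argument.  Positive definiteness and the
  norm come from \<^class>\<open>real_inner\<close>, because the real inner product is the real part of the complex
  one.
\<close>

class chilbert_space = real_inner + complete_space +
  fixes scaleC :: "complex \<Rightarrow> 'a \<Rightarrow> 'a"  (infixr "*\<^sub>C" 75)
    and cinner :: "'a \<Rightarrow> 'a \<Rightarrow> complex"
  assumes scaleC_add_right: "a *\<^sub>C (x + y) = a *\<^sub>C x + a *\<^sub>C y"
    and scaleC_add_left: "(a + b) *\<^sub>C x = a *\<^sub>C x + b *\<^sub>C x"
    and scaleC_scaleC: "a *\<^sub>C (b *\<^sub>C x) = (a * b) *\<^sub>C x"
    and scaleR_scaleC: "r *\<^sub>R x = complex_of_real r *\<^sub>C x"
    and cinner_commute: "cinner x y = cnj (cinner y x)"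
    and cinner_add_left: "cinner (x + y) z = cinner x z + cinner y z"
    and cinner_scaleC_left: "cinner (a *\<^sub>C x) y = a * cinner x y"
    and inner_eq_Re_cinner: "inner x y = Re (cinner x y)"

global_interpretation complex_vector:
  vector_space "scaleC :: complex \<Rightarrow> 'a \<Rightarrow> 'a::chilbert_space"
proof
  fix a b :: complex and x y :: 'a
  show "a *\<^sub>C (x + y) = a *\<^sub>C x + a *\<^sub>C y" by (rule scaleC_add_right)
  show "(a + b) *\<^sub>C x = a *\<^sub>C x + b *\<^sub>C x" by (rule scaleC_add_left)
  show "a *\<^sub>C (b *\<^sub>C x) = (a * b) *\<^sub>C x" by (rule scaleC_scaleC)
  show "1 *\<^sub>C x = x" using scaleR_scaleC[of 1 x] by simp
qed

instantiation prod :: (chilbert_space, chilbert_space) chilbert_space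
begin

definition scaleC_prod :: "complex \<Rightarrow> 'a \<times> 'b \<Rightarrow> 'a \<times> 'b"
  where "scaleC_prod c x = (c *\<^sub>C fst x, c *\<^sub>C snd x)"

definition cinner_prod :: "'a \<times> 'b \<Rightarrow> 'a \<times> 'b \<Rightarrow> complex"
  where "cinner_prod x y = cinner (fst x) (fst y) + cinner (snd x) (snd y)"

instance
proof
  fix a b :: complex and r :: real and x y z :: "'a \<times> 'b"
  show "a *\<^sub>C (x + y) = a *\<^sub>C x + a *\<^sub>C y"
    by (simp add: scaleC_prod_def scaleC_add_right)
  show "(a + b) *\<^sub>C x = a *\<^sub>C x + b *\<^sub>C x"
    by (simp add: scaleC_prod_def scaleC_add_left)
  show "a *\<^sub>C (b *\<^sub>C x) = (a * b) *\<^sub>C x"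
    by (simp add: scaleC_prod_def scaleC_scaleC)
  show "r *\<^sub>R x = complex_of_real r *\<^sub>C x"
    by (simp add: scaleC_prod_def scaleR_prod_def scaleR_scaleC)
  show "cinner x y = cnj (cinner y x)"
    using cinner_commute[of "fst x" "fst y"] cinner_commute[of "snd x" "snd y"]
    by (simp add: cinner_prod_def)
  show "cinner (x + y) z = cinner x z + cinner y z"
    by (simp add: cinner_prod_def cinner_add_left)
  show "cinner (a *\<^sub>C x) y = a * cinner x y"
    by (simp add: cinner_prod_def scaleC_prod_def cinner_scaleC_left distrib_left)
  show "inner x y = Re (cinner x y)"
    by (simp add: cinner_prod_def inner_prod_def inner_eq_Re_cinner)
qed

end

abbreviation csubspace :: "'a::chilbert_space set \<Rightarrow> bool"
  where "csubspace \<equiv> complex_vector.subspace"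

abbreviation cspan :: "'a::chilbert_space set \<Rightarrow> 'a set"
  where "cspan \<equiv> complex_vector.span"

definition finite_cdim :: "'a::chilbert_space set \<Rightarrow> bool"
  where "finite_cdim W \<longleftrightarrow> (\<exists>B. finite B \<and> W \<subseteq> cspan B)"

definition finite_ccodim :: "'a::chilbert_space set \<Rightarrow> 'a set \<Rightarrow> bool"
  where "finite_ccodim W N \<longleftrightarrow> (\<exists>B. finite B \<and> B \<subseteq> W \<and> W \<subseteq> cspan (N \<union> B))"

definition clinear_on :: "'a::chilbert_space set \<Rightarrow> ('a \<Rightarrow> 'b::chilbert_space) \<Rightarrow> bool"
  where "clinear_on W T \<longleftrightarrow>
    (\<forall>x\<in>W. \<forall>y\<in>W. T (x + y) = T x + T y) \<and> (\<forall>c. \<forall>x\<in>W. T (c *\<^sub>C x) = c *\<^sub>C T x)"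

text \<open>\<open>W\<close> minus \<open>N\<close> in the sense of Hilbert spaces: the orthogonal complement of \<open>N\<close> in \<open>W\<close>.\<close>

definition orth_diff :: "'a::chilbert_space set \<Rightarrow> 'a set \<Rightarrow> 'a set"  (infixl "\<ominus>" 65)
  where "W \<ominus> N = {x \<in> W. \<forall>y\<in>N. cinner x y = 0}"

definition orth_proj :: "'a::chilbert_space set \<Rightarrow> 'a \<Rightarrow> 'a"
  where "orth_proj W x = (THE p. p \<in> W \<and> x - p \<in> UNIV \<ominus> W)"


section \<open>Operators on closed subspaces\<close>

text \<open>
  A bounded operator on a closed subspace \<open>W\<close> of a Hilbert space is encoded by its extension by zero
  to the orthogonal complement of \<open>W\<close>.  This preserves the operator norm, so the norm topology on
  operators on \<open>W\<close> is the subspace topology from the type of bounded linear maps.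
\<close>

definition op_on :: "'a::chilbert_space set \<Rightarrow> ('a \<Rightarrow> 'a) \<Rightarrow> 'a \<Rightarrow>\<^sub>L 'a"
  where "op_on W T = Blinfun (\<lambda>x. T (orth_proj W x))"

definition unitary_ops :: "'a::chilbert_space set \<Rightarrow> ('a \<Rightarrow>\<^sub>L 'a) set"
  where "unitary_ops W = {u. clinear_on UNIV (blinfun_apply u) \<and>
    blinfun_apply u ` W = W \<and>
    (\<forall>x\<in>W. \<forall>y\<in>W. cinner (blinfun_apply u x) (blinfun_apply u y) = cinner x y) \<and>
    (\<forall>x \<in> UNIV \<ominus> W. blinfun_apply u x = 0)}"

definition fredholm_on :: "'a::chilbert_space set \<Rightarrow> ('a \<Rightarrow> 'a) \<Rightarrow> bool"
  where "fredholm_on W T \<longleftrightarrow>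
    finite_cdim {x \<in> W. T x = 0} \<and> closed (T ` W) \<and> finite_ccodim W (T ` W)"

definition UF :: "'a::chilbert_space set \<Rightarrow> ('a \<Rightarrow>\<^sub>L 'a) set"
  where "UF W = {u \<in> unitary_ops W. fredholm_on W (\<lambda>x. blinfun_apply u x + x)}"

abbreviation UF_top :: "'a::chilbert_space set \<Rightarrow> ('a \<Rightarrow>\<^sub>L 'a) topology"
  where "UF_top W \<equiv> top_of_set (UF W)"

definition continuous_family ::
    "'x topology \<Rightarrow> ('x \<Rightarrow> 'a::chilbert_space set) \<Rightarrow> bool"
  where "continuous_family X L \<longleftrightarrow>
    continuous_map X euclidean (\<lambda>x. Blinfun (orth_proj (L x)))"


section \<open>The group \<open>K\<^sup>1\<close> and the class of a family of unitaries\<close>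

text \<open>
  The type \<open>'k\<close> is the infinite-dimensional separable Hilbert space \<open>H\<close> used to represent \<open>K\<^sup>1(X)\<close> as
  \<open>[X, UF(H)]\<close>.  Elements of \<open>K\<^sup>1(X)\<close> are homotopy classes, as sets of maps.
\<close>

definition htpy_class ::
    "'x topology \<Rightarrow> ('x \<Rightarrow> ('k::chilbert_space \<Rightarrow>\<^sub>L 'k)) \<Rightarrow> ('x \<Rightarrow> ('k \<Rightarrow>\<^sub>L 'k)) set"
  where "htpy_class X f = {g. homotopic_with (\<lambda>_. True) X (UF_top UNIV) f g}"

definition K1 :: "'x topology \<Rightarrow> ('x \<Rightarrow> ('k::chilbert_space \<Rightarrow>\<^sub>L 'k)) set set"
  where "K1 X = htpy_class X ` {f. continuous_map X (UF_top UNIV) f}"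

text \<open>
  For an operator \<open>u\<close> on \<open>W\<close>, this is \<open>u \<oplus> 1\<close> on \<open>W \<oplus> H'\<close>; the space \<open>W \<oplus> H'\<close> is the closed
  subspace \<open>W \<times> UNIV\<close> of the product type.
\<close>

definition oplus_one ::
    "('a::chilbert_space \<Rightarrow>\<^sub>L 'a) \<Rightarrow> ('a \<times> 'k::chilbert_space) \<Rightarrow>\<^sub>L ('a \<times> 'k)"
  where "oplus_one u = Blinfun (\<lambda>(x, y). (blinfun_apply u x, y))"

definition unitary_iso :: "'b::chilbert_space set \<Rightarrow> ('b \<Rightarrow> 'k::chilbert_space) \<Rightarrow> bool"
  where "unitary_iso W \<Phi> \<longleftrightarrow> clinear_on W \<Phi> \<and> \<Phi> ` W = UNIV \<and>
    (\<forall>x\<in>W. \<forall>y\<in>W. cinner (\<Phi> x) (\<Phi> y) = cinner x y)"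

definition conj_op ::
    "'b::chilbert_space set \<Rightarrow> ('b \<Rightarrow> 'k::chilbert_space) \<Rightarrow> ('b \<Rightarrow>\<^sub>L 'b) \<Rightarrow> ('k \<Rightarrow>\<^sub>L 'k)"
  where "conj_op W \<Phi> u = Blinfun (\<lambda>y. \<Phi> (blinfun_apply u (inv_into W \<Phi> y)))"

text \<open>
  The class of \<open>f \<oplus> 1 : X \<rightarrow> UF(W \<oplus> H')\<close>, with \<open>H' = H\<close>.  The spaces \<open>W \<oplus> H'\<close> and \<open>H\<close> are identified
  by a unitary isomorphism; since the unitary group of \<open>H\<close> is connected, the homotopy class does not
  depend on which one is chosen.
\<close>

definition K1_class ::
    "'x topology \<Rightarrow> 'a::chilbert_space set \<Rightarrow> ('x \<Rightarrow> ('a \<Rightarrow>\<^sub>L 'a))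
      \<Rightarrow> ('x \<Rightarrow> ('k::chilbert_space \<Rightarrow>\<^sub>L 'k)) set"
  where "K1_class X W f =
    (let \<Phi> = (SOME \<Phi> :: 'a \<times> 'k \<Rightarrow> 'k. unitary_iso (W \<times> UNIV) \<Phi>)
     in htpy_class X (\<lambda>x. conj_op (W \<times> UNIV) \<Phi> (oplus_one (f x))))"


section \<open>Symplectic Hilbert spaces and Lagrangian subspaces\<close>

definition skew_adjoint_unitary :: "('a::chilbert_space \<Rightarrow> 'a) \<Rightarrow> bool"
  where "skew_adjoint_unitary J \<longleftrightarrow> clinear_on UNIV J \<and> surj J \<and>
    (\<forall>x y. cinner (J x) (J y) = cinner x y) \<and>
    (\<forall>x y. cinner (J x) y = - cinner x (J y))"

definition sform :: "('a::chilbert_space \<Rightarrow> 'a) \<Rightarrow> 'a \<Rightarrow> 'a \<Rightarrow> complex"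
  where "sform J \<xi> \<eta> = cinner (J \<xi>) \<eta>"

definition annihilator :: "'v set \<Rightarrow> ('v \<Rightarrow> 'v \<Rightarrow> complex) \<Rightarrow> 'v set \<Rightarrow> 'v set"
  where "annihilator V \<omega> L = {\<xi> \<in> V. \<forall>\<eta>\<in>L. \<omega> \<xi> \<eta> = 0}"

definition isotropic :: "'v set \<Rightarrow> ('v \<Rightarrow> 'v \<Rightarrow> complex) \<Rightarrow> 'v set \<Rightarrow> bool"
  where "isotropic V \<omega> L \<longleftrightarrow> L \<subseteq> annihilator V \<omega> L"

text \<open>An annihilator is automatically a closed linear subspace, so this need not be demanded.\<close>

definition lagrangian :: "'v set \<Rightarrow> ('v \<Rightarrow> 'v \<Rightarrow> complex) \<Rightarrow> 'v set \<Rightarrow> bool"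
  where "lagrangian V \<omega> L \<longleftrightarrow> L = annihilator V \<omega> L"

definition fredholm_pair :: "'a::chilbert_space set \<Rightarrow> 'a set \<Rightarrow> 'a set \<Rightarrow> bool"
  where "fredholm_pair \<Lambda> L M \<longleftrightarrow>
    closed {x + y |x y. x \<in> L \<and> y \<in> M} \<and> finite_cdim (L \<inter> M) \<and>
    finite_ccodim \<Lambda> {x + y |x y. x \<in> L \<and> y \<in> M}"

definition transversal :: "'a::chilbert_space set \<Rightarrow> 'a set \<Rightarrow> 'a set \<Rightarrow> bool"
  where "transversal M \<Gamma> \<Gamma>s \<longleftrightarrow>
    closed {x + y |x y. x \<in> M \<and> y \<in> \<Gamma>} \<and> M \<inter> \<Gamma> = {0} \<and>
    {x + y |x y. x \<in> M \<and> y \<in> \<Gamma>s} = UNIV"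

text \<open>
  Below, \<open>\<Lambda>\<close> is a closed \<open>J\<close>-invariant subspace, seen as a symplectic Hilbert space of its own.
\<close>

definition pos_part :: "('a::chilbert_space \<Rightarrow> 'a) \<Rightarrow> 'a set \<Rightarrow> 'a set"
  where "pos_part J \<Lambda> = {\<xi> \<in> \<Lambda>. J \<xi> = \<i> *\<^sub>C \<xi>}"

definition neg_part :: "('a::chilbert_space \<Rightarrow> 'a) \<Rightarrow> 'a set \<Rightarrow> 'a set"
  where "neg_part J \<Lambda> = {\<xi> \<in> \<Lambda>. J \<xi> = (- \<i>) *\<^sub>C \<xi>}"

text \<open>The map \<open>u\<^sub>L\<close> whose graph is the Lagrangian subspace \<open>L\<close>; meaningful on \<open>pos_part J \<Lambda>\<close>.\<close>

definition graph_map :: "('a::chilbert_space \<Rightarrow> 'a) \<Rightarrow> 'a set \<Rightarrow> 'a set \<Rightarrow> 'a \<Rightarrow> 'a"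
  where "graph_map J \<Lambda> L \<xi> = (THE \<eta>. \<eta> \<in> neg_part J \<Lambda> \<and> \<xi> + \<eta> \<in> L)"

definition pair_unitary :: "('a::chilbert_space \<Rightarrow> 'a) \<Rightarrow> 'a set \<Rightarrow> 'a set \<Rightarrow> 'a set \<Rightarrow> 'a \<Rightarrow>\<^sub>L 'a"
  where "pair_unitary J \<Lambda> L M =
    op_on (pos_part J \<Lambda>)
      (\<lambda>\<xi>. - inv_into (pos_part J \<Lambda>) (graph_map J \<Lambda> M) (graph_map J \<Lambda> L \<xi>))"

definition ind ::
    "('a::chilbert_space \<Rightarrow> 'a) \<Rightarrow> 'a set \<Rightarrow> 'x topology \<Rightarrow> ('x \<Rightarrow> 'a set) \<Rightarrow> ('x \<Rightarrow> 'a set)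
      \<Rightarrow> ('x \<Rightarrow> ('k::chilbert_space \<Rightarrow>\<^sub>L 'k)) set"
  where "ind J \<Lambda> X L M = K1_class X (pos_part J \<Lambda>) (\<lambda>x. pair_unitary J \<Lambda> (L x) (M x))"


section \<open>Symplectic reduction\<close>

abbreviation ann :: "('a::chilbert_space \<Rightarrow> 'a) \<Rightarrow> 'a set \<Rightarrow> 'a set"
  where "ann J \<Gamma> \<equiv> annihilator UNIV (sform J) \<Gamma>"

definition quot_map :: "'a::chilbert_space set \<Rightarrow> 'a \<Rightarrow> 'a set"
  where "quot_map \<Gamma> \<xi> = {\<xi> + \<zeta> |\<zeta>. \<zeta> \<in> \<Gamma>}"

definition quot_space :: "('a::chilbert_space \<Rightarrow> 'a) \<Rightarrow> 'a set \<Rightarrow> 'a set set"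
  where "quot_space J \<Gamma> = quot_map \<Gamma> ` ann J \<Gamma>"

definition quot_sform :: "('a::chilbert_space \<Rightarrow> 'a) \<Rightarrow> 'a set \<Rightarrow> 'a set \<Rightarrow> complex"
  where "quot_sform J A B = (THE c. \<forall>\<xi>\<in>A. \<forall>\<eta>\<in>B. sform J \<xi> \<eta> = c)"

definition quot_pull :: "('a::chilbert_space \<Rightarrow> 'a) \<Rightarrow> 'a set \<Rightarrow> 'a set set \<Rightarrow> 'a set"
  where "quot_pull J \<Gamma> L = {\<xi> \<in> ann J \<Gamma>. quot_map \<Gamma> \<xi> \<in> L}"

definition quot_push :: "('a::chilbert_space \<Rightarrow> 'a) \<Rightarrow> 'a set \<Rightarrow> 'a set \<Rightarrow> 'a set set"
  where "quot_push J \<Gamma> M = quot_map \<Gamma> ` (M \<inter> ann J \<Gamma>)"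

text \<open>
  The Hilbert space structure and the operator \<open>J\<close> of the quotient are those of the orthogonal
  complement of \<open>\<Gamma>\<close> in its annihilator, with which the quotient is identified by means of the
  quotient map.  A subset \<open>S\<close> of the quotient corresponds to \<open>quot_lift J \<Gamma> S\<close>.
\<close>

definition quot_model :: "('a::chilbert_space \<Rightarrow> 'a) \<Rightarrow> 'a set \<Rightarrow> 'a set"
  where "quot_model J \<Gamma> = ann J \<Gamma> \<ominus> \<Gamma>"

definition quot_lift :: "('a::chilbert_space \<Rightarrow> 'a) \<Rightarrow> 'a set \<Rightarrow> 'a set set \<Rightarrow> 'a set"
  where "quot_lift J \<Gamma> S = {\<xi> \<in> quot_model J \<Gamma>. quot_map \<Gamma> \<xi> \<in> S}"

lemma quot_sform_quot_map:
  assumes J: "skew_adjoint_unitary J" and "csubspace \<Gamma>" and iso: "isotropic UNIV (sform J) \<Gamma>"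
    and \<xi>: "\<xi> \<in> ann J \<Gamma>" and \<eta>: "\<eta> \<in> ann J \<Gamma>"
  shows "quot_sform J (quot_map \<Gamma> \<xi>) (quot_map \<Gamma> \<eta>) = sform J \<xi> \<eta>"
proof -
  have J_add: "J (x + y) = J x + J y" for x y
    using J by (auto simp: skew_adjoint_unitary_def clinear_on_def)
  have add_left: "sform J (x + y) z = sform J x z + sform J y z" for x y z
    by (simp add: sform_def J_add cinner_add_left)
  have skew: "sform J x y = - cnj (sform J y x)" for x y
    using J cinner_commute[of x "J y"] by (auto simp: skew_adjoint_unitary_def sform_def)
  have add_right: "sform J x (y + z) = sform J x y + sform J x z" for x y z
    by (subst (1 2 3) skew) (simp add: add_left)
  have vanish: "sform J x y = 0" if "x \<in> ann J \<Gamma>" "y \<in> \<Gamma>" for x y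
    using that by (auto simp: annihilator_def)
  have vanish': "sform J y x = 0" if "x \<in> ann J \<Gamma>" "y \<in> \<Gamma>" for x y
    using vanish[OF that] by (subst skew) simp
  have sub: "\<Gamma> \<subseteq> ann J \<Gamma>" using iso by (simp add: isotropic_def)
  have val: "sform J (\<xi> + a) (\<eta> + b) = sform J \<xi> \<eta>" if "a \<in> \<Gamma>" "b \<in> \<Gamma>" for a b
    using that sub \<xi> \<eta> by (auto simp: add_left add_right vanish vanish')
  have zero: "0 \<in> \<Gamma>" using assms(2) by (rule complex_vector.subspace_0)
  show ?thesis
    unfolding quot_sform_def
  proof (rule the_equality)
    show "\<forall>x\<in>quot_map \<Gamma> \<xi>. \<forall>y\<in>quot_map \<Gamma> \<eta>. sform J x y = sform J \<xi> \<eta>"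
      by (auto simp: quot_map_def val)
    have "\<xi> \<in> quot_map \<Gamma> \<xi>" "\<eta> \<in> quot_map \<Gamma> \<eta>"
      using zero by (force simp: quot_map_def)+
    then show "c = sform J \<xi> \<eta>"
      if "\<forall>x\<in>quot_map \<Gamma> \<xi>. \<forall>y\<in>quot_map \<Gamma> \<eta>. sform J x y = c" for c
      using that by simp
  qed
qed

end

theory Submission
  imports Defs
begin

text \<open>
  Let \<open>\<rho>\<^sub>L = 2 P\<^sub>L - 1\<close> be the reflection in a Lagrangian \<open>L\<close>.  It anticommutes with \<open>J\<close> and restricts to
  \<open>u\<^sub>L\<close> on \<open>\<Lambda>\<^sup>+\<close> and to its inverse on \<open>\<Lambda>\<^sup>-\<close>, so that \<open>- u\<^sub>M\<inverse> u\<^sub>L\<close> is the restriction of \<open>- \<rho>\<^sub>M \<rho>\<^sub>L\<close>.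
  Decompose the positive part of the whole space as \<open>P \<oplus> Q\<close> with \<open>Q\<close> the positive part of
  \<open>\<Gamma>\<^sup>* \<ominus> \<Gamma>\<close>.  If \<open>U\<close> is the unitary of the pair \<open>(\<gamma>\<inverse>L, M)\<close> and \<open>f\<close> that of the reduced pair, then for every
  \<open>q \<in> Q\<close> there is \<open>a \<in> P\<close> with \<open>U (a + q) = - a + f q\<close>: the reduced unitary arises from \<open>U\<close> by closing a feedback
  loop through \<open>P\<close>.  Transversality and the uniform boundedness principle bound \<open>1 + U\<close> from below on \<open>P\<close>, which
  makes the loop solvable.

  In the coordinates \<open>s = x + y\<close>, \<open>d = x - y\<close> on the graph \<open>y = p U (x + q)\<close> of the \<open>P\<close>-component, the rescaling
  \<open>(s, d) \<mapsto> (s / t, t d)\<close> preserves the indefinite form that expresses unitarity and does not change the reduced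
  unitary.  For \<open>0 \<le> t \<le> 1\<close> it gives a path of unitaries from \<open>1 \<oplus> f\<close> to \<open>U\<close> all of whose members \<open>u\<close> have
  \<open>u + 1\<close> equal to \<open>f + 1\<close> up to invertible factors, hence Fredholm.

  Finally \<open>1 \<oplus> f\<close> and \<open>f\<close> differ only in the isometry used to embed \<open>Q\<close> into the auxiliary space, and any two such
  isometries with infinite-dimensional cokernels are connected by rotations.
\<close>

\<comment> \<open>Fredholmness of the pair \<open>(\<gamma>\<inverse>L, M)\<close> is not derived
  from the geometry: it comes out at \<open>t = 1\<close>, because the whole path inherits it from
  \<open>f\<close>. The lower bound for \<open>1 + U\<close> on \<open>P\<close> is a positive angle
  between \<open>\<Gamma>\<close> and \<open>M\<close>: for \<open>v\<close> in \<open>P\<close>,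
  the sum \<open>g\<close> of \<open>v\<close> and its reflection in
  \<open>\<gamma>\<inverse>L\<close> lies in \<open>\<Gamma>\<close>, and \<open>v + U v\<close> is
  the difference of \<open>g\<close> and an element of \<open>M\<close>. One bound serves all points
  of \<open>X\<close>, which keeps the inverses along the path continuous.

  The obstacle at \<open>t = 0\<close> is the division of the sum by \<open>t\<close>. It disappears
  when each unitary of the path is given by its graph, parametrised by the rescaled sum together
  with \<open>q\<close>. The price is that the domain component of the graph has to be shown
  bijective: preservation of the form bounds it below by 1/2 uniformly in \<open>t\<close>, and
  surjectivity spreads from \<open>t = 1\<close>.

  The arbitrary isomorphism chosen in \<open>K1_class\<close> matters only through the isometry of
  \<open>W\<close> into \<open>H\<close> that it induces.\<close>
subclass (in chilbert_space) banach ..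

section \<open>Calculus of the complex inner product\<close>

lemma cinner_add_right: "cinner x (y + z) = cinner x y + cinner x z"
  by (subst (1 2 3) cinner_commute) (simp add: cinner_add_left)

lemma cinner_scaleC_right: "cinner x (a *\<^sub>C y) = cnj a * cinner x y"
  by (subst (1 2) cinner_commute) (simp add: cinner_scaleC_left)

lemma cinner_zero_left [simp]: "cinner 0 x = 0"
  using cinner_add_left[of 0 0 x] by simp

lemma cinner_zero_right [simp]: "cinner x 0 = 0"
  using cinner_add_right[of x 0 0] by simp

lemma cinner_minus_left: "cinner (- x) y = - cinner x y"
  using cinner_add_left[of x "- x" y] by (simp add: add_eq_0_iff)

lemma cinner_minus_right: "cinner x (- y) = - cinner x y"
  using cinner_add_right[of x y "- y"] by (simp add: add_eq_0_iff)

lemma cinner_diff_left: "cinner (x - y) z = cinner x z - cinner y z"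
  using cinner_add_left[of x "- y" z] by (simp add: cinner_minus_left)

lemma cinner_diff_right: "cinner x (y - z) = cinner x y - cinner x z"
  using cinner_add_right[of x y "- z"] by (simp add: cinner_minus_right)

lemma cinner_scaleR_left: "cinner (r *\<^sub>R x) y = r * cinner x y"
  by (simp add: scaleR_scaleC cinner_scaleC_left)

lemma cinner_scaleR_right: "cinner x (r *\<^sub>R y) = r * cinner x y"
  by (simp add: scaleR_scaleC cinner_scaleC_right)

lemmas cinner_simps = cinner_add_left cinner_add_right cinner_diff_left cinner_diff_right
  cinner_minus_left cinner_minus_right cinner_scaleC_left cinner_scaleC_right
  cinner_scaleR_left cinner_scaleR_right

lemma scaleC_minus_right: "a *\<^sub>C (- x) = - (a *\<^sub>C (x :: 'a::chilbert_space))"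
  by (rule complex_vector.scale_minus_right)

lemma scaleC_diff_right: "a *\<^sub>C (x - y) = a *\<^sub>C x - a *\<^sub>C (y :: 'a::chilbert_space)"
  by (rule complex_vector.scale_right_diff_distrib)

lemma scaleC_zero_right [simp]: "a *\<^sub>C 0 = (0 :: 'a::chilbert_space)"
  by (rule complex_vector.scale_zero_right)

lemma scaleC_scaleR: "a *\<^sub>C (r *\<^sub>R x) = r *\<^sub>R (a *\<^sub>C (x :: 'a::chilbert_space))"
  by (simp add: scaleR_scaleC scaleC_scaleC mult.commute)

text \<open>The imaginary part is a real inner product with \<open>\<i> *\<^sub>C y\<close>. Facts
  known for real inner products, such as polarisation and orthogonality of nearest points, pass to
  the complex form this way.\<close>

lemma cinner_eq_Complex: "cinner x y = Complex (inner x y) (inner x (\<i> *\<^sub>C y))"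
  by (simp add: complex_eq_iff inner_eq_Re_cinner cinner_scaleC_right)

lemma cinner_same: "cinner x x = complex_of_real ((norm x)\<^sup>2)"
proof -
  have "cinner x x = cnj (cinner x x)" by (rule cinner_commute)
  then have "Im (cinner x x) = 0" by (metis cnj.sel(2) equation_minus_iff neg_equal_zero)
  then show ?thesis
    by (simp add: complex_eq_iff power2_norm_eq_inner inner_eq_Re_cinner)
qed

lemma norm_scaleC: "norm (a *\<^sub>C x) = cmod a * norm (x :: 'a::chilbert_space)"
proof -
  have "complex_of_real ((norm (a *\<^sub>C x))\<^sup>2) = complex_of_real ((cmod a * norm x)\<^sup>2)"
    by (simp only: cinner_same[symmetric] cinner_scaleC_left cinner_scaleC_right)
      (simp add: cinner_same power_mult_distrib complex_norm_square mult_ac flip: of_real_power)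
  then show ?thesis by (metis norm_ge_zero mult_nonneg_nonneg of_real_eq_iff power2_eq_imp_eq)
qed

lemma bounded_linear_scaleC: "bounded_linear (\<lambda>x :: 'a::chilbert_space. a *\<^sub>C x)"
  by (rule bounded_linear_intro[where K = "cmod a"])
    (simp_all add: scaleC_add_right scaleC_scaleR norm_scaleC mult.commute)

text \<open>Multiplying \<open>x\<close> by a phase makes the inner product real and nonnegative, so
  the real Cauchy-Schwarz inequality applies.\<close>

lemma norm_cinner_le: "cmod (cinner x y) \<le> norm x * norm y"
proof (cases "cinner x y = 0")
  case False
  define c where "c = cnj (cinner x y) / cmod (cinner x y)"
  have c: "cmod c = 1" using False by (simp add: c_def norm_divide)
  have "c * cinner x y = cmod (cinner x y)"
    using False by (simp add: c_def mult.commute[of "cnj _"] complex_norm_square[symmetric] power2_eq_square)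
  then have "cmod (cinner x y) = inner (c *\<^sub>C x) y"
    by (simp add: inner_eq_Re_cinner cinner_scaleC_left)
  also have "\<dots> \<le> norm (c *\<^sub>C x) * norm y" by (rule norm_cauchy_schwarz)
  finally show ?thesis by (simp add: norm_scaleC c)
qed simp

lemma bounded_linear_cinner_left: "bounded_linear (\<lambda>x. cinner x y)"
  by (rule bounded_linear_intro[where K = "norm y"])
    (simp_all add: cinner_simps norm_cinner_le scaleR_conv_of_real)

lemma bounded_linear_cinner_right: "bounded_linear (\<lambda>y. cinner x y)"
proof (rule bounded_linear_intro[where K = "norm x"])
  show "cmod (cinner x y) \<le> norm y * norm x" for y
    using norm_cinner_le[of x y] by (simp add: mult.commute)
qed (simp_all add: cinner_simps scaleR_conv_of_real)

lemma norm_add_orth: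
  assumes "cinner x y = 0"
  shows "(norm (x + y))\<^sup>2 = (norm x)\<^sup>2 + (norm y)\<^sup>2"
  using assms by (simp add: power2_norm_eq_inner inner_eq_Re_cinner cinner_simps cinner_commute[of y x])

lemma cinner_preserving:
  assumes "\<And>x. x \<in> W \<Longrightarrow> norm (f x) = norm x"
    and "csubspace W" and "clinear_on W f" and "x \<in> W" "y \<in> W"
  shows "cinner (f x) (f y) = cinner x y"
proof -
  have add: "f (x + y) = f x + f y" if "x \<in> W" "y \<in> W" for x y
    using assms(3) that by (auto simp: clinear_on_def)
  have inner: "inner (f x) (f y) = inner x y" if "x \<in> W" "y \<in> W" for x y
    using that complex_vector.subspace_add[OF assms(2) that]
    by (simp add: dot_norm add[symmetric] assms(1))
  have "\<i> *\<^sub>C y \<in> W" "f (\<i> *\<^sub>C y) = \<i> *\<^sub>C f y"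
    using assms complex_vector.subspace_scale[OF assms(2)] by (auto simp: clinear_on_def)
  then show ?thesis
    unfolding cinner_eq_Complex using assms inner by metis
qed

lemma csubspace_imp_subspace: "csubspace W \<Longrightarrow> subspace W"
  unfolding complex_vector.subspace_def real_vector.subspace_def scaleR_scaleC by auto

lemmas csubspace_0 = complex_vector.subspace_0
lemmas csubspace_add = complex_vector.subspace_add
lemmas csubspace_diff = complex_vector.subspace_diff
lemmas csubspace_scale = complex_vector.subspace_scale
lemmas csubspace_neg = complex_vector.subspace_neg

lemma csubspace_scaleR: "csubspace W \<Longrightarrow> x \<in> W \<Longrightarrow> r *\<^sub>R x \<in> W"
  by (simp add: scaleR_scaleC csubspace_scale)

section \<open>Projections\<close>

text \<open>The almost nearest points form nested closed sets \<open>S n\<close>. By the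
  parallelogram law their diameters tend to 0, so completeness provides a common point.\<close>

lemma nearest_point_exists:
  fixes W :: "'a::{real_inner, complete_space} set"
  assumes "closed W" "subspace W"
  shows "\<exists>p\<in>W. \<forall>w\<in>W. norm (x - p) \<le> norm (x - w)"
proof -
  have W0: "0 \<in> W" using assms(2) by (rule subspace_0)
  define d where "d = (INF w\<in>W. norm (x - w))"
  have bdd: "bdd_below ((\<lambda>w. norm (x - w)) ` W)" by (rule bdd_belowI[of _ 0]) auto
  have d_le: "d \<le> norm (x - w)" if "w \<in> W" for w
    unfolding d_def using bdd that by (rule cINF_lower)
  have d0: "0 \<le> d" unfolding d_def using W0 by (intro cINF_greatest) auto
  define S where "S n = W \<inter> {w. norm (x - w) \<le> d + inverse (real (Suc n))}" for n
  have "closed (S n)" for n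
    unfolding S_def by (intro closed_Int assms closed_Collect_le continuous_intros)
  moreover have "S n \<noteq> {}" for n
  proof -
    have "\<exists>w\<in>W. norm (x - w) < d + inverse (real (Suc n))"
      unfolding d_def using W0 bdd by (subst cINF_less_iff[symmetric]) auto
    then show ?thesis by (force simp: S_def)
  qed
  moreover have "S n \<subseteq> S m" if "m \<le> n" for m n
  proof -
    have "inverse (real (Suc n)) \<le> inverse (real (Suc m))" using that by (simp add: le_imp_inverse_le)
    then have "norm (x - w) \<le> d + inverse (real (Suc m))" if "norm (x - w) \<le> d + inverse (real (Suc n))" for w
      using that by linarith
    then show ?thesis unfolding S_def by blast
  qed
  moreover have "\<exists>n. \<forall>u\<in>S n. \<forall>v\<in>S n. dist u v < \<epsilon>" if "\<epsilon> > 0" for \<epsilon>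
  proof -
    \<comment> \<open>If \<open>u\<close> and \<open>v\<close> are within \<open>d + e\<close> of
      \<open>x\<close>, the parallelogram law bounds their squared distance by
      \<open>4 * ((2 * d + e) * e)\<close>. The first bound in \<open>min\<close> gives
      \<open>e < 1\<close>, the second makes the result smaller than the square of
      \<open>\<epsilon>\<close>.\<close>
    have "\<exists>n. inverse (real (Suc n)) < min 1 (\<epsilon>\<^sup>2 / (4 * (2 * d + 1)))"
      by (rule reals_Archimedean) (use that d0 in auto)
    then obtain n where n: "inverse (real (Suc n)) < 1" "inverse (real (Suc n)) < \<epsilon>\<^sup>2 / (4 * (2 * d + 1))"
      by auto
    define e where "e = inverse (real (Suc n))"
    have e: "0 < e" "e < 1" "4 * ((2 * d + 1) * e) < \<epsilon>\<^sup>2"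
    proof -
      show "0 < e" by (simp add: e_def)
      show "e < 1" using n by (simp only: e_def)
      have "e * (4 * (2 * d + 1)) < \<epsilon>\<^sup>2"
        using n(2)[folded e_def] d0 pos_less_divide_eq[of "4 * (2 * d + 1)" e "\<epsilon>\<^sup>2"] by simp
      then show "4 * ((2 * d + 1) * e) < \<epsilon>\<^sup>2" by (simp only: mult_ac)
    qed
    have "dist u v < \<epsilon>" if "u \<in> S n" "v \<in> S n" for u v
    proof -
      have uv: "u \<in> W" "v \<in> W" "norm (x - u) \<le> d + e" "norm (x - v) \<le> d + e"
        using that by (auto simp: S_def e_def)
      have par: "(norm (u - v))\<^sup>2 = 2 * (norm (x - u))\<^sup>2 + 2 * (norm (x - v))\<^sup>2
          - 4 * (norm (x - (1/2) *\<^sub>R (u + v)))\<^sup>2"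
        by (simp add: power2_norm_eq_inner algebra_simps inner_commute)
      have "(1/2) *\<^sub>R (u + v) \<in> W" using uv assms(2) by (simp add: subspace_add subspace_scale)
      then have "d\<^sup>2 \<le> (norm (x - (1/2) *\<^sub>R (u + v)))\<^sup>2" using d_le d0 by (simp add: power_mono)
      moreover have "(norm (x - u))\<^sup>2 \<le> (d + e)\<^sup>2" "(norm (x - v))\<^sup>2 \<le> (d + e)\<^sup>2"
        using uv by (simp_all add: power_mono)
      ultimately have "(norm (u - v))\<^sup>2 \<le> 4 * (d + e)\<^sup>2 - 4 * d\<^sup>2" using par by linarith
      also have "\<dots> = 4 * ((2 * d + e) * e)" by (simp add: power2_eq_square algebra_simps)
      also have "\<dots> \<le> 4 * ((2 * d + 1) * e)" using e by simp
      also have "\<dots> < \<epsilon>\<^sup>2" by fact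
      finally show ?thesis using \<open>\<epsilon> > 0\<close> by (simp add: dist_norm power2_less_imp_less)
    qed
    then show ?thesis by blast
  qed
  ultimately obtain a where a: "\<And>n. a \<in> S n" by (rule decreasing_closed_nest) blast+
  have "norm (x - a) \<le> d"
  proof (rule field_le_epsilon)
    fix \<epsilon> :: real assume "\<epsilon> > 0"
    then obtain n where "inverse (real (Suc n)) < \<epsilon>" using reals_Archimedean by blast
    then show "norm (x - a) \<le> d + \<epsilon>" using a[of n] by (auto simp: S_def)
  qed
  then show ?thesis using a[of 0] d_le by (force simp: S_def)
qed

lemma orth_proj_exists:
  assumes "closed W" "csubspace W"
  shows "\<exists>!p. p \<in> W \<and> x - p \<in> UNIV \<ominus> W"
proof -
  obtain p where p: "p \<in> W" "\<forall>w\<in>W. norm (x - p) \<le> norm (x - w)"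
    using nearest_point_exists csubspace_imp_subspace assms by metis
  have real_orth: "inner (x - p) w = 0" if "w \<in> W" for w
  proof -
    \<comment> \<open>The minimiser of the quadratic polynomial that gives the squared distance from
      \<open>x\<close> to \<open>p + t *\<^sub>R w\<close>.\<close>
    define t where "t = inner (x - p) w / (norm w)\<^sup>2"
    have "p + t *\<^sub>R w \<in> W" using p(1) that assms(2) by (simp add: csubspace_add csubspace_scaleR)
    then have "norm (x - p) \<le> norm (x - (p + t *\<^sub>R w))" using p(2) by blast
    then have "(norm (x - p))\<^sup>2 \<le> (norm (x - (p + t *\<^sub>R w)))\<^sup>2" by (simp add: power_mono)
    also have "\<dots> = (norm (x - p))\<^sup>2 - 2 * t * inner (x - p) w + t\<^sup>2 * (norm w)\<^sup>2"
      by (simp add: power2_norm_eq_inner power2_eq_square[of t] algebra_simps inner_commute)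
    finally have "2 * t * inner (x - p) w \<le> t\<^sup>2 * (norm w)\<^sup>2" by simp
    then have "(inner (x - p) w)\<^sup>2 \<le> 0" if "w \<noteq> 0"
      using that by (simp add: t_def field_simps power2_eq_square)
    then show ?thesis by (cases "w = 0") auto
  qed
  have orth: "cinner (x - p) w = 0" if "w \<in> W" for w
    using real_orth that csubspace_scale[OF assms(2) that] by (simp add: cinner_eq_Complex complex_eq_iff)
  show ?thesis
  proof (rule ex1I)
    show "p \<in> W \<and> x - p \<in> UNIV \<ominus> W" using p orth by (simp add: orth_diff_def)
    fix q assume q: "q \<in> W \<and> x - q \<in> UNIV \<ominus> W"
    have "p - q \<in> W" using q p assms(2) by (simp add: csubspace_diff)
    then have "cinner (x - p) (p - q) = 0" "cinner (x - q) (p - q) = 0"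
      using q orth by (auto simp: orth_diff_def)
    moreover have "p - q = (x - q) - (x - p)" by simp
    ultimately have "cinner (p - q) (p - q) = 0" by (metis cinner_diff_left diff_self)
    then show "q = p" by (simp add: cinner_same)
  qed
qed

context
  fixes W :: "'a::chilbert_space set"
  assumes W: "closed W" "csubspace W"
begin

lemma orth_proj_in: "orth_proj W x \<in> W"
  and orth_proj_orth: "y \<in> W \<Longrightarrow> cinner (x - orth_proj W x) y = 0"
  using theI'[OF orth_proj_exists[OF W, of x]] by (auto simp: orth_proj_def orth_diff_def)

lemma orth_proj_eqI: "p \<in> W \<Longrightarrow> (\<And>y. y \<in> W \<Longrightarrow> cinner (x - p) y = 0) \<Longrightarrow> orth_proj W x = p"
  unfolding orth_proj_def by (rule the1_equality[OF orth_proj_exists[OF W]]) (simp add: orth_diff_def)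

lemma orth_proj_same: "x \<in> W \<Longrightarrow> orth_proj W x = x"
  by (rule orth_proj_eqI) auto

lemma orth_proj_zero: "(\<And>y. y \<in> W \<Longrightarrow> cinner x y = 0) \<Longrightarrow> orth_proj W x = 0"
  by (rule orth_proj_eqI) (auto simp: csubspace_0[OF W(2)])

lemma orth_proj_add: "orth_proj W (x + y) = orth_proj W x + orth_proj W y"
proof (rule orth_proj_eqI)
  fix z assume "z \<in> W"
  then show "cinner (x + y - (orth_proj W x + orth_proj W y)) z = 0"
    using orth_proj_orth[of z x] orth_proj_orth[of z y] by (simp add: cinner_simps)
qed (simp add: orth_proj_in csubspace_add[OF W(2)])

lemma orth_proj_scaleC: "orth_proj W (c *\<^sub>C x) = c *\<^sub>C orth_proj W x"
proof (rule orth_proj_eqI)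
  fix z assume "z \<in> W"
  then show "cinner (c *\<^sub>C x - c *\<^sub>C orth_proj W x) z = 0"
    using orth_proj_orth[of z x] by (simp add: cinner_simps right_diff_distrib[symmetric])
qed (simp add: orth_proj_in csubspace_scale[OF W(2)])

lemma orth_proj_diff: "orth_proj W (x - y) = orth_proj W x - orth_proj W y"
  using orth_proj_add[of "x - y" y] by simp

lemma cinner_orth_proj: "cinner (orth_proj W x) y = cinner x (orth_proj W y)"
proof -
  have "cinner (y - orth_proj W y) (orth_proj W x) = 0" using orth_proj_in orth_proj_orth by blast
  then have "cinner (orth_proj W x) (y - orth_proj W y) = 0" by (subst cinner_commute) simp
  moreover have "cinner (x - orth_proj W x) (orth_proj W y) = 0" using orth_proj_in orth_proj_orth by blast
  ultimately show ?thesis by (simp add: cinner_simps)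
qed

lemma norm_orth_proj: "(norm x)\<^sup>2 = (norm (orth_proj W x))\<^sup>2 + (norm (x - orth_proj W x))\<^sup>2"
proof -
  have "cinner (orth_proj W x) (x - orth_proj W x) = 0"
    using orth_proj_orth[OF orth_proj_in, of x x] cinner_commute[of "orth_proj W x" "x - orth_proj W x"] by simp
  from norm_add_orth[OF this] show ?thesis by simp
qed

lemma norm_orth_proj_le: "norm (orth_proj W x) \<le> norm x"
proof (rule power2_le_imp_le)
  show "(norm (orth_proj W x))\<^sup>2 \<le> (norm x)\<^sup>2" unfolding norm_orth_proj[of x] by simp
qed simp

lemma bounded_linear_orth_proj: "bounded_linear (orth_proj W)"
  by (rule bounded_linear_intro[where K = 1])
    (simp_all add: orth_proj_add scaleR_scaleC orth_proj_scaleC norm_orth_proj_le)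

end

definition cproj :: "'a::chilbert_space set \<Rightarrow> 'a \<Rightarrow>\<^sub>L 'a"
  where "cproj W = Blinfun (orth_proj W)"

lemma cproj_apply: "closed W \<Longrightarrow> csubspace W \<Longrightarrow> cproj W x = orth_proj W x"
  unfolding cproj_def by (simp add: bounded_linear_orth_proj bounded_linear_Blinfun_apply)

lemma clinear_onI:
  assumes "\<And>x y. T (x + y) = T x + T y" "\<And>c x. T (c *\<^sub>C x) = c *\<^sub>C T x"
  shows "clinear_on W T"
  using assms by (simp add: clinear_on_def)

section \<open>Finite dimension\<close>

lemma finite_cdim_mono: "finite_cdim W \<Longrightarrow> V \<subseteq> W \<Longrightarrow> finite_cdim V"
  unfolding finite_cdim_def by blast

lemma span_image:
  assumes f: "\<And>x y. f (x + y) = f x + f y" "\<And>c x. f (c *\<^sub>C x) = c *\<^sub>C f x"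
    and "x \<in> cspan (B :: 'a::chilbert_space set)"
  shows "f x \<in> cspan (f ` B :: 'b::chilbert_space set)"
  using assms(3)
proof (induction rule: complex_vector.span_induct_alt)
  case base
  have "f 0 = 0" using f(1)[of 0 0] by simp
  then show ?case by (simp add: complex_vector.span_zero)
next
  case (step c x y)
  then show ?case
    by (simp add: f complex_vector.span_add complex_vector.span_scale complex_vector.span_base)
qed

lemma finite_cdim_image:
  assumes "\<And>x y. f (x + y) = f x + f y" "\<And>c x. f (c *\<^sub>C x) = c *\<^sub>C f x" "finite_cdim W"
  shows "finite_cdim (f ` W)"
proof -
  obtain B where B: "finite B" "W \<subseteq> cspan B" using assms(3) by (auto simp: finite_cdim_def)
  have "f ` W \<subseteq> cspan (f ` B)" using span_image[OF assms(1,2)] B by blast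
  then show ?thesis using B(1) unfolding finite_cdim_def by blast
qed

text \<open>One linear condition lowers the dimension by at most one: a vector violating it spans,
  together with the solutions, the whole space. This guarantees that Gram-Schmidt never runs out of
  vectors.\<close>

lemma orth_compl_not_finite:
  assumes "csubspace E" "\<not> finite_cdim E" "finite F"
  shows "\<not> finite_cdim (E \<inter> {x. \<forall>f\<in>F. cinner x f = 0})"
  using assms(3)
proof (induction F)
  case empty
  then show ?case using assms by simp
next
  case (insert f F)
  let ?E = "E \<inter> {x. \<forall>f\<in>F. cinner x f = 0}"
  have sub: "csubspace ?E"
    using assms(1) by (auto simp: complex_vector.subspace_def cinner_simps)
  show ?case
  proof
    assume "finite_cdim (E \<inter> {x. \<forall>f\<in>insert f F. cinner x f = 0})"
    then obtain B where B: "finite B" "?E \<inter> {x. cinner x f = 0} \<subseteq> cspan B"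
      by (auto simp: finite_cdim_def)
    show False
    proof (cases "\<exists>a\<in>?E. cinner a f \<noteq> 0")
      case True
      then obtain a where a: "a \<in> ?E" "cinner a f \<noteq> 0" by blast
      have "?E \<subseteq> cspan (insert a B)"
      proof
        fix x assume x: "x \<in> ?E"
        let ?c = "cinner x f / cinner a f"
        have "x - ?c *\<^sub>C a \<in> ?E"
          using csubspace_diff[OF sub x csubspace_scale[OF sub a(1)]] .
        moreover have "cinner (x - ?c *\<^sub>C a) f = 0" using a(2) by (simp add: cinner_simps)
        ultimately have "x - ?c *\<^sub>C a \<in> cspan B" using B(2) by blast
        then show "x \<in> cspan (insert a B)" unfolding complex_vector.span_insert by blast
      qed
      then show False using insert.IH B(1) unfolding finite_cdim_def by blast
    next
      case False
      then have "?E \<subseteq> cspan B" using B by blast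
      then show False using insert.IH B(1) unfolding finite_cdim_def by blast
    qed
  qed
qed

text \<open>The difficulty is that \<open>B\<close> may lie outside \<open>V\<close>, whereas
  \<open>finite_ccodim\<close> asks for vectors of \<open>V\<close>. Each \<open>b\<close> is traded
  for some \<open>a\<close> in \<open>V\<close> with a nonzero \<open>b\<close>-component modulo the
  remaining span, or dropped if there is none.\<close>

lemma finite_ccodim_Int:
  assumes "csubspace N" "csubspace V" "V \<subseteq> cspan (N \<union> B)" "finite B"
  shows "finite_ccodim V (N \<inter> V)"
  using assms(4,2,3) unfolding finite_ccodim_def
proof (induction B arbitrary: V)
  case empty
  then have "V \<subseteq> N" using assms(1) by (simp add: complex_vector.span_eq_iff[THEN iffD2])
  then show ?case by (intro exI[of _ "{}"]) (auto intro: complex_vector.span_base)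
next
  case (insert b B)
  let ?V = "V \<inter> cspan (N \<union> B)"
  have "csubspace ?V" using insert.prems by (simp add: complex_vector.subspace_inter)
  then obtain C where C: "finite C" "C \<subseteq> ?V" "?V \<subseteq> cspan (N \<inter> ?V \<union> C)"
    using insert.IH[of ?V] by blast
  have C': "?V \<subseteq> cspan (N \<inter> V \<union> C)"
    using C(3) complex_vector.span_mono[of "N \<inter> ?V \<union> C" "N \<inter> V \<union> C"] by blast
  have ins: "V \<subseteq> cspan (insert b (N \<union> B))" using insert.prems(2) by simp
  show ?case
  proof (cases "V \<subseteq> cspan (N \<union> B)")
    case True
    then show ?thesis using C C' by (intro exI[of _ C]) blast
  next
    case False
    then obtain a where a: "a \<in> V" "a \<notin> cspan (N \<union> B)" by blast
    obtain \<beta> where \<beta>: "a - \<beta> *\<^sub>C b \<in> cspan (N \<union> B)"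
      using a ins unfolding complex_vector.span_insert by blast
    have "\<beta> \<noteq> 0" using \<beta> a(2) by auto
    have "V \<subseteq> cspan (N \<inter> V \<union> insert a C)"
    proof
      fix x assume x: "x \<in> V"
      obtain c where c: "x - c *\<^sub>C b \<in> cspan (N \<union> B)"
        using x ins unfolding complex_vector.span_insert by blast
      have "x - (c / \<beta>) *\<^sub>C a = (x - c *\<^sub>C b) - (c / \<beta>) *\<^sub>C (a - \<beta> *\<^sub>C b)"
        using \<open>\<beta> \<noteq> 0\<close> by (simp add: scaleC_diff_right scaleC_scaleC)
      then have "x - (c / \<beta>) *\<^sub>C a \<in> cspan (N \<union> B)"
        using c \<beta> by (metis complex_vector.span_diff complex_vector.span_scale)
      then have "x - (c / \<beta>) *\<^sub>C a \<in> cspan (N \<inter> V \<union> C)"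
        using C' x a(1) insert.prems(1) csubspace_diff csubspace_scale by blast
      then show "x \<in> cspan (N \<inter> V \<union> insert a C)"
        by (simp add: complex_vector.span_insert) blast
    qed
    then show ?thesis using C a(1) by (intro exI[of _ "insert a C"]) blast
  qed
qed

section \<open>Orthonormal sequences\<close>

definition orthonormal_seq :: "(nat \<Rightarrow> 'a::chilbert_space) \<Rightarrow> bool"
  where "orthonormal_seq e \<longleftrightarrow> (\<forall>m n. cinner (e m) (e n) = (if m = n then 1 else 0))"

lemma cinner_eq_0_commute: "cinner x y = 0 \<longleftrightarrow> cinner y x = 0"
  by (metis cinner_commute complex_cnj_zero_iff)

lemma closed_orth_set: "closed {x. \<forall>f\<in>F. cinner x f = 0}"
proof -
  have "closed (\<Inter>f\<in>F. {x. cinner x f = 0})"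
    by (intro closed_INT ballI closed_Collect_eq linear_continuous_on
      bounded_linear_cinner_left continuous_on_const)
  moreover have "(\<Inter>f\<in>F. {x. cinner x f = 0}) = {x. \<forall>f\<in>F. cinner x f = 0}" by blast
  ultimately show ?thesis by simp
qed

lemma csubspace_orth_set: "csubspace {x. \<forall>f\<in>F. cinner x f = 0}"
  by (auto simp: complex_vector.subspace_def cinner_simps)

text \<open>Gram-Schmidt with the subspace allowed to vary. A constant \<open>E\<close> and a dense
  \<open>w\<close> produce a complete sequence; an \<open>E\<close> alternating between two spaces
  produces mutually orthogonal sequences in both.\<close>

lemma orthonormal_seq_in_subspaces:
  fixes E :: "nat \<Rightarrow> 'a::chilbert_space set"
  assumes "\<And>n. closed (E n)" "\<And>n. csubspace (E n)" "\<And>n. \<not> finite_cdim (E n)"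
  obtains e where "orthonormal_seq e" "\<And>n. e n \<in> E n"
    "\<And>n x. x \<in> E n \<Longrightarrow> (\<And>i. cinner x (e i) = 0) \<Longrightarrow> cinner x (w n) = 0"
proof -
  define P where "P f n v \<longleftrightarrow> v \<in> E n \<and> norm v = 1 \<and> (\<forall>i<n. cinner v (f i) = 0) \<and>
    (\<forall>x\<in>E n. (\<forall>i<n. cinner x (f i) = 0) \<longrightarrow> cinner x v = 0 \<longrightarrow> cinner x (w n) = 0)" for f n v
  have "\<exists>e. \<forall>n. P e n (e n)"
  proof (rule dependent_wellorder_choice)
    show "P f n v = P g n v" if "\<And>y. y < n \<Longrightarrow> f y = g y" for v f g n
      using that by (simp add: P_def)
    fix n f
    define N where "N = E n \<inter> {x. \<forall>y\<in>f ` {..<n}. cinner x y = 0}"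
    have "closed N" and sub: "csubspace N"
      unfolding N_def using assms closed_orth_set csubspace_orth_set
      by (blast intro: complex_vector.subspace_inter)+
    have "\<not> finite_cdim N" unfolding N_def by (rule orth_compl_not_finite) (use assms in auto)
    then have "\<not> N \<subseteq> cspan {}" unfolding finite_cdim_def by blast
    then obtain a where a: "a \<in> N" "a \<noteq> 0" by auto
    \<comment> \<open>Normalising the part of \<open>w n\<close> in \<open>N\<close> exhausts
      \<open>w n\<close> for the last clause of \<open>P\<close>. If that part vanishes, the clause
      holds anyway and any nonzero \<open>a\<close> in \<open>N\<close> will do.\<close>
    define p where "p = orth_proj N (w n)"
    have p: "p \<in> N" unfolding p_def using \<open>closed N\<close> sub by (rule orth_proj_in)
    define u where "u = (if p = 0 then a else p)"
    have u: "u \<in> N" "u \<noteq> 0" using a p by (auto simp: u_def)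
    define v where "v = (1 / norm u) *\<^sub>R u"
    have "v \<in> N" unfolding v_def using sub u(1) by (rule csubspace_scaleR)
    moreover have "norm v = 1" using u by (simp add: v_def)
    moreover have "cinner x (w n) = 0" if "x \<in> N" "cinner x v = 0" for x
    proof -
      have "cinner x u = 0" using that(2) u by (simp add: v_def cinner_simps)
      then have "cinner x p = 0" by (auto simp: u_def split: if_splits)
      moreover have "cinner (w n - p) x = 0"
        unfolding p_def using \<open>closed N\<close> sub that(1) by (rule orth_proj_orth)
      ultimately show ?thesis
        using cinner_eq_0_commute[of x "w n - p"] by (simp add: cinner_simps)
    qed
    ultimately have "P f n v" by (auto simp: P_def N_def)
    then show "\<exists>r. P f n r" ..
  qed
  then obtain e where e: "\<And>n. P e n (e n)" by blast
  have less: "cinner (e m) (e n) = 0" if "n < m" for m n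
    using e[of m] that by (simp add: P_def)
  have "cinner (e m) (e n) = (if m = n then 1 else 0)" for m n
    using less[of m n] less[of n m] cinner_eq_0_commute[of "e m" "e n"] e[of m]
    by (cases m n rule: linorder_cases) (auto simp: P_def cinner_same)
  then have "orthonormal_seq e" by (simp add: orthonormal_seq_def)
  then show thesis by (rule that) (use e in \<open>auto simp: P_def\<close>)
qed

lemma norm_sum_orthonormal:
  assumes "orthonormal_seq d" "finite A"
  shows "(norm (\<Sum>n\<in>A. c n *\<^sub>C d n))\<^sup>2 = (\<Sum>n\<in>A. (cmod (c n))\<^sup>2)"
  using assms(2)
proof (induction A)
  case (insert m A)
  have "cinner (d m) (\<Sum>n\<in>A. c n *\<^sub>C d n) = (\<Sum>n\<in>A. cinner (d m) (c n *\<^sub>C d n))"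
    by (rule linear_sum[OF bounded_linear.linear[OF bounded_linear_cinner_right]])
  also have "\<dots> = 0"
    using insert.hyps assms(1)
    by (intro sum.neutral) (auto simp: cinner_simps orthonormal_seq_def)
  finally have "cinner (c m *\<^sub>C d m) (\<Sum>n\<in>A. c n *\<^sub>C d n) = 0" by (simp add: cinner_simps)
  moreover have "norm (d m) = 1"
    using assms(1) cinner_same[of "d m"] by (simp add: orthonormal_seq_def flip: of_real_power)
      (metis norm_ge_zero of_real_eq_1_iff one_power2 power2_eq_imp_eq zero_le_one of_real_power)
  ultimately show ?case using insert by (simp add: norm_add_orth norm_scaleC)
qed simp

lemma bessel:
  assumes "orthonormal_seq e"
  shows "(\<Sum>n<N. (cmod (cinner x (e n)))\<^sup>2) \<le> (norm x)\<^sup>2"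
proof -
  define s where "s = (\<Sum>n<N. cinner x (e n) *\<^sub>C e n)"
  have cs: "cinner s y = (\<Sum>n<N. cinner x (e n) * cinner (e n) y)" for y
    unfolding s_def
    by (subst linear_sum[OF bounded_linear.linear[OF bounded_linear_cinner_left]])
      (simp add: cinner_simps)
  have "cinner s (e m) = cinner x (e m)" if "m < N" for m
  proof -
    have "cinner s (e m) = (\<Sum>n<N. if n = m then cinner x (e m) else 0)"
      unfolding cs using assms by (intro sum.cong) (auto simp: orthonormal_seq_def)
    then show ?thesis using that by simp
  qed
  then have "cinner (e m) (x - s) = 0" if "m < N" for m
    using that cinner_eq_0_commute[of "e m" "x - s"] by (simp add: cinner_simps)
  then have "cinner s (x - s) = 0" unfolding cs by simp
  from norm_add_orth[OF this] have "(norm x)\<^sup>2 = (norm s)\<^sup>2 + (norm (x - s))\<^sup>2" by simp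
  moreover have "(norm s)\<^sup>2 = (\<Sum>n<N. (cmod (cinner x (e n)))\<^sup>2)"
    unfolding s_def by (rule norm_sum_orthonormal[OF assms]) simp
  ultimately show ?thesis by simp
qed

text \<open>The partial isometry that takes \<open>e n\<close> to \<open>d n\<close> and kills
  everything orthogonal to all \<open>e n\<close>; its adjoint is
  \<open>seq_map d e\<close>.\<close>

definition seq_map :: "(nat \<Rightarrow> 'a::chilbert_space) \<Rightarrow> (nat \<Rightarrow> 'b::chilbert_space) \<Rightarrow> 'a \<Rightarrow> 'b"
  where "seq_map e d x = (\<Sum>n. cinner x (e n) *\<^sub>C d n)"

context
  fixes e :: "nat \<Rightarrow> 'a::chilbert_space" and d :: "nat \<Rightarrow> 'b::chilbert_space"
  assumes e: "orthonormal_seq e" and d: "orthonormal_seq d"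
begin

lemma seq_map_sums: "(\<lambda>n. cinner x (e n) *\<^sub>C d n) sums seq_map e d x"
proof -
  have "summable (\<lambda>n. (cmod (cinner x (e n)))\<^sup>2)"
    using bessel[OF e] by (intro summableI_nonneg_bounded) auto
  then have C: "\<forall>\<epsilon>>0. \<exists>N. \<forall>m\<ge>N. \<forall>n. norm (\<Sum>i=m..<n. (cmod (cinner x (e i)))\<^sup>2) < \<epsilon>"
    by (simp only: summable_Cauchy)
  have "summable (\<lambda>n. cinner x (e n) *\<^sub>C d n)"
    unfolding summable_Cauchy
  proof (intro allI impI)
    fix \<epsilon> :: real assume "\<epsilon> > 0"
    then obtain N where N: "\<forall>m\<ge>N. \<forall>n. norm (\<Sum>i=m..<n. (cmod (cinner x (e i)))\<^sup>2) < \<epsilon>\<^sup>2"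
      using C by (metis zero_less_power)
    have "norm (\<Sum>i=m..<n. cinner x (e i) *\<^sub>C d i) < \<epsilon>" if "m \<ge> N" for m n
    proof -
      have "(norm (\<Sum>i=m..<n. cinner x (e i) *\<^sub>C d i))\<^sup>2 < \<epsilon>\<^sup>2"
        using N that by (simp add: norm_sum_orthonormal[OF d] sum_nonneg)
      then show ?thesis using \<open>\<epsilon> > 0\<close> by (simp add: power2_less_imp_less)
    qed
    then show "\<exists>N. \<forall>m\<ge>N. \<forall>n. norm (\<Sum>i=m..<n. cinner x (e i) *\<^sub>C d i) < \<epsilon>" by blast
  qed
  then show ?thesis unfolding seq_map_def by (rule summable_sums)
qed

lemma seq_map_add: "seq_map e d (x + y) = seq_map e d x + seq_map e d y"
  using sums_add[OF seq_map_sums[of x] seq_map_sums[of y]] seq_map_sums[of "x + y"]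
  by (simp add: cinner_simps scaleC_add_left sums_unique2)

lemma seq_map_scaleC: "seq_map e d (c *\<^sub>C x) = c *\<^sub>C seq_map e d x"
  using bounded_linear.sums[OF bounded_linear_scaleC[of c] seq_map_sums[of x]] seq_map_sums[of "c *\<^sub>C x"]
  by (simp add: cinner_simps scaleC_scaleC sums_unique2)

lemma norm_seq_map_le: "norm (seq_map e d x) \<le> norm x"
proof (rule LIMSEQ_le_const2)
  show "(\<lambda>N. norm (\<Sum>n<N. cinner x (e n) *\<^sub>C d n)) \<longlonglongrightarrow> norm (seq_map e d x)"
    using seq_map_sums[of x] unfolding sums_def by (rule tendsto_norm)
  have "(norm (\<Sum>n<N. cinner x (e n) *\<^sub>C d n))\<^sup>2 \<le> (norm x)\<^sup>2" for N
    using bessel[OF e] by (simp add: norm_sum_orthonormal[OF d])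
  then show "\<exists>N. \<forall>n\<ge>N. norm (\<Sum>n<n. cinner x (e n) *\<^sub>C d n) \<le> norm x"
    using norm_ge_zero power2_le_imp_le by blast
qed

lemma bounded_linear_seq_map: "bounded_linear (seq_map e d)"
  by (rule bounded_linear_intro[where K = 1])
    (simp_all add: seq_map_add seq_map_scaleC scaleR_scaleC norm_seq_map_le)

lemma cinner_seq_map_left: "(\<lambda>n. cinner x (e n) * cinner (d n) y) sums cinner (seq_map e d x) y"
  using bounded_linear.sums[OF bounded_linear_cinner_left seq_map_sums[of x]]
  by (simp add: cinner_simps)

lemma cinner_seq_map_basis: "cinner (seq_map e d x) (d n) = cinner x (e n)"
proof -
  have "(\<lambda>m. cinner x (e m) * cinner (d m) (d n)) = (\<lambda>m. if m = n then cinner x (e n) else 0)"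
    using d by (auto simp: orthonormal_seq_def)
  then show ?thesis
    using cinner_seq_map_left[of x "d n"] sums_single[of n "\<lambda>m. cinner x (e n)"]
    by (simp add: sums_unique2)
qed

end

lemma cinner_seq_map_right:
  assumes "orthonormal_seq e" "orthonormal_seq d"
  shows "cinner (seq_map e d x) y = cinner x (seq_map d e y)"
proof -
  have "(\<lambda>n. cnj (cinner y (d n) * cinner (e n) x)) sums cnj (cinner (seq_map d e y) x)"
    using bounded_linear.sums[OF bounded_linear_cnj cinner_seq_map_left[OF assms(2,1), of y x]] .
  moreover have "cnj (cinner y (d n) * cinner (e n) x) = cinner x (e n) * cinner (d n) y" for n
    using cinner_commute[of "d n" y] cinner_commute[of x "e n"] by simp
  moreover have "cnj (cinner (seq_map d e y) x) = cinner x (seq_map d e y)"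
    by (rule cinner_commute[symmetric])
  ultimately have "(\<lambda>n. cinner x (e n) * cinner (d n) y) sums cinner x (seq_map d e y)" by simp
  with cinner_seq_map_left[OF assms, of x y] show ?thesis by (rule sums_unique2)
qed

lemma seq_map_basis_sums:
  assumes e: "orthonormal_seq e"
    and W: "csubspace W" "closed W" "\<And>n. e n \<in> W"
    and complete: "\<And>x. x \<in> W \<Longrightarrow> (\<And>i. cinner x (e i) = 0) \<Longrightarrow> x = 0"
    and x: "x \<in> W"
  shows "seq_map e e x = x"
proof -
  have in_W: "seq_map e e x \<in> W"
  proof (rule closed_sequentially[OF W(2)])
    show "(\<lambda>N. \<Sum>n<N. cinner x (e n) *\<^sub>C e n) \<longlonglongrightarrow> seq_map e e x"
      using seq_map_sums[OF e e] by (simp add: sums_def)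
    show "(\<Sum>n<N. cinner x (e n) *\<^sub>C e n) \<in> W" for N
      using W by (intro complex_vector.subspace_sum csubspace_scale)
  qed
  have "x - seq_map e e x = 0"
    using x in_W W(1) by (intro complete csubspace_diff) (simp_all add: cinner_simps cinner_seq_map_basis[OF e e])
  then show ?thesis by simp
qed

lemma seq_map_seq_map:
  assumes "orthonormal_seq e" "orthonormal_seq d"
  shows "seq_map d e (seq_map e d x) = seq_map e e x"
  unfolding seq_map_def[of d e] cinner_seq_map_basis[OF assms] by (simp add: seq_map_def)

text \<open>A vector of \<open>W\<close> orthogonal to all \<open>e n\<close> is orthogonal to a
  dense sequence, hence to itself.\<close>

lemma complete_orthonormal_seq_exists:
  fixes W :: "'a::chilbert_space set" and w :: "nat \<Rightarrow> 'a"
  assumes "closure (range w) = UNIV"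
    and "closed W" "csubspace W" "\<not> finite_cdim W"
  obtains e where "orthonormal_seq e" "\<And>n. e n \<in> W"
    "\<And>x. x \<in> W \<Longrightarrow> (\<And>i. cinner x (e i) = 0) \<Longrightarrow> x = 0"
proof -
  obtain e where e: "orthonormal_seq e" "\<And>n. e n \<in> W"
    "\<And>n x. x \<in> W \<Longrightarrow> (\<And>i. cinner x (e i) = 0) \<Longrightarrow> cinner x (w n) = 0"
    using orthonormal_seq_in_subspaces[of "\<lambda>_. W" w] assms by metis
  show thesis
  proof (rule that[OF e(1,2)])
    fix x assume x: "x \<in> W" "\<And>i. cinner x (e i) = 0"
    have "closed {y. cinner x y = 0}"
      by (intro closed_Collect_eq linear_continuous_on bounded_linear_cinner_right continuous_on_const)
    moreover have "range w \<subseteq> {y. cinner x y = 0}" using e(3)[OF x] by blast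
    ultimately have "closure (range w) \<subseteq> {y. cinner x y = 0}" by (rule closure_minimal[rotated])
    then have "cinner x x = 0" using assms(1) by blast
    then show "x = 0" by (simp add: cinner_same)
  qed
qed

lemma separable_space_dense_seq:
  assumes "separable_space (euclidean :: 'a::metric_space topology)"
  obtains w :: "nat \<Rightarrow> 'a::metric_space" where "closure (range w) = UNIV"
proof -
  obtain C :: "'a set" where C: "countable C" "closure C = UNIV"
    using assms by (auto simp: separable_space_def)
  then have "C \<noteq> {}" by auto
  then have "range (from_nat_into C) = C" using C(1) by (rule range_from_nat_into)
  then show thesis using C(2) that by metis
qed

section \<open>Partial isometries\<close>

text \<open>\<open>V'\<close> is the adjoint of \<open>V\<close>, carried along explicitly. Together
  the conditions say that \<open>V\<close> is isometric on \<open>W\<close> and zero on its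
  orthogonal complement. Complex homogeneity is listed because the type of bounded maps only
  provides real linearity.\<close>

definition isometry_pair ::
    "'a::chilbert_space set \<Rightarrow> ('a \<Rightarrow>\<^sub>L 'b::chilbert_space) \<Rightarrow> ('b \<Rightarrow>\<^sub>L 'a) \<Rightarrow> bool"
  where "isometry_pair W V V' \<longleftrightarrow> (\<forall>c x. V (c *\<^sub>C x) = c *\<^sub>C V x) \<and>
    (\<forall>x y. cinner (V x) y = cinner x (V' y)) \<and> (\<forall>x\<in>W. V' (V x) = x) \<and> range V' \<subseteq> W"

lemma cinner_ext: "(\<And>x. cinner x y = cinner x z) \<Longrightarrow> y = z"
  by (metis cinner_diff_right cinner_same eq_iff_diff_eq_0 norm_eq_zero of_real_eq_0_iff power_eq_0_iff)

lemma isometry_pairD: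
  assumes "isometry_pair W V V'"
  shows "V (c *\<^sub>C x) = c *\<^sub>C V x" "V' (c *\<^sub>C y) = c *\<^sub>C V' y"
    "cinner (V x) y = cinner x (V' y)" "cinner y (V x) = cinner (V' y) x"
    "x \<in> W \<Longrightarrow> V' (V x) = x" "V' y \<in> W" "V' (V (V' y)) = V' y"
proof -
  show adj: "cinner (V x) y = cinner x (V' y)" for x y using assms by (simp add: isometry_pair_def)
  show "cinner y (V x) = cinner (V' y) x"
    using adj[of x y] cinner_commute[of y "V x"] cinner_commute[of "V' y" x] by simp
  show "V' (c *\<^sub>C y) = c *\<^sub>C V' y"
    by (rule cinner_ext) (simp add: adj[symmetric] cinner_simps)
  show "V' y \<in> W" using assms by (auto simp: isometry_pair_def)
  then show "V' (V (V' y)) = V' y" using assms by (simp add: isometry_pair_def)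
qed (use assms in \<open>auto simp: isometry_pair_def\<close>)

lemma isometry_pair_seq_map:
  assumes e: "orthonormal_seq e" and d: "orthonormal_seq d"
    and W: "csubspace W" "closed W" "\<And>n. e n \<in> W"
    and complete: "\<And>x. x \<in> W \<Longrightarrow> (\<And>i. cinner x (e i) = 0) \<Longrightarrow> x = 0"
  shows "isometry_pair W (Blinfun (seq_map e d)) (Blinfun (seq_map d e))"
proof -
  note bl = bounded_linear_Blinfun_apply[OF bounded_linear_seq_map]
  have "seq_map d e y \<in> W" for y
  proof (rule closed_sequentially[OF W(2)])
    show "(\<lambda>N. \<Sum>n<N. cinner y (d n) *\<^sub>C e n) \<longlonglongrightarrow> seq_map d e y"
      using seq_map_sums[OF d e] by (simp add: sums_def)
    show "(\<Sum>n<N. cinner y (d n) *\<^sub>C e n) \<in> W" for N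
      using W by (intro complex_vector.subspace_sum csubspace_scale)
  qed
  then show ?thesis
    unfolding isometry_pair_def bl[OF e d] bl[OF d e]
    by (auto simp: seq_map_scaleC[OF e d] cinner_seq_map_right[OF e d] seq_map_seq_map[OF e d]
        intro: seq_map_basis_sums[OF assms(1,3-6)])
qed

text \<open>Ensures that the choice in \<open>K1_class\<close> selects a genuine isomorphism. Both
  spaces have complete orthonormal sequences, the product because its second factor is
  infinite-dimensional, and matching the sequences gives the map.\<close>

lemma unitary_iso_exists:
  fixes W :: "'a::chilbert_space set"
  assumes sep: "separable_space (euclidean :: 'a topology)"
    and sepk: "separable_space (euclidean :: 'k::chilbert_space topology)"
    and inf: "\<not> finite_cdim (UNIV :: 'k set)"
    and W: "closed W" "csubspace W"
  shows "\<exists>\<Phi> :: 'a \<times> 'k \<Rightarrow> 'k. unitary_iso (W \<times> UNIV) \<Phi>"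
proof -
  obtain w :: "nat \<Rightarrow> 'a" where w: "closure (range w) = UNIV" by (rule separable_space_dense_seq[OF sep])
  obtain v :: "nat \<Rightarrow> 'k" where v: "closure (range v) = UNIV" by (rule separable_space_dense_seq[OF sepk])
  define z where "z n = (w (fst (prod_decode n)), v (snd (prod_decode n)))" for n
  have "range z = range w \<times> range v"
  proof
    show "range z \<subseteq> range w \<times> range v" by (auto simp: z_def)
    show "range w \<times> range v \<subseteq> range z"
    proof clarify
      fix m n
      have "(w m, v n) = z (prod_encode (m, n))" by (simp add: z_def)
      then show "(w m, v n) \<in> range z" by blast
    qed
  qed
  then have z: "closure (range z) = UNIV" by (simp add: closure_Times w v)
  let ?W = "W \<times> (UNIV :: 'k set)"
  have sub: "csubspace ?W"
    using W(2) by (auto simp: complex_vector.subspace_def scaleC_prod_def zero_prod_def)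
  have cl: "closed ?W" using W(1) by (intro closed_Times) auto
  have ninf: "\<not> finite_cdim ?W"
  proof
    assume "finite_cdim ?W"
    then have "finite_cdim (snd ` ?W)" by (rule finite_cdim_image[rotated 2]) (auto simp: scaleC_prod_def)
    moreover have "snd ` ?W = UNIV" using csubspace_0[OF W(2)] by force
    ultimately show False using inf by simp
  qed
  obtain e where e: "orthonormal_seq e" "\<And>n. e n \<in> ?W" "\<And>x. x \<in> ?W \<Longrightarrow> (\<And>i. cinner x (e i) = 0) \<Longrightarrow> x = 0"
    using complete_orthonormal_seq_exists[OF z cl sub ninf] by blast
  obtain d :: "nat \<Rightarrow> 'k" where d: "orthonormal_seq d" "\<And>x. (\<And>i. cinner x (d i) = 0) \<Longrightarrow> x = 0"
    using complete_orthonormal_seq_exists[OF v _ _ inf] by (auto simp: complex_vector.subspace_UNIV)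
  note V = isometry_pairD[OF isometry_pair_seq_map[OF e(1) d(1) sub cl e(2,3)],
      unfolded bounded_linear_Blinfun_apply[OF bounded_linear_seq_map[OF e(1) d(1)]]
        bounded_linear_Blinfun_apply[OF bounded_linear_seq_map[OF d(1) e(1)]]]
  have "seq_map e d (seq_map d e y) = y" for y
    unfolding seq_map_seq_map[OF d(1) e(1)]
    by (rule seq_map_basis_sums[of d UNIV]) (auto simp: d complex_vector.subspace_UNIV)
  then have "seq_map e d ` ?W = UNIV" using V(6) by (metis UNIV_eq_I imageI)
  then have "unitary_iso ?W (seq_map e d)"
    unfolding unitary_iso_def
    by (intro conjI clinear_onI ballI) (simp_all only: seq_map_add[OF e(1) d(1)] V(1,3,5))
  then show ?thesis by blast
qed

section \<open>Stabilised unitaries\<close>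

lemma continuous_map_scaleR:
  fixes g :: "'x \<Rightarrow> 'b::real_normed_vector"
  assumes "continuous_map X euclideanreal f" "continuous_map X euclidean g"
  shows "continuous_map X euclidean (\<lambda>x. f x *\<^sub>R g x)"
  using continuous_map_compose[OF continuous_map_pairedI[OF assms], of euclidean "\<lambda>p. fst p *\<^sub>R snd p"]
  by (simp add: o_def flip: euclidean_product_topology) (simp add: continuous_intros)

lemma continuous_map_blinfun_compose:
  fixes f :: "'x \<Rightarrow> 'b::real_normed_vector \<Rightarrow>\<^sub>L 'c::real_normed_vector"
    and g :: "'x \<Rightarrow> 'a::real_normed_vector \<Rightarrow>\<^sub>L 'b"
  assumes "continuous_map X euclidean f" "continuous_map X euclidean g"
  shows "continuous_map X euclidean (\<lambda>x. f x o\<^sub>L g x)"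
  using continuous_map_compose[OF continuous_map_pairedI[OF assms], of euclidean "\<lambda>p. fst p o\<^sub>L snd p"]
  by (simp add: o_def flip: euclidean_product_topology)
    (simp add: bounded_bilinear.continuous_on[OF bounded_bilinear_blinfun_compose] continuous_intros)

lemmas continuous_map_blinfun_intros = continuous_map_scaleR continuous_map_blinfun_compose
  continuous_map_add continuous_map_diff

lemma unitary_ops_UNIVI:
  assumes "\<And>c x. blinfun_apply u (c *\<^sub>C x) = c *\<^sub>C blinfun_apply u x" "surj (blinfun_apply u)"
    and "\<And>x. norm (blinfun_apply u x) = norm x"
  shows "u \<in> unitary_ops UNIV"
proof -
  have lin: "clinear_on UNIV (blinfun_apply u)" by (simp add: clinear_onI assms blinfun.add_right)
  have "cinner (blinfun_apply u x) (blinfun_apply u y) = cinner x y" for x y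
    by (rule cinner_preserving[OF _ complex_vector.subspace_UNIV lin]) (simp_all add: assms)
  moreover have "x = 0" if "x \<in> UNIV \<ominus> UNIV" for x :: 'a
    using that cinner_same[of x] by (auto simp: orth_diff_def)
  ultimately show ?thesis using lin assms(2) by (force simp: unitary_ops_def blinfun.zero_right)
qed

lemma unitary_opsD:
  assumes "u \<in> unitary_ops W"
  shows "blinfun_apply u (c *\<^sub>C x) = c *\<^sub>C blinfun_apply u x"
    "x \<in> W \<Longrightarrow> y \<in> W \<Longrightarrow> cinner (blinfun_apply u x) (blinfun_apply u y) = cinner x y"
    "x \<in> W \<Longrightarrow> norm (blinfun_apply u x) = norm x"
    "x \<in> W \<Longrightarrow> blinfun_apply u x \<in> W"
    "y \<in> W \<Longrightarrow> \<exists>x\<in>W. blinfun_apply u x = y"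
proof -
  show isom: "x \<in> W \<Longrightarrow> y \<in> W \<Longrightarrow> cinner (blinfun_apply u x) (blinfun_apply u y) = cinner x y" for x y
    using assms by (auto simp: unitary_ops_def)
  show "x \<in> W \<Longrightarrow> norm (blinfun_apply u x) = norm x"
    using isom[of x x] by (simp add: cinner_same del: of_real_power)
  have img: "blinfun_apply u ` W = W" using assms by (simp add: unitary_ops_def)
  then show "x \<in> W \<Longrightarrow> blinfun_apply u x \<in> W" by blast
  show "\<exists>x\<in>W. blinfun_apply u x = y" if "y \<in> W" using img that by (metis imageE)
qed (use assms in \<open>auto simp: unitary_ops_def clinear_on_def\<close>)

text \<open>\<open>u\<close> transported to the range of \<open>V\<close>, and the identity on the
  complement of that range. The stabilisation \<open>u \<oplus> 1\<close> conjugated into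
  \<open>H\<close> has this form.\<close>

definition inflate ::
    "('a::chilbert_space \<Rightarrow>\<^sub>L 'k::chilbert_space) \<Rightarrow> ('k \<Rightarrow>\<^sub>L 'a) \<Rightarrow> ('a \<Rightarrow>\<^sub>L 'a) \<Rightarrow> ('k \<Rightarrow>\<^sub>L 'k)"
  where "inflate V V' u = (V o\<^sub>L (u o\<^sub>L V')) + (id_blinfun - (V o\<^sub>L V'))"

lemma inflate_apply: "inflate V V' u y = V (u (V' y)) + (y - V (V' y))"
  by (simp add: inflate_def blinfun.add_left blinfun.diff_left)

lemma continuous_map_inflate:
  assumes "continuous_map X euclidean V" "continuous_map X euclidean V'" "continuous_map X euclidean u"
  shows "continuous_map X euclidean (\<lambda>x. inflate (V x) (V' x) (u x))"
  unfolding inflate_def using assms by (intro continuous_map_blinfun_intros) auto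

context
  fixes W :: "'a::chilbert_space set" and V :: "'a \<Rightarrow>\<^sub>L 'k::chilbert_space" and V'
  assumes V: "isometry_pair W V V'"
begin

lemma cinner_isometry: "x \<in> W \<Longrightarrow> cinner (V x) (V y) = cinner x y"
  using isometry_pairD(4)[OF V, of "V x" y] isometry_pairD(5)[OF V, of x] by simp

lemma norm_isometry: "x \<in> W \<Longrightarrow> norm (V x) = norm x"
  using cinner_isometry[of x x] by (simp add: cinner_same del: of_real_power)

lemma norm_isometry_complement: "(norm (V x + (y - V (V' y))))\<^sup>2 = (norm (V x))\<^sup>2 + (norm (y - V (V' y)))\<^sup>2"
  by (rule norm_add_orth)
    (simp add: isometry_pairD(3)[OF V] isometry_pairD(7)[OF V] blinfun.diff_right)

lemma inflate_unitary:
  assumes u: "u \<in> unitary_ops W"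
  shows "inflate V V' u \<in> unitary_ops UNIV"
proof (rule unitary_ops_UNIVI)
  note VD = isometry_pairD[OF V] and uD = unitary_opsD[OF u]
  show "inflate V V' u (c *\<^sub>C y) = c *\<^sub>C inflate V V' u y" for c y
    by (simp add: inflate_apply VD(1,2) uD(1) scaleC_add_right scaleC_diff_right)
  show "norm (inflate V V' u y) = norm y" for y
  proof -
    have "(norm (inflate V V' u y))\<^sup>2 = (norm (V' y))\<^sup>2 + (norm (y - V (V' y)))\<^sup>2"
      using norm_isometry_complement[of "u (V' y)" y]
      by (simp add: inflate_apply VD(6) uD(3,4) norm_isometry)
    moreover have "(norm y)\<^sup>2 = (norm (V' y))\<^sup>2 + (norm (y - V (V' y)))\<^sup>2"
      using norm_isometry_complement[of "V' y" y] by (simp add: VD(6) norm_isometry)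
    ultimately show ?thesis by (simp add: power2_eq_imp_eq)
  qed
  show "surj (inflate V V' u)"
    unfolding surj_def
  proof
    fix y
    obtain w where w: "w \<in> W" "u w = V' y" using uD(5)[OF VD(6)] by blast
    have "V' (V w + (y - V (V' y))) = w"
      using w by (simp add: blinfun.add_right blinfun.diff_right VD(5,7))
    then have "inflate V V' u (V w + (y - V (V' y))) = y"
      by (simp add: inflate_apply w)
    then show "\<exists>x. y = inflate V V' u x" by metis
  qed
qed

text \<open>Adding 1 to the inflated operator gives \<open>u + 1\<close> on the range of
  \<open>V\<close> and multiplication by 2 on its complement. So the new range is the preimage under
  \<open>V'\<close> of the range of \<open>u + 1\<close>, which is closed by continuity.\<close>

lemma inflate_UF:
  assumes u: "u \<in> UF W" and W: "csubspace W"
  shows "inflate V V' u \<in> UF UNIV"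
proof -
  note VD = isometry_pairD[OF V]
  have uu: "u \<in> unitary_ops W" using u by (simp add: UF_def)
  note uD = unitary_opsD[OF uu]
  let ?T = "\<lambda>x. u x + x" and ?S = "\<lambda>y. inflate V V' u y + y"
  have fred: "finite_cdim {x \<in> W. ?T x = 0}" "closed (?T ` W)" "finite_ccodim W (?T ` W)"
    using u by (auto simp: UF_def fredholm_on_def)
  have S: "?S y = V (?T (V' y)) + 2 *\<^sub>R (y - V (V' y))" for y
    by (simp add: inflate_apply blinfun.add_right scaleR_2 algebra_simps)
  have T_W: "?T (V' y) \<in> W" for y using VD(6) uD(4) W by (simp add: csubspace_add)
  have V'S: "V' (?S y) = ?T (V' y)" for y
  proof -
    have "V' (?S y) = V' (V (?T (V' y))) + 2 *\<^sub>R (V' y - V' (V (V' y)))"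
      unfolding S by (simp add: blinfun.add_right blinfun.diff_right blinfun.scaleR_right)
    also have "\<dots> = ?T (V' y)" using VD(5)[OF T_W] VD(7) by simp
    finally show ?thesis .
  qed
  have "{y \<in> UNIV. ?S y = 0} \<subseteq> V ` {x \<in> W. ?T x = 0}"
  proof clarify
    fix y assume y: "?S y = 0"
    then have T0: "?T (V' y) = 0" using V'S[of y] by simp
    then have "y = V (V' y)" using y by (simp add: S blinfun.zero_right)
    then show "y \<in> V ` {x \<in> W. ?T x = 0}" using T0 VD(6) by blast
  qed
  moreover have "finite_cdim (V ` {x \<in> W. ?T x = 0})"
    using fred(1) by (rule finite_cdim_image[rotated 2]) (simp_all add: blinfun.add_right VD(1))
  ultimately have ker: "finite_cdim {y \<in> UNIV. ?S y = 0}" by (rule finite_cdim_mono[rotated])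
  have range: "?S ` UNIV = V' -` (?T ` W)"
  proof
    show "?S ` UNIV \<subseteq> V' -` (?T ` W)" using V'S VD(6) by blast
    show "V' -` (?T ` W) \<subseteq> ?S ` UNIV"
    proof
      fix y assume "y \<in> V' -` (?T ` W)"
      then obtain a where a: "a \<in> W" "V' y = ?T a" by auto
      let ?z = "V a + (1/2) *\<^sub>R (y - V (V' y))"
      have z: "V' ?z = a"
        using a(1) VD(7) by (simp add: blinfun.add_right blinfun.diff_right blinfun.scaleR_right VD(5))
      have "?S ?z = V (?T a) + 2 *\<^sub>R (?z - V a)" unfolding S z ..
      also have "\<dots> = V (V' y) + (y - V (V' y))" using a by simp
      finally have "?S ?z = y" by simp
      then show "y \<in> ?S ` UNIV" by (rule image_eqI[OF sym UNIV_I])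
    qed
  qed
  have "closed (?S ` UNIV)"
    unfolding range using fred(2)
    by (rule continuous_closed_vimage[OF _ linear_continuous_at[OF blinfun.bounded_linear_right]])
  moreover have "finite_ccodim UNIV (?S ` UNIV)"
  proof -
    obtain B where B: "finite B" "B \<subseteq> W" "W \<subseteq> cspan (?T ` W \<union> B)"
      using fred(3) by (auto simp: finite_ccodim_def)
    have "y \<in> cspan (?S ` UNIV \<union> V ` B)" for y
    proof -
      have "V (V' y) \<in> cspan (V ` (?T ` W \<union> B))"
        using B(3) VD(6) by (intro span_image) (auto simp: blinfun.add_right VD(1))
      moreover have "V ` (?T ` W) \<subseteq> ?S ` UNIV"
        unfolding range using VD(5) uD(4) W by (auto simp: csubspace_add)
      then have "V ` (?T ` W \<union> B) \<subseteq> ?S ` UNIV \<union> V ` B" by (auto simp del: image_image)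
      ultimately have 1: "V (V' y) \<in> cspan (?S ` UNIV \<union> V ` B)"
        using complex_vector.span_mono by blast
      have "V' (y - V (V' y)) = ?T 0" by (simp add: blinfun.diff_right VD(7) blinfun.zero_right)
      then have "y - V (V' y) \<in> ?S ` UNIV"
        unfolding range using csubspace_0[OF W] by blast
      then have "y - V (V' y) \<in> cspan (?S ` UNIV \<union> V ` B)" by (intro complex_vector.span_base) blast
      from complex_vector.span_add[OF 1 this] show ?thesis by simp
    qed
    then show ?thesis using B(1) unfolding finite_ccodim_def by blast
  qed
  ultimately show ?thesis using ker inflate_unitary[OF uu] by (simp add: UF_def fredholm_on_def)
qed

end

section \<open>Homotopies between different embeddings of a family\<close>

lemma htpy_class_eqI:
  assumes "homotopic_with (\<lambda>_. True) X (UF_top UNIV) f g"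
  shows "htpy_class X f = htpy_class X g"
  unfolding htpy_class_def using assms
  by (blast intro: homotopic_with_trans homotopic_with_symD)

lemma htpy_class_cong:
  assumes "\<And>x. x \<in> topspace X \<Longrightarrow> f x = g x"
  shows "htpy_class X f = htpy_class X g"
proof -
  have "homotopic_with (\<lambda>_. True) X (UF_top UNIV) f h = homotopic_with (\<lambda>_. True) X (UF_top UNIV) g h" for h
    by (auto elim!: homotopic_with_eq simp: assms)
  then show ?thesis by (simp add: htpy_class_def)
qed

lemma homotopic_withI:
  assumes "continuous_map (prod_topology (top_of_set {0..1::real}) X) Y (\<lambda>z. h (fst z) (snd z))"
    and "\<And>x. x \<in> topspace X \<Longrightarrow> h 0 x = f x" "\<And>x. x \<in> topspace X \<Longrightarrow> h 1 x = g x"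
  shows "homotopic_with (\<lambda>_. True) X Y f g"
  using assms by (subst homotopic_with) (auto intro!: exI[of _ "\<lambda>z. h (fst z) (snd z)"])

lemma continuous_map_fst_real:
  "continuous_map (prod_topology (top_of_set {0..1::real}) X) euclideanreal fst"
  using continuous_map_fst[of "top_of_set {0..1::real}" X] continuous_map_into_fulltopology by blast

text \<open>Since the two ranges are orthogonal, \<open>cos V + sin T\<close> is an isometry on
  \<open>W\<close> at every angle, and inflating \<open>f\<close> along it stays in
  \<open>UF\<close>.\<close>

lemma homotopic_inflate_orth:
  fixes V T :: "'a::chilbert_space \<Rightarrow>\<^sub>L 'k::chilbert_space"
  assumes V: "isometry_pair W V V'" and T: "isometry_pair W T T'" and orth: "\<And>x. T' (V x) = 0"
    and W: "csubspace W" and cont: "continuous_map X euclidean f"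
    and UF: "\<And>x. x \<in> topspace X \<Longrightarrow> f x \<in> UF W"
  shows "homotopic_with (\<lambda>_. True) X (UF_top UNIV) (\<lambda>x. inflate V V' (f x)) (\<lambda>x. inflate T T' (f x))"
proof -
  have orth': "V' (T x) = 0" for x
    by (rule cinner_ext) (simp add: isometry_pairD(3)[OF V, symmetric] isometry_pairD(4)[OF T] orth)
  define R where "R t = cos (pi/2 * t) *\<^sub>R V + sin (pi/2 * t) *\<^sub>R T" for t
  define R' where "R' t = cos (pi/2 * t) *\<^sub>R V' + sin (pi/2 * t) *\<^sub>R T'" for t
  have R: "isometry_pair W (R t) (R' t)" for t
    unfolding isometry_pair_def
  proof (intro conjI allI ballI)
    show "R t (c *\<^sub>C x) = c *\<^sub>C R t x" for c x
      by (simp add: R_def blinfun.add_left blinfun.scaleR_left isometry_pairD(1)[OF V]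
          isometry_pairD(1)[OF T] scaleC_add_right scaleC_scaleR)
    show "cinner (R t x) y = cinner x (R' t y)" for x y
      by (simp add: R_def R'_def blinfun.add_left blinfun.scaleR_left cinner_simps
          isometry_pairD(3)[OF V] isometry_pairD(3)[OF T])
    show "R' t (R t x) = x" if "x \<in> W" for x
    proof -
      let ?c = "cos (pi/2 * t)" and ?s = "sin (pi/2 * t)"
      have "R' t (R t x) = (?c * ?c) *\<^sub>R x + (?s * ?s) *\<^sub>R x"
        by (simp add: R_def R'_def blinfun.add_left blinfun.scaleR_left blinfun.add_right
            blinfun.scaleR_right orth orth' isometry_pairD(5)[OF V that] isometry_pairD(5)[OF T that])
      also have "\<dots> = (?c\<^sup>2 + ?s\<^sup>2) *\<^sub>R x" by (simp only: scaleR_add_left power2_eq_square)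
      finally show ?thesis by simp
    qed
    show "range (R' t) \<subseteq> W"
      using isometry_pairD(6)[OF V] isometry_pairD(6)[OF T] W
      by (auto simp: R'_def blinfun.add_left blinfun.scaleR_left intro!: csubspace_add csubspace_scaleR)
  qed
  let ?Z = "prod_topology (top_of_set {0..1::real}) X"
  have cs: "continuous_map ?Z euclideanreal (\<lambda>z. cos (pi/2 * fst z))"
    "continuous_map ?Z euclideanreal (\<lambda>z. sin (pi/2 * fst z))"
    using continuous_map_compose[OF continuous_map_fst_real, of euclideanreal "\<lambda>t. cos (pi/2 * t)"]
      continuous_map_compose[OF continuous_map_fst_real, of euclideanreal "\<lambda>t. sin (pi/2 * t)"]
    by (simp_all add: o_def continuous_intros)
  have f: "continuous_map ?Z euclidean (\<lambda>z. f (snd z))"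
    using continuous_map_compose[OF continuous_map_snd cont] by (simp add: o_def)
  have "continuous_map ?Z (UF_top UNIV) (\<lambda>z. inflate (R (fst z)) (R' (fst z)) (f (snd z)))"
    unfolding continuous_map_in_subtopology
  proof
    show "continuous_map ?Z euclidean (\<lambda>z. inflate (R (fst z)) (R' (fst z)) (f (snd z)))"
      unfolding R_def R'_def using cs f
      by (intro continuous_map_inflate continuous_map_blinfun_intros) auto
    show "(\<lambda>z. inflate (R (fst z)) (R' (fst z)) (f (snd z))) \<in> topspace ?Z \<rightarrow> UF UNIV"
      using inflate_UF[OF R UF W] by auto
  qed
  then show ?thesis
    by (rule homotopic_withI[where h = "\<lambda>t x. inflate (R t) (R' t) (f x)"]) (simp_all add: R_def R'_def)
qed

lemma isometry_pair_compose:
  assumes "isometry_pair W V V'" "isometry_pair UNIV T T'"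
  shows "isometry_pair W (T o\<^sub>L V) (V' o\<^sub>L T')"
  using isometry_pairD[OF assms(1)] isometry_pairD[OF assms(2)]
  by (auto simp: isometry_pair_def)

text \<open>
  The two isometries need not have orthogonal ranges, so a single rotation does not connect them.
  The kernels of their adjoints are infinite-dimensional and contain mutually orthogonal copies of the
  whole space, through which three rotations lead from one isometry to the other.
\<close>

lemma htpy_class_inflate_unique:
  fixes V T :: "'a::chilbert_space \<Rightarrow>\<^sub>L 'k::chilbert_space"
  assumes sep: "separable_space (euclidean :: 'k topology)"
    and V: "isometry_pair W V V'" "\<not> finite_cdim {y. V' y = 0}"
    and T: "isometry_pair W T T'" "\<not> finite_cdim {y. T' y = 0}"
    and W: "csubspace W" and cont: "continuous_map X euclidean f"
    and UF: "\<And>x. x \<in> topspace X \<Longrightarrow> f x \<in> UF W"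
  shows "htpy_class X (\<lambda>x. inflate V V' (f x)) = htpy_class X (\<lambda>x. inflate T T' (f x))"
proof -
  have inf: "\<not> finite_cdim (UNIV :: 'k set)" using finite_cdim_mono V(2) by blast
  obtain w :: "nat \<Rightarrow> 'k" where w: "closure (range w) = UNIV" by (rule separable_space_dense_seq[OF sep])
  obtain e :: "nat \<Rightarrow> 'k" where e: "orthonormal_seq e" "\<And>x. (\<And>i. cinner x (e i) = 0) \<Longrightarrow> x = 0"
    using complete_orthonormal_seq_exists[OF w _ _ inf] by (auto simp: complex_vector.subspace_UNIV)
  have ker: "closed {y. S y = 0}" "csubspace {y. S y = 0}" if "isometry_pair W R S"
    for R :: "'a \<Rightarrow>\<^sub>L 'k" and S
    using isometry_pairD(2)[OF that]
    by (auto intro!: closed_Collect_eq continuous_intros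
        simp: complex_vector.subspace_def blinfun.zero_right blinfun.add_right)
  \<comment> \<open>The two kernels may be in any relative position. Choosing one orthonormal
    sequence that visits them alternately yields \<open>a\<close> in the kernel of \<open>V'\<close>
    and \<open>b\<close> in that of \<open>T'\<close>, orthogonal to each other.\<close>
  obtain c where c: "orthonormal_seq c" "\<And>n. c n \<in> (if even n then {y. V' y = 0} else {y. T' y = 0})"
    by (rule orthonormal_seq_in_subspaces[of "\<lambda>n. if even n then {y. V' y = 0} else {y. T' y = 0}"])
      (use ker[OF V(1)] ker[OF T(1)] V(2) T(2) in auto)
  define a where "a n = c (2 * n)" for n
  define b where "b n = c (2 * n + 1)" for n
  have a: "orthonormal_seq a" "\<And>n. V' (a n) = 0"
    using c(1) c(2)[of "2 * _"] by (auto simp: a_def orthonormal_seq_def)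
  have b: "orthonormal_seq b" "\<And>n. T' (b n) = 0"
    using c(1) c(2)[of "2 * _ + 1"] by (auto simp: b_def orthonormal_seq_def)
  have ab: "cinner (b n) (a m) = 0" for m n
    using c(1) by (auto simp: a_def b_def orthonormal_seq_def) presburger
  note app = bounded_linear_Blinfun_apply[OF bounded_linear_seq_map]
  have A: "isometry_pair UNIV (Blinfun (seq_map e a)) (Blinfun (seq_map a e))"
    and B: "isometry_pair UNIV (Blinfun (seq_map e b)) (Blinfun (seq_map b e))"
    using isometry_pair_seq_map[of e _ UNIV] e a(1) b(1) by (auto simp: complex_vector.subspace_UNIV)
  \<comment> \<open>Stations of the chain: \<open>V\<close>, then \<open>V\<close> pushed into the
    span of \<open>a\<close>, then \<open>T\<close> pushed into the span of \<open>b\<close>, then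
    \<open>T\<close>. The facts 1, 2, 3 state that neighbours have orthogonal ranges.\<close>
  note VA = isometry_pair_compose[OF V(1) A] and TB = isometry_pair_compose[OF T(1) B]
  have zero: "seq_map d e y = 0" if "\<And>n. cinner y (d n) = 0" for d :: "nat \<Rightarrow> 'k" and y
    by (simp add: seq_map_def that)
  have "seq_map a e (V x) = 0" for x
    by (rule zero) (simp add: isometry_pairD(3)[OF V(1)] a)
  then have 1: "(V' o\<^sub>L Blinfun (seq_map a e)) (V x) = 0" for x
    by (simp add: app[OF a(1) e(1)] blinfun.zero_right)
  have "seq_map b e (seq_map e a y) = 0" for y
    by (rule zero) (simp add: cinner_seq_map_right[OF e(1) a(1)] zero ab)
  then have 2: "(T' o\<^sub>L Blinfun (seq_map b e)) ((Blinfun (seq_map e a) o\<^sub>L V) x) = 0" for x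
    by (simp add: app[OF b(1) e(1)] app[OF e(1) a(1)] blinfun.zero_right)
  have 3: "T' ((Blinfun (seq_map e b) o\<^sub>L T) x) = 0" for x
    by (rule cinner_ext) (simp add: isometry_pairD(3)[OF T(1), symmetric] app[OF e(1) b(1)]
        cinner_seq_map_right[OF b(1) e(1), symmetric] zero isometry_pairD(3)[OF T(1)] b)
  show ?thesis
    using htpy_class_eqI[OF homotopic_inflate_orth[OF V(1) VA 1 W cont UF]]
      htpy_class_eqI[OF homotopic_inflate_orth[OF VA TB 2 W cont UF]]
      htpy_class_eqI[OF homotopic_inflate_orth[OF TB T(1) 3 W cont UF]] by simp
qed

text \<open>\<open>V\<close> is the chosen isomorphism restricted to the summand \<open>W\<close>;
  the other summand survives as an infinite-dimensional kernel of \<open>V'\<close>. Unitarity of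
  \<open>f x\<close> suffices for the formula, so it applies to the unreduced family before that is
  known to be Fredholm.\<close>

lemma K1_class_inflate:
  fixes W :: "'a::chilbert_space set" and X :: "'x topology"
  assumes sep: "separable_space (euclidean :: 'a topology)"
    and sepk: "separable_space (euclidean :: 'k::chilbert_space topology)"
    and inf: "\<not> finite_cdim (UNIV :: 'k set)"
    and W: "closed W" "csubspace W"
  obtains V :: "'a \<Rightarrow>\<^sub>L 'k::chilbert_space" and V' where "isometry_pair W V V'" "\<not> finite_cdim {y. V' y = 0}"
    "\<And>f. (\<And>x. x \<in> topspace X \<Longrightarrow> f x \<in> unitary_ops W) \<Longrightarrow>
      K1_class X W f = htpy_class X (\<lambda>x. inflate V V' (f x))"
proof -
  define \<Phi> where "\<Phi> = (SOME \<Phi> :: 'a \<times> 'k \<Rightarrow> 'k. unitary_iso (W \<times> UNIV) \<Phi>)"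
  let ?W = "W \<times> (UNIV :: 'k set)"
  have "unitary_iso ?W \<Phi>"
    unfolding \<Phi>_def using unitary_iso_exists[OF sep sepk inf W] by (rule someI_ex)
  then have add: "\<And>x y. x \<in> ?W \<Longrightarrow> y \<in> ?W \<Longrightarrow> \<Phi> (x + y) = \<Phi> x + \<Phi> y"
    and scale: "\<And>c x. x \<in> ?W \<Longrightarrow> \<Phi> (c *\<^sub>C x) = c *\<^sub>C \<Phi> x"
    and img: "\<Phi> ` ?W = UNIV"
    and pres: "\<And>x y. x \<in> ?W \<Longrightarrow> y \<in> ?W \<Longrightarrow> cinner (\<Phi> x) (\<Phi> y) = cinner x y"
    unfolding unitary_iso_def clinear_on_def by blast+
  have sub: "csubspace ?W"
    using W(2) by (auto simp: complex_vector.subspace_def scaleC_prod_def zero_prod_def)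
  have norm: "norm (\<Phi> x) = norm x" if "x \<in> ?W" for x
    using pres[OF that that] by (simp add: cinner_same del: of_real_power)
  have inj: "inj_on \<Phi> ?W"
  proof (rule inj_onI)
    fix x y assume xy: "x \<in> ?W" "y \<in> ?W" "\<Phi> x = \<Phi> y"
    have d: "x - y \<in> ?W" by (rule csubspace_diff[OF sub xy(1,2)])
    have "\<Phi> (x - y) = 0" using add[OF d xy(2)] xy(3) by simp
    then show "x = y" using norm[OF d] by simp
  qed
  define \<Psi> where "\<Psi> = inv_into ?W \<Phi>"
  have \<Psi>: "\<Psi> y \<in> ?W" "\<Phi> (\<Psi> y) = y" for y
    unfolding \<Psi>_def using img by (auto intro: inv_into_into f_inv_into_f)
  have \<Psi>_eq: "\<Psi> (\<Phi> x) = x" if "x \<in> ?W" for x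
    unfolding \<Psi>_def by (rule inv_into_f_f[OF inj that])
  have \<Psi>_add: "\<Psi> (x + y) = \<Psi> x + \<Psi> y" for x y
    using \<Psi>_eq[OF csubspace_add[OF sub \<Psi>(1) \<Psi>(1)], of x y] add[OF \<Psi>(1) \<Psi>(1), of x y] \<Psi>(2) by metis
  have \<Psi>_scale: "\<Psi> (c *\<^sub>C y) = c *\<^sub>C \<Psi> y" for c y
    using \<Psi>_eq[OF csubspace_scale[OF sub \<Psi>(1)], of c y] scale[OF \<Psi>(1), of c y] \<Psi>(2) by metis
  define V where "V = Blinfun (\<lambda>x. \<Phi> (orth_proj W x, 0))"
  define V' where "V' = Blinfun (\<lambda>y. fst (\<Psi> y))"
  have "bounded_linear (\<lambda>x. \<Phi> (orth_proj W x, 0))"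
  proof (rule bounded_linear_intro[where K = 1])
    have in_W: "(orth_proj W x, 0) \<in> ?W" for x using orth_proj_in[OF W] by simp
    show "\<Phi> (orth_proj W (x + y), 0) = \<Phi> (orth_proj W x, 0) + \<Phi> (orth_proj W y, 0)" for x y
      using add[OF in_W in_W, of x y] by (simp add: orth_proj_add[OF W])
    show "\<Phi> (orth_proj W (r *\<^sub>R x), 0) = r *\<^sub>R \<Phi> (orth_proj W x, 0)" for r x
      using scale[OF in_W, of r x]
      by (simp add: scaleR_scaleC orth_proj_scaleC[OF W] scaleC_prod_def)
    show "norm (\<Phi> (orth_proj W x, 0)) \<le> norm x * 1" for x
      using norm[OF in_W, of x] norm_orth_proj_le[OF W, of x] by (simp add: norm_Pair)
  qed
  then have V: "V x = \<Phi> (orth_proj W x, 0)" for x by (simp add: V_def bounded_linear_Blinfun_apply)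
  have "bounded_linear (\<lambda>y. fst (\<Psi> y))"
  proof (rule bounded_linear_intro[where K = 1])
    show "norm (fst (\<Psi> y)) \<le> norm y * 1" for y
      using norm[OF \<Psi>(1), of y] norm_fst_le[of "fst (\<Psi> y)" "snd (\<Psi> y)"] \<Psi>(2)[of y] by simp
  qed (simp_all add: \<Psi>_add \<Psi>_scale scaleR_scaleC scaleC_prod_def)
  then have V': "V' y = fst (\<Psi> y)" for y by (simp add: V'_def bounded_linear_Blinfun_apply)
  have split: "\<Phi> (a, b) = \<Phi> (a, 0) + \<Phi> (0, b)" if "a \<in> W" for a b
    using add[of "(a, 0)" "(0, b)"] that csubspace_0[OF W(2)] by simp
  have pair: "isometry_pair W V V'"
    unfolding isometry_pair_def
  proof (intro conjI allI ballI)
    show "V (c *\<^sub>C x) = c *\<^sub>C V x" for c x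
      using scale[of "(orth_proj W x, 0)" c] orth_proj_in[OF W, of x]
      by (simp add: V orth_proj_scaleC[OF W] scaleC_prod_def)
    show "cinner (V x) y = cinner x (V' y)" for x y
    proof -
      have fW: "fst (\<Psi> y) \<in> W" using \<Psi>(1)[of y] by auto
      have "cinner (V x) y = cinner (orth_proj W x, 0) (\<Psi> y)"
        using pres[of "(orth_proj W x, 0)" "\<Psi> y"] \<Psi>[of y] orth_proj_in[OF W, of x] by (simp add: V)
      also have "\<dots> = cinner (orth_proj W x) (fst (\<Psi> y))" by (simp add: cinner_prod_def)
      also have "\<dots> = cinner x (fst (\<Psi> y))"
        by (simp add: cinner_orth_proj[OF W] orth_proj_same[OF W fW])
      finally show ?thesis by (simp add: V')
    qed
    show "V' (V x) = x" if "x \<in> W" for x using that by (simp add: V V' orth_proj_same[OF W] \<Psi>_eq)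
    show "range V' \<subseteq> W" using \<Psi>(1) by (auto simp: V' mem_Times_iff)
  qed
  have "\<not> finite_cdim {y. V' y = 0}"
  proof
    assume "finite_cdim {y. V' y = 0}"
    then have "finite_cdim ((\<lambda>y. snd (\<Psi> y)) ` {y. V' y = 0})"
      by (rule finite_cdim_image[rotated 2]) (simp_all add: \<Psi>_add \<Psi>_scale scaleC_prod_def)
    moreover have "z \<in> (\<lambda>y. snd (\<Psi> y)) ` {y. V' y = 0}" for z
    proof -
      have "(0, z) \<in> ?W" using csubspace_0[OF W(2)] by simp
      then have "V' (\<Phi> (0, z)) = 0" "z = snd (\<Psi> (\<Phi> (0, z)))" by (simp_all add: V' \<Psi>_eq)
      then show ?thesis by blast
    qed
    then have "(\<lambda>y. snd (\<Psi> y)) ` {y. V' y = 0} = UNIV" by blast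
    ultimately show False using inf by simp
  qed
  moreover have "conj_op ?W \<Phi> (oplus_one u) = inflate V V' u" if u: "u \<in> unitary_ops W" for u
  proof -
    have one: "oplus_one u p = (u (fst p), snd p)" for p :: "'a \<times> 'k"
    proof -
      have "bounded_linear (\<lambda>p :: 'a \<times> 'k. (u (fst p), snd p))"
        by (intro bounded_linear_Pair bounded_linear_snd
            bounded_linear_compose[OF blinfun.bounded_linear_right bounded_linear_fst])
      then show ?thesis by (simp add: oplus_one_def case_prod_unfold bounded_linear_Blinfun_apply)
    qed
    have "\<Phi> (oplus_one u (\<Psi> y)) = inflate V V' u y" for y
    proof -
      have fW: "fst (\<Psi> y) \<in> W" using \<Psi>(1)[of y] by auto
      have "y = \<Phi> (fst (\<Psi> y), 0) + \<Phi> (0, snd (\<Psi> y))"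
        using split[OF fW, of "snd (\<Psi> y)"] \<Psi>(2)[of y] by simp
      then show ?thesis
        using split[OF unitary_opsD(4)[OF u fW], of "snd (\<Psi> y)"] unitary_opsD(4)[OF u fW] fW
        by (simp add: one inflate_apply V V' orth_proj_same[OF W] eq_diff_eq add.commute)
    qed
    then show ?thesis
      by (simp add: conj_op_def \<Psi>_def[symmetric] blinfun_apply_inverse)
  qed
  then have "K1_class X W f = htpy_class X (\<lambda>x. inflate V V' (f x))"
    if "\<And>x. x \<in> topspace X \<Longrightarrow> f x \<in> unitary_ops W" for f
    unfolding K1_class_def Let_def \<Phi>_def[symmetric] using that by (intro htpy_class_cong) blast
  ultimately show thesis using that pair by blast
qed

section \<open>Invertible operators\<close>

definition blinfun_inv :: "('a::banach \<Rightarrow>\<^sub>L 'b::banach) \<Rightarrow> ('b \<Rightarrow>\<^sub>L 'a)"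
  where "blinfun_inv G = Blinfun (inv (blinfun_apply G))"

text \<open>The constant is part of the set so that a whole family can share it; inversion is
  Lipschitz there.\<close>

definition invertible_bound :: "real \<Rightarrow> ('a::banach \<Rightarrow>\<^sub>L 'b::banach) set"
  where "invertible_bound C = {G. surj (blinfun_apply G) \<and> (\<forall>z. norm z \<le> C * norm (blinfun_apply G z))}"

lemma blinfun_inv:
  assumes "G \<in> invertible_bound C"
  shows "blinfun_apply G (blinfun_inv G y) = y" "blinfun_inv G (blinfun_apply G x) = x"
    "norm (blinfun_inv G y) \<le> C * norm y" "bij (blinfun_apply G)"
proof -
  have surj: "surj (blinfun_apply G)" and bound: "norm z \<le> C * norm (blinfun_apply G z)" for z
    using assms by (auto simp: invertible_bound_def)
  have "inj (blinfun_apply G)"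
  proof (rule injI)
    fix x y assume "blinfun_apply G x = blinfun_apply G y"
    then show "x = y" using bound[of "x - y"] by (simp add: blinfun.diff_right)
  qed
  then show bij: "bij (blinfun_apply G)" using surj by (simp add: bij_def)
  have G_inv: "blinfun_apply G (inv (blinfun_apply G) y) = y" for y
    using surj by (rule surj_f_inv_f)
  have "bounded_linear (inv (blinfun_apply G))"
  proof (rule bounded_linear_intro[where K = C])
    fix x y :: 'b and r :: real
    show "inv (blinfun_apply G) (x + y) = inv (blinfun_apply G) x + inv (blinfun_apply G) y"
      by (rule injD[OF \<open>inj (blinfun_apply G)\<close>]) (simp add: blinfun.add_right G_inv)
    show "inv (blinfun_apply G) (r *\<^sub>R x) = r *\<^sub>R inv (blinfun_apply G) x"
      by (rule injD[OF \<open>inj (blinfun_apply G)\<close>]) (simp add: blinfun.scaleR_right G_inv)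
    show "norm (inv (blinfun_apply G) x) \<le> norm x * C"
      using bound[of "inv (blinfun_apply G) x"] by (simp add: G_inv mult.commute)
  qed
  then have app: "blinfun_apply (blinfun_inv G) = inv (blinfun_apply G)"
    by (simp add: blinfun_inv_def bounded_linear_Blinfun_apply)
  show "blinfun_apply G (blinfun_inv G y) = y" by (simp add: app G_inv)
  show "blinfun_inv G (blinfun_apply G x) = x"
    by (simp add: app \<open>inj (blinfun_apply G)\<close>)
  show "norm (blinfun_inv G y) \<le> C * norm y"
    using bound[of "inv (blinfun_apply G) y"] by (simp add: app G_inv)
qed

text \<open>From the resolvent identity: the difference of the inverses of \<open>G\<close> and
  \<open>H\<close> is the inverse of \<open>G\<close>, times \<open>H - G\<close>, times the inverse
  of \<open>H\<close>. Hence the Lipschitz constant \<open>C * C\<close>.\<close>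

lemma continuous_on_blinfun_inv:
  assumes "C \<ge> 0"
  shows "continuous_on (invertible_bound C :: ('a::banach \<Rightarrow>\<^sub>L 'b::banach) set) blinfun_inv"
proof (rule lipschitz_on_continuous_on, rule lipschitz_onI)
  fix G H :: "'a \<Rightarrow>\<^sub>L 'b" assume G: "G \<in> invertible_bound C" and H: "H \<in> invertible_bound C"
  have "norm ((blinfun_inv G - blinfun_inv H) y) \<le> (C * C * norm (G - H)) * norm y" for y
  proof -
    let ?z = "blinfun_inv H y"
    have "(blinfun_inv G - blinfun_inv H) y = blinfun_inv G ((H - G) ?z)"
      by (simp add: blinfun.diff_left blinfun.diff_right blinfun_inv(1)[OF H] blinfun_inv(2)[OF G])
    also have "norm \<dots> \<le> C * norm ((H - G) ?z)" by (rule blinfun_inv(3)[OF G])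
    also have "\<dots> \<le> C * (norm (H - G) * (C * norm y))"
      by (intro mult_left_mono assms order_trans[OF norm_blinfun mult_left_mono[OF blinfun_inv(3)[OF H]]])
        simp
    finally show ?thesis by (simp add: norm_minus_commute mult_ac)
  qed
  then show "dist (blinfun_inv G) (blinfun_inv H) \<le> C * C * dist G H"
    unfolding dist_norm using assms by (intro norm_blinfun_bound) auto
qed (use assms in auto)

lemma continuous_map_blinfun_inv:
  fixes G :: "'x \<Rightarrow> 'a::banach \<Rightarrow>\<^sub>L 'b::banach"
  assumes "continuous_map X euclidean G" "\<And>x. x \<in> topspace X \<Longrightarrow> G x \<in> invertible_bound C" "C \<ge> 0"
  shows "continuous_map X euclidean (\<lambda>x. blinfun_inv (G x))"
proof -
  have "continuous_map X (top_of_set (invertible_bound C)) G"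
    using assms by (auto simp: continuous_map_in_subtopology)
  from continuous_map_compose[OF this, of euclidean blinfun_inv] show ?thesis
    using continuous_on_blinfun_inv[OF assms(3)] by (simp add: o_def)
qed

text \<open>An operator bounded below has closed range, so the residual of the projection onto the
  range is defined and orthogonal to the range.\<close>

lemma surj_if_orth_trivial:
  fixes G :: "'a::chilbert_space \<Rightarrow>\<^sub>L 'b::chilbert_space"
  assumes bound: "\<And>z. norm z \<le> C * norm (G z)" and lin: "\<And>c z. G (c *\<^sub>C z) = c *\<^sub>C G z"
    and orth: "\<And>y. (\<And>z. cinner (G z) y = 0) \<Longrightarrow> y = 0"
  shows "surj (blinfun_apply G)"
proof -
  \<comment> \<open>\<open>C\<close> is not assumed positive, and its reciprocal is about to be
    used.\<close>
  let ?C = "max C 1"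
  have bound': "norm z \<le> ?C * norm (G z)" for z
    using bound[of z] mult_right_mono[of C ?C "norm (G z)"] by simp
  have "complete (range (blinfun_apply G))"
  proof (rule complete_isometric_image[where e = "1 / ?C"])
    show "\<forall>x\<in>UNIV. norm (blinfun_apply G x) \<ge> 1 / ?C * norm x"
      using bound' by (simp add: field_simps)
  qed (auto simp: blinfun.bounded_linear_right complete_UNIV)
  then have cl: "closed (range (blinfun_apply G))" by (rule complete_imp_closed)
  have sub: "csubspace (range (blinfun_apply G))"
    unfolding complex_vector.subspace_def
    by (auto simp: lin[symmetric] blinfun.add_right[symmetric] intro: range_eqI[of _ _ 0] simp: blinfun.zero_right)
  have "y - orth_proj (range (blinfun_apply G)) y = 0" for y
  proof (rule orth)
    show "cinner (G z) (y - orth_proj (range (blinfun_apply G)) y) = 0" for z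
      using orth_proj_orth[OF cl sub, of "G z" y] cinner_eq_0_commute by blast
  qed
  then show ?thesis using orth_proj_in[OF cl sub] by (metis eq_iff_diff_eq_0 UNIV_eq_I)
qed

text \<open>If \<open>y\<close> is orthogonal to the range of \<open>H\<close> and \<open>z\<close>
  is its preimage under \<open>G\<close>, then the squared norm of \<open>y\<close> equals the inner
  product of \<open>(G - H) z\<close> and \<open>y\<close>, which is at most
  \<open>C * norm (G - H) < 1\<close> times itself.\<close>

lemma surj_perturb:
  fixes G H :: "'a::chilbert_space \<Rightarrow>\<^sub>L 'b::chilbert_space"
  assumes G: "G \<in> invertible_bound C" and C: "C > 0" "C * norm (G - H) < 1"
    and H: "\<And>z. norm z \<le> C * norm (H z)" "\<And>c z. H (c *\<^sub>C z) = c *\<^sub>C H z"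
  shows "surj (blinfun_apply H)"
proof (rule surj_if_orth_trivial[OF H])
  fix y assume y: "\<And>z. cinner (H z) y = 0"
  define z where "z = blinfun_inv G y"
  have "(norm y)\<^sup>2 = norm (cinner (G z) y)" by (simp add: z_def blinfun_inv(1)[OF G] cinner_same norm_power)
  also have "cinner (G z) y = cinner ((G - H) z) y" by (simp add: blinfun.diff_left cinner_simps y)
  also have "norm \<dots> \<le> norm ((G - H) z) * norm y" by (rule norm_cinner_le)
  also have "\<dots> \<le> (norm (G - H) * (C * norm y)) * norm y"
    unfolding z_def
    by (intro mult_right_mono order_trans[OF norm_blinfun mult_left_mono[OF blinfun_inv(3)[OF G]]]) simp_all
  finally have "(norm y)\<^sup>2 \<le> (C * norm (G - H)) * (norm y)\<^sup>2" by (simp add: power2_eq_square mult_ac)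
  then have "(norm y)\<^sup>2 * (1 - C * norm (G - H)) \<le> 0" by (simp add: algebra_simps)
  then have "(norm y)\<^sup>2 \<le> 0" using C(2) by (simp add: mult_le_0_iff)
  then show "y = 0" by simp
qed

text \<open>With one lower bound along the path, surjectivity is preserved in both directions by
  perturbations smaller than \<open>1 / C\<close>. It is therefore locally constant on the connected
  interval.\<close>

lemma method_of_continuity:
  fixes G :: "real \<Rightarrow> 'a::chilbert_space \<Rightarrow>\<^sub>L 'b::chilbert_space"
  assumes cont: "continuous_on {0..1} G" and C: "C > 0"
    and bound: "\<And>t z. t \<in> {0..1} \<Longrightarrow> norm z \<le> C * norm (G t z)"
    and lin: "\<And>t c z. G t (c *\<^sub>C z) = c *\<^sub>C G t z"
    and surj: "surj (blinfun_apply (G 1))" and t: "t \<in> {0..1}"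
  shows "G t \<in> invertible_bound C"
proof -
  have "surj (blinfun_apply (G t)) = surj (blinfun_apply (G 1))"
  proof (rule connected_local_const[of "{0..1::real}" t 1 "\<lambda>t. surj (blinfun_apply (G t))"])
    show "\<forall>a\<in>{0..1}. \<forall>\<^sub>F b in at a within {0..1}. surj (blinfun_apply (G a)) = surj (blinfun_apply (G b))"
    proof
      fix a :: real assume a: "a \<in> {0..1}"
      have "(G \<longlongrightarrow> G a) (at a within {0..1})" using cont a by (simp add: continuous_on_def)
      then have "\<forall>\<^sub>F b in at a within {0..1}. dist (G b) (G a) < 1 / C"
        using C by (intro tendstoD) auto
      then show "\<forall>\<^sub>F b in at a within {0..1}. surj (blinfun_apply (G a)) = surj (blinfun_apply (G b))"
        unfolding eventually_at_filter
      proof (rule eventually_mono, intro impI)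
        fix b assume "b \<noteq> a \<longrightarrow> b \<in> {0..1} \<longrightarrow> dist (G b) (G a) < 1 / C" "b \<noteq> a" "b \<in> {0..1}"
        then have b: "b \<in> {0..1}" "C * norm (G a - G b) < 1" "C * norm (G b - G a) < 1"
          using C by (simp_all add: dist_norm norm_minus_commute field_simps)
        show "surj (blinfun_apply (G a)) = surj (blinfun_apply (G b))"
          using surj_perturb[of "G a" C "G b"] surj_perturb[of "G b" C "G a"] a b C bound lin
          by (auto simp: invertible_bound_def)
      qed
    qed
  qed (use t in auto)
  then show ?thesis using surj bound[OF t] by (simp add: invertible_bound_def)
qed

text \<open>\<open>G\<close> carries the kernel of \<open>T\<close> onto that of \<open>S\<close>,
  and \<open>B\<close> carries the range of \<open>T\<close> onto that of \<open>S\<close>.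
  Closedness follows because this image is also a preimage under \<open>B'\<close>.\<close>

lemma fredholm_on_transfer:
  fixes T S :: "'k::chilbert_space \<Rightarrow> 'k" and G B B' :: "'k \<Rightarrow>\<^sub>L 'k"
  assumes T: "fredholm_on UNIV T"
    and eq: "\<And>w. S (G w) = B (T w)" and G: "surj (blinfun_apply G)"
    and B: "\<And>w. B' (B w) = w" "\<And>w. B (B' w) = w"
    and lin: "\<And>c z. G (c *\<^sub>C z) = c *\<^sub>C G z" "\<And>c z. B (c *\<^sub>C z) = c *\<^sub>C B z"
  shows "fredholm_on UNIV S"
proof -
  have fin: "finite_cdim {z. T z = 0}" "closed (range T)" "finite_ccodim UNIV (range T)"
    using T by (auto simp: fredholm_on_def)
  have "{z. S z = 0} \<subseteq> G ` {z. T z = 0}"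
  proof clarify
    fix z assume z: "S z = 0"
    obtain w where w: "z = G w" using G by blast
    have "B' (B (T w)) = 0" using z unfolding w eq by (simp add: blinfun.zero_right)
    then show "z \<in> G ` {z. T z = 0}" using B(1) w by auto
  qed
  then have 1: "finite_cdim {z. S z = 0}"
    using finite_cdim_image[OF _ lin(1) fin(1)] finite_cdim_mono by (metis blinfun.add_right)
  have range: "range S = B ` range T"
  proof -
    have "range S = S ` range (blinfun_apply G)" using G by simp
    also have "\<dots> = B ` range T" by (simp add: image_image eq)
    finally show ?thesis .
  qed
  have "range S = B' -` range T" unfolding range
  proof (intro set_eqI iffI)
    show "x \<in> B' -` range T" if "x \<in> B ` range T" for x using that B(1) by auto
    show "x \<in> B ` range T" if "x \<in> B' -` range T" for x using that B(2) by (metis imageI vimageD)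
  qed
  then have 2: "closed (range S)"
    using continuous_closed_vimage[OF fin(2) linear_continuous_at[OF blinfun.bounded_linear_right]] by simp
  obtain F where F: "finite F" "UNIV = cspan (range T \<union> F)"
    using fin(3) by (auto simp: finite_ccodim_def)
  have "y \<in> cspan (range S \<union> B ` F)" for y
  proof -
    have "B (B' y) \<in> cspan (B ` (range T \<union> F))"
      using F(2) by (intro span_image) (auto simp: blinfun.add_right lin)
    then show ?thesis by (simp add: B(2) range image_Un)
  qed
  then have 3: "finite_ccodim UNIV (range S)" using F(1) unfolding finite_ccodim_def by blast
  show ?thesis using 1 2 3 by (simp add: fredholm_on_def)
qed

section \<open>Eliminating a summand of a unitary\<close>

text \<open>
  Let \<open>p\<close> be an orthogonal projection, and let \<open>w = s + q\<close> with \<open>s\<close> in its range and \<open>q\<close> in its kernel.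
  \<open>cayley_inv p u w\<close> is the vector \<open>z\<close> with \<open>p z + p (u z) = s\<close> and \<open>z - p z = q\<close>.  For \<open>t > 0\<close>, take this \<open>z\<close>
  for \<open>t s + q\<close> and rescale the sum and the difference of \<open>p z\<close> and \<open>p (u z)\<close> by \<open>1 / t\<close> and \<open>t\<close>; the resulting
  vectors in place of \<open>z\<close> and \<open>u z\<close> are \<open>cayley_dom p u t w\<close> and \<open>cayley_ran p u t w\<close>.  In this
  parametrisation both are polynomial in \<open>t\<close>, so \<open>t = 0\<close> is included.
\<close>

definition cayley_inv :: "('k::chilbert_space \<Rightarrow>\<^sub>L 'k) \<Rightarrow> ('k \<Rightarrow>\<^sub>L 'k) \<Rightarrow> ('k \<Rightarrow>\<^sub>L 'k)"
  where "cayley_inv p u = blinfun_inv (id_blinfun + (p o\<^sub>L u))"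

definition cayley_scale :: "('k::chilbert_space \<Rightarrow>\<^sub>L 'k) \<Rightarrow> real \<Rightarrow> ('k \<Rightarrow>\<^sub>L 'k)"
  where "cayley_scale p t = t *\<^sub>R p + (id_blinfun - p)"

text \<open>Origin of the coefficients: let \<open>s = p w\<close> and \<open>x = p z\<close>. The
  original sum is \<open>t s\<close>, so the original difference is \<open>2 x - t s\<close>. The
  rescaled sum is \<open>s\<close> and the rescaled difference is \<open>t (2 x - t s)\<close>; half
  their sum gives the \<open>p\<close>-part of \<open>cayley_dom\<close>, half their difference that
  of \<open>cayley_ran\<close>.\<close>

definition cayley_dom :: "('k::chilbert_space \<Rightarrow>\<^sub>L 'k) \<Rightarrow> ('k \<Rightarrow>\<^sub>L 'k) \<Rightarrow> real \<Rightarrow> ('k \<Rightarrow>\<^sub>L 'k)"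
  where "cayley_dom p u t = ((1 - t\<^sup>2) / 2) *\<^sub>R p + t *\<^sub>R (p o\<^sub>L (cayley_inv p u o\<^sub>L cayley_scale p t))
    + (id_blinfun - p)"

definition cayley_ran :: "('k::chilbert_space \<Rightarrow>\<^sub>L 'k) \<Rightarrow> ('k \<Rightarrow>\<^sub>L 'k) \<Rightarrow> real \<Rightarrow> ('k \<Rightarrow>\<^sub>L 'k)"
  where "cayley_ran p u t = ((1 + t\<^sup>2) / 2) *\<^sub>R p - t *\<^sub>R (p o\<^sub>L (cayley_inv p u o\<^sub>L cayley_scale p t))
    + ((id_blinfun - p) o\<^sub>L (u o\<^sub>L (cayley_inv p u o\<^sub>L cayley_scale p t)))"

definition cayley_path :: "('k::chilbert_space \<Rightarrow>\<^sub>L 'k) \<Rightarrow> ('k \<Rightarrow>\<^sub>L 'k) \<Rightarrow> real \<Rightarrow> ('k \<Rightarrow>\<^sub>L 'k)"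
  where "cayley_path p u t = cayley_ran p u t o\<^sub>L blinfun_inv (cayley_dom p u t)"

lemmas blinfun_simps = blinfun.add_left blinfun.diff_left blinfun.scaleR_left
  blinfun.add_right blinfun.diff_right blinfun.scaleR_right blinfun.zero_right blinfun.minus_right

context
  fixes p u y :: "'k::chilbert_space \<Rightarrow>\<^sub>L 'k" and c :: real
  assumes p_idem: "\<And>z. p (p z) = p z" and p_adj: "\<And>w z. cinner (p w) z = cinner w (p z)"
    and p_lin: "\<And>c z. p (c *\<^sub>C z) = c *\<^sub>C p z"
    and u: "u \<in> unitary_ops UNIV"
    and c: "c > 0" "\<And>z. p z = z \<Longrightarrow> c * norm z \<le> norm (z + u z)"
begin

lemma pythagoras: "(norm z)\<^sup>2 = (norm (p z))\<^sup>2 + (norm (z - p z))\<^sup>2"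
proof -
  have "cinner (p z) (z - p z) = 0" by (simp add: p_adj blinfun_simps p_idem)
  from norm_add_orth[OF this] show ?thesis by simp
qed

lemma norm_p_le: "norm (p z) \<le> norm z" "norm (z - p z) \<le> norm z"
  using pythagoras[of z] by (auto intro: power2_le_imp_le)

text \<open>As \<open>u\<close> is isometric, the squared norm of \<open>x + u x\<close> is twice
  the real inner product of \<open>x\<close> and \<open>x + u x\<close>, so for \<open>x\<close> in
  the range of \<open>p\<close> the lower bound passes from \<open>1 + u\<close> to its compression.
  With \<open>norm (x + p (u x)) \<le> 2 * norm w\<close> this yields
  \<open>norm x \<le> 4 / c\<^sup>2 * norm w\<close>; the summand 1 accounts for the component
  \<open>q\<close>.\<close>

lemma cayley_inv_bound: "norm z \<le> (4 / c\<^sup>2 + 1) * norm ((id_blinfun + (p o\<^sub>L u)) z)"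
proof -
  define x where "x = p z"
  define q where "q = z - x"
  define w where "w = (id_blinfun + (p o\<^sub>L u)) z"
  have w: "w = z + p (u z)" by (simp add: w_def blinfun_simps)
  have px: "p x = x" by (simp add: x_def p_idem)
  have "q = w - p w" by (simp add: q_def w blinfun_simps p_idem x_def)
  then have q: "norm q \<le> norm w" using norm_p_le(2) by simp
  have uq: "norm (u q) = norm q" and ux: "norm (u x) = norm x" using unitary_opsD(3)[OF u] by auto
  have "z = x + q" by (simp add: q_def)
  have "x + p (u x) = p w - p (u q)"
    unfolding w by (simp add: \<open>z = x + q\<close> blinfun_simps p_idem) (simp add: px q_def x_def p_idem blinfun_simps)
  then have le: "norm (x + p (u x)) \<le> 2 * norm w"
    using norm_triangle_ineq4[of "p w" "p (u q)"] norm_p_le(1)[of w] norm_p_le(1)[of "u q"] q uq by simp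
  have inner_p: "inner x (p v) = inner x v" for v
    using p_adj[of x v] px by (simp add: inner_eq_Re_cinner)
  have "(c * norm x)\<^sup>2 \<le> (norm (x + u x))\<^sup>2" using c px by (intro power_mono) auto
  also have "\<dots> = 2 * inner x (x + p (u x))"
  proof -
    have "inner (u x) (u x) = inner x x" using ux by (simp add: norm_eq_sqrt_inner)
    then show ?thesis
      by (simp add: power2_norm_eq_inner inner_p inner_add_right inner_add_left inner_commute[of "u x" x])
  qed
  also have "\<dots> \<le> 2 * (norm x * norm (x + p (u x)))" using norm_cauchy_schwarz[of x "x + p (u x)"] by simp
  also have "\<dots> \<le> 2 * (norm x * (2 * norm w))" using le by (intro mult_left_mono) auto
  finally have "c\<^sup>2 * norm x * norm x \<le> 4 * norm w * norm x" by (simp add: power2_eq_square mult_ac)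
  then have "c\<^sup>2 * norm x \<le> 4 * norm w" by (cases "x = 0") auto
  then have "norm x \<le> 4 / c\<^sup>2 * norm w" using c(1) by (simp add: field_simps)
  moreover have "norm z \<le> norm x + norm q" unfolding \<open>z = x + q\<close> by (rule norm_triangle_ineq)
  ultimately show ?thesis using q by (simp add: w_def[symmetric] distrib_right)
qed

text \<open>For \<open>y\<close> orthogonal to the range and \<open>v = p y\<close>, testing with
  \<open>y\<close> itself gives \<open>norm y \<le> norm v\<close>, hence \<open>y = v\<close>. Then
  the inner product of \<open>u v\<close> and \<open>v\<close> has the extreme value that forces
  \<open>u v = - v\<close>, which the lower bound excludes unless \<open>v = 0\<close>.\<close>

lemma cayley_invertible: "id_blinfun + (p o\<^sub>L u) \<in> invertible_bound (4 / c\<^sup>2 + 1)"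
proof -
  have "surj (blinfun_apply (id_blinfun + (p o\<^sub>L u)))"
  proof (rule surj_if_orth_trivial[OF cayley_inv_bound])
    show "(id_blinfun + (p o\<^sub>L u)) (c *\<^sub>C z) = c *\<^sub>C (id_blinfun + (p o\<^sub>L u)) z" for c z
      by (simp add: blinfun_simps unitary_opsD(1)[OF u] p_lin scaleC_add_right)
    fix y assume y: "\<And>z. cinner ((id_blinfun + (p o\<^sub>L u)) z) y = 0"
    define v where "v = p y"
    have adj: "cinner z y = - cinner (u z) v" for z
      using y[of z] by (simp add: blinfun_simps cinner_simps p_adj v_def eq_neg_iff_add_eq_0)
    have "(norm y)\<^sup>2 = norm (cinner y y)" by (simp add: cinner_same norm_power)
    also have "\<dots> = norm (cinner (u y) v)" by (simp add: adj[of y])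
    also have "\<dots> \<le> norm y * norm v"
      using norm_cinner_le[of "u y" v] unitary_opsD(3)[OF u, of y] by simp
    finally have "norm y \<le> norm v" by (cases "y = 0") (simp_all add: power2_eq_square)
    then have "(norm y)\<^sup>2 \<le> (norm (p y))\<^sup>2" by (simp add: v_def power_mono)
    then have "(norm (y - p y))\<^sup>2 \<le> 0" using pythagoras[of y] by simp
    then have yv: "y = v" by (simp add: v_def)
    have uv: "cinner (u v) v = - cinner v v" using adj[of v] by (simp add: yv)
    then have "cinner v (u v) = - cinner v v"
      using cinner_commute[of v "u v"] by (simp add: cinner_same)
    then have "cinner (v + u v) (v + u v) = 0"
      using uv unitary_opsD(2)[OF u, of v v] by (simp only: cinner_simps) simp
    then have "v + u v = 0" by (simp add: cinner_same)
    moreover have "p v = v" by (simp add: v_def p_idem)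
    ultimately have "c * norm v \<le> 0" using c(2)[of v] by simp
    then show "y = 0" using c(1) unfolding yv by (simp add: mult_le_0_iff)
  qed
  then show ?thesis using cayley_inv_bound by (simp add: invertible_bound_def)
qed

lemma cayley_inv: "cayley_inv p u w + p (u (cayley_inv p u w)) = w"
  using blinfun_inv(1)[OF cayley_invertible, of w] by (simp add: cayley_inv_def blinfun_simps)

lemma cayley_inv_eqI: "z + p (u z) = w \<Longrightarrow> cayley_inv p u w = z"
  using blinfun_inv(2)[OF cayley_invertible, of z] by (simp add: cayley_inv_def blinfun_simps)

lemma cayley_inv_lin: "cayley_inv p u (a *\<^sub>C w) = a *\<^sub>C cayley_inv p u w"
  using cayley_inv[of w]
  by (intro cayley_inv_eqI) (simp add: unitary_opsD(1)[OF u] p_lin flip: scaleC_add_right)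

lemma p_cayley_inv: "p (cayley_inv p u w) + p (u (cayley_inv p u w)) = p w"
  "cayley_inv p u w - p (cayley_inv p u w) = w - p w"
proof -
  have "p (cayley_inv p u w + p (u (cayley_inv p u w))) = p w" by (simp only: cayley_inv)
  then show 1: "p (cayley_inv p u w) + p (u (cayley_inv p u w)) = p w" by (simp add: blinfun_simps p_idem)
  then show "cayley_inv p u w - p (cayley_inv p u w) = w - p w"
    using cayley_inv[of w] by (metis add_diff_cancel_left add.commute)
qed

lemma cayley_scale_apply: "cayley_scale p t w = t *\<^sub>R p w + (w - p w)"
  by (simp add: cayley_scale_def blinfun_simps)

lemma cayley_dom_apply:
  "cayley_dom p u t w = ((1 - t\<^sup>2) / 2) *\<^sub>R p w + t *\<^sub>R p (cayley_inv p u (cayley_scale p t w)) + (w - p w)"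
  by (simp add: cayley_dom_def blinfun_simps)

lemma cayley_ran_apply:
  "cayley_ran p u t w = ((1 + t\<^sup>2) / 2) *\<^sub>R p w - t *\<^sub>R p (cayley_inv p u (cayley_scale p t w))
    + (u (cayley_inv p u (cayley_scale p t w)) - p (u (cayley_inv p u (cayley_scale p t w))))"
  by (simp add: cayley_ran_def blinfun_simps)

lemma cayley_scale_lin: "cayley_scale p t (a *\<^sub>C w) = a *\<^sub>C cayley_scale p t w"
  by (simp add: cayley_scale_apply p_lin scaleC_add_right scaleC_diff_right scaleC_scaleR)

lemma cayley_dom_lin: "cayley_dom p u t (a *\<^sub>C w) = a *\<^sub>C cayley_dom p u t w"
  by (simp add: cayley_dom_apply p_lin cayley_scale_lin cayley_inv_lin
      scaleC_add_right scaleC_diff_right scaleC_scaleR)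

lemma cayley_ran_lin: "cayley_ran p u t (a *\<^sub>C w) = a *\<^sub>C cayley_ran p u t w"
  by (simp add: cayley_ran_apply p_lin cayley_scale_lin cayley_inv_lin unitary_opsD(1)[OF u]
      scaleC_add_right scaleC_diff_right scaleC_scaleR)

text \<open>The difference of the squared norms of \<open>x\<close> and \<open>v\<close> is the real
  inner product of \<open>x + v\<close> and \<open>x - v\<close>, so it is unchanged when the sum is
  divided and the difference multiplied by \<open>t\<close>. Using
  \<open>x + v = t *\<^sub>R s\<close> avoids the division and covers \<open>t = 0\<close>. The
  equality of norms is then unitarity of \<open>u\<close>.\<close>

lemma cayley_norms:
  "norm (cayley_dom p u t w) = norm (cayley_ran p u t w)"
  "norm w \<le> 2 * norm (cayley_dom p u t w)"
proof -
  define z where "z = cayley_inv p u (cayley_scale p t w)"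
  define s x v where "s = p w" and "x = p z" and "v = p (u z)"
  define a where "a = ((1 - t\<^sup>2) / 2) *\<^sub>R s + t *\<^sub>R x"
  define b where "b = ((1 + t\<^sup>2) / 2) *\<^sub>R s - t *\<^sub>R x"
  have pp: "p s = s" "p x = x" "p v = v" by (simp_all add: s_def x_def v_def p_idem)
  have pscale: "p (cayley_scale p t w) = t *\<^sub>R s"
    by (simp add: cayley_scale_apply blinfun_simps p_idem s_def)
  have sum: "x + v = t *\<^sub>R s" and q: "z - x = w - s"
    using p_cayley_inv[of "cayley_scale p t w"] unfolding pscale z_def[symmetric] x_def[symmetric] v_def[symmetric]
    by (simp_all add: cayley_scale_apply s_def)
  have D: "cayley_dom p u t w = a + (w - s)"
    by (simp add: cayley_dom_apply a_def s_def x_def z_def)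
  have R: "cayley_ran p u t w = b + (u z - v)"
    by (simp add: cayley_ran_apply b_def s_def x_def v_def z_def)
  have pD: "p (cayley_dom p u t w) = a" unfolding D a_def by (simp add: blinfun_simps pp) (simp add: s_def)
  have pR: "p (cayley_ran p u t w) = b" unfolding R b_def by (simp add: blinfun_simps pp) (simp add: v_def)
  have ND: "(norm (cayley_dom p u t w))\<^sup>2 = (norm a)\<^sup>2 + (norm (w - s))\<^sup>2"
    using pythagoras[of "cayley_dom p u t w"] unfolding pD by (simp add: D)
  have NR: "(norm (cayley_ran p u t w))\<^sup>2 = (norm b)\<^sup>2 + (norm (u z - v))\<^sup>2"
    using pythagoras[of "cayley_ran p u t w"] unfolding pR by (simp add: R)
  have "(norm x)\<^sup>2 + (norm (w - s))\<^sup>2 = (norm v)\<^sup>2 + (norm (u z - v))\<^sup>2"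
    using pythagoras[of z] pythagoras[of "u z"] unitary_opsD(3)[OF u, of z] q
    by (simp add: x_def[symmetric] v_def[symmetric])
  moreover have "(norm a)\<^sup>2 - (norm b)\<^sup>2 = (norm x)\<^sup>2 - (norm v)\<^sup>2"
  proof -
    have diff: "(norm g)\<^sup>2 - (norm h)\<^sup>2 = inner (g + h) (g - h)" for g h :: 'k
      by (simp add: power2_norm_eq_inner inner_add_left inner_diff_right inner_commute[of h g])
    have 1: "a + b = s" by (simp add: a_def b_def flip: scaleR_add_left) (simp add: field_simps)
    have 2: "a - b = t *\<^sub>R (x - v)"
    proof -
      have "a - b = t *\<^sub>R x + t *\<^sub>R x - ((1 + t\<^sup>2) / 2 - (1 - t\<^sup>2) / 2) *\<^sub>R s"
        unfolding a_def b_def by (simp only: scaleR_diff_left) simp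
      also have "(1 + t\<^sup>2) / 2 - (1 - t\<^sup>2) / 2 = t * t" by (simp add: field_simps power2_eq_square)
      also have "(t * t) *\<^sub>R s = t *\<^sub>R (x + v)" by (simp add: sum)
      finally show ?thesis by (simp add: scaleR_add_right scaleR_diff_right)
    qed
    have "inner s (t *\<^sub>R (x - v)) = inner (t *\<^sub>R s) (x - v)" by simp
    then show ?thesis unfolding diff 1 2 by (simp add: sum)
  qed
  ultimately have eq: "(norm (cayley_dom p u t w))\<^sup>2 = (norm (cayley_ran p u t w))\<^sup>2"
    unfolding ND NR by linarith
  then show "norm (cayley_dom p u t w) = norm (cayley_ran p u t w)" by (simp add: power2_eq_imp_eq)
  have ab: "a + b = s" by (simp add: a_def b_def flip: scaleR_add_left) (simp add: field_simps)
  \<comment> \<open>Because \<open>s = a + b\<close>, and \<open>a\<close> and \<open>b\<close> are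
    components of two vectors of equal norm, controlling both controls \<open>s\<close>. This is the
    source of the constant 2, independent of \<open>c\<close> and \<open>t\<close>.\<close>
  have "(norm s)\<^sup>2 \<le> 2 * ((norm a)\<^sup>2 + (norm b)\<^sup>2)"
  proof -
    have "0 \<le> (norm (a - b))\<^sup>2" by simp
    moreover have "(norm s)\<^sup>2 + (norm (a - b))\<^sup>2 = 2 * ((norm a)\<^sup>2 + (norm b)\<^sup>2)"
      unfolding ab[symmetric] by (simp add: power2_norm_eq_inner inner_add_left inner_add_right
          inner_diff_left inner_diff_right inner_commute)
    ultimately show ?thesis by linarith
  qed
  moreover have "W \<le> 4 * D" if "S \<le> 2 * (A + B)" "W = S + Q" "D = A + Q" "R = B + Q'" "D = R" "0 \<le> Q" "0 \<le> Q'"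
    for A B D Q Q' R S W :: real
    using that by argo
  ultimately have "(norm w)\<^sup>2 \<le> 4 * (norm (cayley_dom p u t w))\<^sup>2"
    using pythagoras[of w, folded s_def] ND NR eq zero_le_power2[of "norm (w - s)"] zero_le_power2[of "norm (u z - v)"] by blast
  then have "(norm w)\<^sup>2 \<le> (2 * norm (cayley_dom p u t w))\<^sup>2" by (simp add: power_mult_distrib)
  then show "norm w \<le> 2 * norm (cayley_dom p u t w)" by (rule power2_le_imp_le) simp
qed

lemma cayley_1: "cayley_dom p u 1 = cayley_inv p u" "cayley_ran p u 1 = u o\<^sub>L cayley_inv p u"
proof -
  have "cayley_dom p u 1 w = cayley_inv p u w" for w
    using p_cayley_inv(2)[of w] by (simp add: cayley_dom_apply cayley_scale_apply algebra_simps)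
  then show "cayley_dom p u 1 = cayley_inv p u" by (rule blinfun_eqI)
  have "cayley_ran p u 1 w = (u o\<^sub>L cayley_inv p u) w" for w
    using p_cayley_inv(1)[of w, symmetric] by (simp add: cayley_ran_apply cayley_scale_apply)
  then show "cayley_ran p u 1 = u o\<^sub>L cayley_inv p u" by (rule blinfun_eqI)
qed

lemma surj_cayley_inv: "surj (blinfun_apply (cayley_inv p u))"
proof (rule surjI)
  show "cayley_inv p u (z + p (u z)) = z" for z by (rule cayley_inv_eqI) simp
qed

text \<open>At \<open>t = 1\<close> the two maps are \<open>cayley_inv\<close> and \<open>u\<close>
  after it, both onto. The lower bound does not depend on \<open>t\<close>, so continuity carries
  surjectivity down to \<open>t = 0\<close>, where the rescaling of the coordinates itself
  degenerates.\<close>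

lemma cayley_path_invertible:
  assumes "t \<in> {0..1}"
  shows "cayley_dom p u t \<in> invertible_bound 2" "cayley_ran p u t \<in> invertible_bound 2"
proof -
  have scale: "continuous_on {0..1} (cayley_scale p)"
    unfolding cayley_scale_def by (intro continuous_intros)
  have "continuous_on {0..1} (cayley_dom p u)" "continuous_on {0..1} (cayley_ran p u)"
    unfolding cayley_dom_def cayley_ran_def
    by (auto intro!: continuous_intros bounded_bilinear.continuous_on[OF bounded_bilinear_blinfun_compose] scale)
  moreover have "surj (blinfun_apply (cayley_ran p u 1))"
  proof -
    have "surj (blinfun_apply u)" using unitary_opsD(5)[OF u] unfolding surj_def by (metis UNIV_I)
    from comp_surj[OF surj_cayley_inv this] show ?thesis
      by (simp add: cayley_1 o_def blinfun_compose.rep_eq)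
  qed
  ultimately show "cayley_dom p u t \<in> invertible_bound 2" "cayley_ran p u t \<in> invertible_bound 2"
    using cayley_norms(2) cayley_dom_lin cayley_ran_lin surj_cayley_inv assms
    by (auto intro!: method_of_continuity simp: cayley_1 simp flip: cayley_norms(1))
qed

lemma cayley_path_dom: "t \<in> {0..1} \<Longrightarrow> cayley_path p u t (cayley_dom p u t w) = cayley_ran p u t w"
  by (simp add: cayley_path_def blinfun_inv(2)[OF cayley_path_invertible(1)])

lemma cayley_path_unitary:
  assumes t: "t \<in> {0..1}"
  shows "cayley_path p u t \<in> unitary_ops UNIV"
proof (rule unitary_ops_UNIVI)
  have ex: "\<exists>w. z = cayley_dom p u t w" for z
    using blinfun_inv(1)[OF cayley_path_invertible(1)[OF t]] by metis
  show "cayley_path p u t (a *\<^sub>C z) = a *\<^sub>C cayley_path p u t z" for a z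
    using ex[of z] cayley_path_dom[OF t] by (auto simp: cayley_ran_lin simp flip: cayley_dom_lin)
  show "norm (cayley_path p u t z) = norm z" for z
    using ex[of z] cayley_path_dom[OF t] by (auto simp: cayley_norms(1))
  show "surj (cayley_path p u t)"
    unfolding surj_def using blinfun_inv(1)[OF cayley_path_invertible(2)[OF t]] cayley_path_dom[OF t]
    by metis
qed

lemma cayley_path_1: "cayley_path p u 1 = u"
proof (rule blinfun_eqI)
  fix z
  obtain w where "z = cayley_inv p u w" using surj_cayley_inv by blast
  then show "cayley_path p u 1 z = u z" using cayley_path_dom[of 1 w] by (simp add: cayley_1)
qed

context
  assumes y: "y \<in> UF UNIV"
    and y_p: "\<And>z. p z = z \<Longrightarrow> y z = z" and y_q: "\<And>z. p z = 0 \<Longrightarrow> p (y z) = 0"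
    and red: "\<And>z. p z = 0 \<Longrightarrow> \<exists>a. p a = a \<and> u (a + z) = - a + y z"
begin

text \<open>Closing the loop: the \<open>p\<close>-components of \<open>a + z\<close> and of its
  image are \<open>a\<close> and \<open>- a\<close>, so their sum is 0 and \<open>a + z\<close>
  solves the equation defining \<open>cayley_inv\<close> at \<open>z\<close>.\<close>

lemma cayley_ker:
  assumes "p z = 0"
  shows "u (cayley_inv p u z) - p (u (cayley_inv p u z)) = y z"
proof -
  obtain a where a: "p a = a" "u (a + z) = - a + y z" using red[OF assms] by blast
  have "cayley_inv p u z = a + z"
    by (rule cayley_inv_eqI)
      (simp add: a blinfun.add_right[of p] blinfun.diff_right[of p] blinfun.minus_right[of p] y_q[OF assms])
  then show ?thesis
    by (simp add: a blinfun.add_right[of p] blinfun.diff_right[of p] blinfun.minus_right[of p] y_q[OF assms])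
qed

lemma y_split: "y w = p w + y (w - p w)"
  using y_p[OF p_idem, of w] by (simp add: blinfun_simps)

lemma p_diff: "p (w - p w) = 0"
  by (simp add: blinfun_simps p_idem)

text \<open>At \<open>t = 0\<close> the domain map sends \<open>s + q\<close> to
  \<open>s / 2 + q\<close> and the range map sends it to \<open>s / 2 + y q\<close>, so the summand
  decouples and carries the identity.\<close>

lemma cayley_path_0: "cayley_path p u 0 = y"
proof (rule blinfun_eqI)
  fix z
  obtain w where z: "z = cayley_dom p u 0 w"
    using blinfun_inv(1)[OF cayley_path_invertible(1)[of 0]] by (metis atLeastAtMost_iff order_refl zero_le_one)
  have "cayley_ran p u 0 w = (1/2) *\<^sub>R p w + y (w - p w)"
    using cayley_ker[OF p_diff[of w]] by (simp add: cayley_ran_apply cayley_scale_apply)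
  also have "\<dots> = y z"
    using y_p[OF p_idem, of w] by (simp add: z cayley_dom_apply cayley_scale_apply blinfun_simps)
  finally show "cayley_path p u 0 z = y z" using cayley_path_dom[of 0 w] z by simp
qed

text \<open>
  On \<open>s + q\<close>, the sum of \<open>cayley_ran\<close> and \<open>cayley_dom\<close> is \<open>s + t E s + (y + 1) q\<close>: a shear composed with \<open>y + 1\<close>.
\<close>

lemma cayley_path_UF:
  assumes t: "t \<in> {0..1}"
  shows "cayley_path p u t \<in> UF UNIV"
proof -
  define E where "E = (id_blinfun - p) o\<^sub>L (u o\<^sub>L (cayley_inv p u o\<^sub>L p))"
  \<comment> \<open>\<open>y + 1\<close> is multiplication by 2 on the range of \<open>p\<close>,
    whence the factor 1/2. \<open>E\<close> depends only on \<open>p w\<close> and maps into the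
    kernel of \<open>p\<close>, so it squares to zero and \<open>B'\<close> undoes the
    shear.\<close>
  define B where "B = (1/2) *\<^sub>R p + (id_blinfun - p) + (t / 2) *\<^sub>R E"
  define B' where "B' = 2 *\<^sub>R p + (id_blinfun - p) - t *\<^sub>R E"
  have E: "E w = u (cayley_inv p u (p w)) - p (u (cayley_inv p u (p w)))" for w
    by (simp add: E_def blinfun_simps)
  have pE: "p (E w) = 0" "E (p w) = E w" "E (E w) = 0" for w
    by (simp_all add: E blinfun_simps p_idem)
  have "fredholm_on UNIV (\<lambda>z. cayley_path p u t z + z)"
  proof (rule fredholm_on_transfer[where G = "cayley_dom p u t" and B = B and B' = B'])
    show "fredholm_on UNIV (\<lambda>z. y z + z)" using y by (simp add: UF_def)
    show "cayley_path p u t (cayley_dom p u t w) + cayley_dom p u t w = B (y w + w)" for w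
    proof -
      have half: "((1 + t\<^sup>2) / 2) *\<^sub>R p w + ((1 - t\<^sup>2) / 2) *\<^sub>R p w = p w"
        by (simp flip: scaleR_add_left) (simp add: field_simps)
      have "cayley_path p u t (cayley_dom p u t w) + cayley_dom p u t w
        = (((1 + t\<^sup>2) / 2) *\<^sub>R p w + ((1 - t\<^sup>2) / 2) *\<^sub>R p w) + (w - p w) + (t *\<^sub>R E w
          + (u (cayley_inv p u (w - p w)) - p (u (cayley_inv p u (w - p w)))))"
        unfolding cayley_path_dom[OF t] by (simp add: cayley_ran_apply cayley_dom_apply
            cayley_scale_apply E blinfun_simps scaleR_diff_right)
      also have "\<dots> = p w + (w - p w) + (t *\<^sub>R E w + y (w - p w))"
        by (simp only: cayley_ker[OF p_diff] half)
      also have "\<dots> = B (y w + w)"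
      proof -
        have "p (y (w - p w)) = 0" by (rule y_q[OF p_diff])
        moreover from this have "E (y (w - p w)) = 0" using pE(2)[of "y (w - p w)"] by (simp add: blinfun.zero_right)
        moreover have "p (y w) = p w" "E (y w) = E w"
          using y_split[of w] calculation by (simp_all add: blinfun.add_right p_idem pE)
        moreover have "y w = p w + y (w - p w)" by (rule y_split)
        ultimately show ?thesis
          by (simp add: B_def blinfun.add_left blinfun.diff_left blinfun.scaleR_left
              blinfun.add_right[of p] blinfun.add_right[of E] scaleR_add_right flip: scaleR_add_left)
      qed
      finally show ?thesis .
    qed
    show "surj (blinfun_apply (cayley_dom p u t))"
      using cayley_path_invertible(1)[OF t] by (simp add: invertible_bound_def)
    show "B' (B w) = w" "B (B' w) = w" for w
      by (simp_all add: B_def B'_def blinfun_simps p_idem pE algebra_simps flip: scaleR_add_left)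
    show "B (a *\<^sub>C z) = a *\<^sub>C B z" for a z
      by (simp add: B_def blinfun_simps E p_lin cayley_inv_lin unitary_opsD(1)[OF u]
          scaleC_add_right scaleC_diff_right scaleC_scaleR)
  qed (rule cayley_dom_lin)
  then show ?thesis using cayley_path_unitary[OF t] by (simp add: UF_def)
qed

end

end

text \<open>As \<open>c\<close> does not depend on \<open>x\<close>, all operators to be inverted
  have a common bound, \<open>4 / c\<^sup>2 + 1\<close> for \<open>cayley_inv\<close> and 2 for
  \<open>cayley_dom\<close>. Inversion is continuous on each of these two sets.\<close>

lemma continuous_map_cayley_path:
  fixes p :: "'k::chilbert_space \<Rightarrow>\<^sub>L 'k" and u :: "'x \<Rightarrow> 'k \<Rightarrow>\<^sub>L 'k" and \<tau> :: "'x \<Rightarrow> real"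
  assumes p: "\<And>z. p (p z) = p z" "\<And>w z. cinner (p w) z = cinner w (p z)"
      "\<And>c z. p (c *\<^sub>C z) = c *\<^sub>C p z"
    and c: "c > 0" "\<And>x z. x \<in> topspace X \<Longrightarrow> p z = z \<Longrightarrow> c * norm z \<le> norm (z + u x z)"
    and u: "\<And>x. x \<in> topspace X \<Longrightarrow> u x \<in> unitary_ops UNIV" "continuous_map X euclidean u"
    and \<tau>: "continuous_map X euclideanreal \<tau>" "\<And>x. x \<in> topspace X \<Longrightarrow> \<tau> x \<in> {0..1}"
  shows "continuous_map X euclidean (\<lambda>x. cayley_path p (u x) (\<tau> x))"
proof -
  have "continuous_map X euclidean (\<lambda>x. id_blinfun + (p o\<^sub>L u x))"
    using u(2) by (intro continuous_map_blinfun_intros) auto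
  then have inv: "continuous_map X euclidean (\<lambda>x. cayley_inv p (u x))"
    unfolding cayley_inv_def
    by (rule continuous_map_blinfun_inv[where C = "4 / c\<^sup>2 + 1"]) (use cayley_invertible[OF p u(1) c] in auto)
  have sq: "continuous_map X euclideanreal (\<lambda>x. (1 - (\<tau> x)\<^sup>2) / 2)"
    "continuous_map X euclideanreal (\<lambda>x. (1 + (\<tau> x)\<^sup>2) / 2)"
    using continuous_map_compose[OF \<tau>(1), of euclideanreal "\<lambda>t. (1 - t\<^sup>2) / 2"]
      continuous_map_compose[OF \<tau>(1), of euclideanreal "\<lambda>t. (1 + t\<^sup>2) / 2"]
    by (simp_all add: o_def continuous_intros)
  have scale: "continuous_map X euclidean (\<lambda>x. cayley_scale p (\<tau> x))"
    unfolding cayley_scale_def using \<tau>(1) by (intro continuous_map_blinfun_intros) auto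
  have dom: "continuous_map X euclidean (\<lambda>x. cayley_dom p (u x) (\<tau> x))"
    unfolding cayley_dom_def using \<tau>(1) sq inv scale
    by (intro continuous_map_blinfun_intros) auto
  have ran: "continuous_map X euclidean (\<lambda>x. cayley_ran p (u x) (\<tau> x))"
    unfolding cayley_ran_def using \<tau>(1) sq inv scale u(2)
    by (intro continuous_map_blinfun_intros) auto
  show ?thesis
    unfolding cayley_path_def
    by (intro continuous_map_blinfun_compose ran continuous_map_blinfun_inv[OF dom, where C = 2])
      (use cayley_path_invertible(1)[OF p u(1) c \<tau>(2)] in auto)
qed

lemma homotopic_cayley:
  fixes p :: "'k::chilbert_space \<Rightarrow>\<^sub>L 'k" and u y :: "'x \<Rightarrow> 'k \<Rightarrow>\<^sub>L 'k"
  assumes p: "\<And>z. p (p z) = p z" "\<And>w z. cinner (p w) z = cinner w (p z)"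
      "\<And>c z. p (c *\<^sub>C z) = c *\<^sub>C p z"
    and c: "c > 0" "\<And>x z. x \<in> topspace X \<Longrightarrow> p z = z \<Longrightarrow> c * norm z \<le> norm (z + u x z)"
    and u: "\<And>x. x \<in> topspace X \<Longrightarrow> u x \<in> unitary_ops UNIV" "continuous_map X euclidean u"
    and y: "\<And>x. x \<in> topspace X \<Longrightarrow> y x \<in> UF UNIV"
      "\<And>x z. x \<in> topspace X \<Longrightarrow> p z = z \<Longrightarrow> y x z = z"
      "\<And>x z. x \<in> topspace X \<Longrightarrow> p z = 0 \<Longrightarrow> p (y x z) = 0"
    and red: "\<And>x z. x \<in> topspace X \<Longrightarrow> p z = 0 \<Longrightarrow> \<exists>a. p a = a \<and> u x (a + z) = - a + y x z"
  shows "homotopic_with (\<lambda>_. True) X (UF_top UNIV) y u"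
proof (rule homotopic_withI[where h = "\<lambda>t x. cayley_path p (u x) t"])
  let ?Z = "prod_topology (top_of_set {0..1::real}) X"
  have "continuous_map ?Z euclidean (\<lambda>z. u (snd z))"
    using continuous_map_compose[OF continuous_map_snd u(2)] by (simp add: o_def)
  then have "continuous_map ?Z euclidean (\<lambda>z. cayley_path p (u (snd z)) (fst z))"
    by (intro continuous_map_cayley_path[OF p c(1)] continuous_map_fst_real) (use c u in auto)
  moreover have "cayley_path p (u x) t \<in> UF UNIV" if "x \<in> topspace X" "t \<in> {0..1}" for x t
    using cayley_path_UF[OF p u(1) c y red] that by blast
  ultimately show "continuous_map ?Z (UF_top UNIV) (\<lambda>z. cayley_path p (u (snd z)) (fst z))"
    by (auto simp: continuous_map_in_subtopology)
  show "cayley_path p (u x) 0 = y x" if "x \<in> topspace X" for x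
    using cayley_path_0[OF p u(1) c y red] that by blast
  show "cayley_path p (u x) 1 = u x" if "x \<in> topspace X" for x
    using cayley_path_1[OF p u(1) c] that by blast
qed

section \<open>Lagrangian subspaces and reflections\<close>

definition reflection :: "'a::chilbert_space set \<Rightarrow> 'a \<Rightarrow>\<^sub>L 'a"
  where "reflection L = 2 *\<^sub>R cproj L - id_blinfun"

context
  fixes L :: "'a::chilbert_space set"
  assumes L: "closed L" "csubspace L"
begin

lemma reflection_apply: "reflection L x = 2 *\<^sub>R orth_proj L x - x"
  by (simp add: reflection_def blinfun_simps cproj_apply[OF L])

lemma reflection_add_self: "x + reflection L x \<in> L"
  by (simp add: reflection_apply csubspace_scaleR[OF L(2)] orth_proj_in[OF L])

lemma reflection_involutive: "reflection L (reflection L x) = x"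
proof -
  have "orth_proj L (2 *\<^sub>R orth_proj L x - x) = orth_proj L x"
    by (simp add: orth_proj_diff[OF L] scaleR_scaleC orth_proj_scaleC[OF L]
        orth_proj_same[OF L orth_proj_in[OF L]]) (simp flip: scaleR_scaleC[of 2, simplified] add: scaleR_2)
  then show ?thesis by (simp add: reflection_apply)
qed

lemma reflection_scaleC: "reflection L (c *\<^sub>C x) = c *\<^sub>C reflection L x"
  by (simp add: reflection_apply orth_proj_scaleC[OF L] scaleC_diff_right scaleC_scaleR)

lemma cinner_reflection: "cinner (reflection L x) y = cinner x (reflection L y)"
  by (simp add: reflection_apply cinner_simps cinner_orth_proj[OF L])

lemma reflection_isometry: "cinner (reflection L x) (reflection L y) = cinner x y"
  by (simp add: cinner_reflection reflection_involutive)

lemma reflection_same: "x \<in> L \<Longrightarrow> reflection L x = x"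
  by (simp add: reflection_apply orth_proj_same[OF L] scaleR_2)

end

lemma skew_adjoint_unitaryD:
  assumes "skew_adjoint_unitary J"
  shows "J (x + y) = J x + J y" "J (c *\<^sub>C x) = c *\<^sub>C J x" "J (x - y) = J x - J y"
    "J (r *\<^sub>R x) = r *\<^sub>R J x" "J (- x) = - J x" "J 0 = 0"
    "cinner (J x) (J y) = cinner x y" "cinner (J x) y = - cinner x (J y)" "J (J x) = - x" "norm (J x) = norm x"
proof -
  show add: "J (x + y) = J x + J y" for x y using assms by (simp add: skew_adjoint_unitary_def clinear_on_def)
  show scale: "J (c *\<^sub>C x) = c *\<^sub>C J x" for c x using assms by (simp add: skew_adjoint_unitary_def clinear_on_def)
  show "J (x - y) = J x - J y" using add[of "x - y" y] by simp
  show "J (r *\<^sub>R x) = r *\<^sub>R J x" by (simp add: scaleR_scaleC scale)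
  show "J 0 = 0" using add[of 0 0] by simp
  then show "J (- x) = - J x" using add[of x "- x"] by (simp add: eq_neg_iff_add_eq_0 add.commute)
  show isom: "cinner (J x) (J y) = cinner x y" for x y using assms unfolding skew_adjoint_unitary_def by blast
  show skew: "cinner (J x) y = - cinner x (J y)" for x y using assms unfolding skew_adjoint_unitary_def by blast
  show "J (J x) = - x"
  proof (rule cinner_ext)
    show "cinner y (J (J x)) = cinner y (- x)" for y
      using skew[of y "J x"] isom[of y x] by (simp add: cinner_simps)
  qed
  show "norm (J x) = norm x" using isom[of x x] by (simp add: cinner_same del: of_real_power)
qed

context
  fixes J :: "'a::chilbert_space \<Rightarrow> 'a" and \<Lambda> :: "'a set"
  assumes J: "skew_adjoint_unitary J" and \<Lambda>: "closed \<Lambda>" "csubspace \<Lambda>" "\<And>x. x \<in> \<Lambda> \<Longrightarrow> J x \<in> \<Lambda>"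
begin

lemmas JD = skew_adjoint_unitaryD[OF J]

lemma lagrangian_subspace:
  assumes "lagrangian \<Lambda> (sform J) L"
  shows "closed L" "csubspace L" "L \<subseteq> \<Lambda>"
    "x \<in> L \<Longrightarrow> y \<in> L \<Longrightarrow> cinner (J x) y = 0"
    "x \<in> \<Lambda> \<Longrightarrow> (\<And>y. y \<in> L \<Longrightarrow> cinner (J x) y = 0) \<Longrightarrow> x \<in> L"
proof -
  have eq: "L = \<Lambda> \<inter> {x. \<forall>f\<in>J ` L. cinner x f = 0}"
    using assms by (auto simp: lagrangian_def annihilator_def sform_def JD(8))
  show "closed L" by (subst eq) (intro closed_Int \<Lambda> closed_orth_set)
  show "csubspace L" by (subst eq) (intro complex_vector.subspace_inter \<Lambda> csubspace_orth_set)
  show "L \<subseteq> \<Lambda>" using eq by blast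
  show "x \<in> L \<Longrightarrow> y \<in> L \<Longrightarrow> cinner (J x) y = 0"
    "x \<in> \<Lambda> \<Longrightarrow> (\<And>y. y \<in> L \<Longrightarrow> cinner (J x) y = 0) \<Longrightarrow> x \<in> L"
    using assms by (auto simp: lagrangian_def annihilator_def sform_def)
qed

lemma pos_part_subspace: "closed (pos_part J \<Lambda>)" "csubspace (pos_part J \<Lambda>)"
proof -
  have "bounded_linear J" by (rule bounded_linear_intro[where K = 1]) (simp_all add: JD)
  then have "closed {x. J x = \<i> *\<^sub>C x}"
    by (intro closed_Collect_eq linear_continuous_on bounded_linear_scaleC)
  moreover have "pos_part J \<Lambda> = \<Lambda> \<inter> {x. J x = \<i> *\<^sub>C x}" by (auto simp: pos_part_def)
  ultimately show "closed (pos_part J \<Lambda>)" using \<Lambda>(1) by (simp add: closed_Int)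
  show "csubspace (pos_part J \<Lambda>)"
    using \<Lambda>(2) by (auto simp: pos_part_def complex_vector.subspace_def JD scaleC_add_right scaleC_scaleC mult.commute)
qed

lemma cinner_pos_neg:
  assumes "x \<in> pos_part J \<Lambda>" "y \<in> neg_part J \<Lambda>'"
  shows "cinner x y = 0" "cinner y x = 0"
proof -
  show "cinner x y = 0" using JD(7)[of x y] assms by (simp add: pos_part_def neg_part_def cinner_simps)
  then show "cinner y x = 0" using cinner_eq_0_commute by blast
qed

lemma neg_diff: "x \<in> neg_part J \<Lambda> \<Longrightarrow> y \<in> neg_part J \<Lambda> \<Longrightarrow> x - y \<in> neg_part J \<Lambda>"
  using \<Lambda>(2) by (auto simp: neg_part_def csubspace_diff JD scaleC_diff_right)

lemma orth_proj_pos_neg: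
  assumes "x \<in> pos_part J \<Lambda>" "y \<in> neg_part J \<Lambda>'"
  shows "orth_proj (pos_part J \<Lambda>) (x + y) = x"
  using assms cinner_pos_neg(2) by (intro orth_proj_eqI[OF pos_part_subspace]) auto

lemma orth_proj_pos:
  assumes "x \<in> \<Lambda>"
  shows "orth_proj (pos_part J \<Lambda>) x = (1/2) *\<^sub>R (x - \<i> *\<^sub>C J x)"
proof (rule orth_proj_eqI[OF pos_part_subspace])
  show "(1/2) *\<^sub>R (x - \<i> *\<^sub>C J x) \<in> pos_part J \<Lambda>"
    using assms \<Lambda> by (simp add: pos_part_def csubspace_scaleR csubspace_diff csubspace_scale JD
        scaleC_scaleR scaleC_diff_right scaleC_scaleC)
  fix y assume "y \<in> pos_part J \<Lambda>"
  then have "cinner (J x) y = \<i> * cinner x y" by (simp add: JD(8) pos_part_def cinner_simps)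
  then show "cinner (x - (1/2) *\<^sub>R (x - \<i> *\<^sub>C J x)) y = 0" by (simp add: cinner_simps)
qed

context
  fixes L assumes L: "lagrangian \<Lambda> (sform J) L"
begin

lemmas LD = lagrangian_subspace[OF L]

lemma reflection_in: "x \<in> \<Lambda> \<Longrightarrow> reflection L x \<in> \<Lambda>"
  using orth_proj_in[OF LD(1,2)] LD(3) \<Lambda>(2)
  by (auto simp: reflection_apply[OF LD(1,2)] intro!: csubspace_diff csubspace_scaleR)

text \<open>For a Lagrangian subspace \<open>J\<close> interchanges \<open>L\<close> and its
  orthogonal complement in \<open>\<Lambda>\<close>, so the projections before and after
  \<open>J\<close> are complementary.\<close>

lemma reflection_J:
  assumes x: "x \<in> \<Lambda>"
  shows "reflection L (J x) = - J (reflection L x)"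
proof -
  let ?P = "orth_proj L"
  have in_L: "?P x \<in> L" by (rule orth_proj_in[OF LD(1,2)])
  have "?P (J x) = J (x - ?P x)"
  proof (rule orth_proj_eqI[OF LD(1,2)])
    show "J (x - ?P x) \<in> L"
    proof (rule LD(5))
      show "J (x - ?P x) \<in> \<Lambda>" using x in_L LD(3) \<Lambda> by (intro \<Lambda>(3) csubspace_diff) auto
      show "cinner (J (J (x - ?P x))) y = 0" if "y \<in> L" for y
        using orth_proj_orth[OF LD(1,2) that, of x] by (simp add: JD(9) cinner_minus_left del: minus_diff_eq)
    qed
    show "cinner (J x - J (x - ?P x)) y = 0" if "y \<in> L" for y
      using LD(4)[OF in_L that] by (simp add: JD(3))
  qed
  then show ?thesis by (simp add: reflection_apply[OF LD(1,2)] JD scaleR_diff_right scaleR_2)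
qed

lemma reflection_pos_neg: "x \<in> pos_part J \<Lambda> \<Longrightarrow> reflection L x \<in> neg_part J \<Lambda>"
  using reflection_J[of x] reflection_in by (simp add: pos_part_def neg_part_def reflection_scaleC[OF LD(1,2)])

lemma reflection_neg_pos: "x \<in> neg_part J \<Lambda> \<Longrightarrow> reflection L x \<in> pos_part J \<Lambda>"
  using reflection_J[of x] reflection_in
  by (simp add: pos_part_def neg_part_def reflection_scaleC[OF LD(1,2)] complex_vector.scale_minus_left blinfun.minus_right)

text \<open>The reflection fixes \<open>x\<close> and changes the sign of \<open>J x\<close>, so it
  exchanges the positive part \<open>(x - \<i> J x) / 2\<close> with the negative part
  \<open>(x + \<i> J x) / 2\<close>. This exhibits \<open>L\<close> as a graph.\<close>

lemma reflection_orth_proj_pos: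
  assumes "x \<in> L"
  shows "reflection L (orth_proj (pos_part J \<Lambda>) x) = x - orth_proj (pos_part J \<Lambda>) x"
proof -
  have x: "x \<in> \<Lambda>" using assms LD(3) by blast
  have "reflection L (\<i> *\<^sub>C J x) = - (\<i> *\<^sub>C J x)"
    using assms by (simp add: reflection_scaleC[OF LD(1,2)] reflection_J[OF x] reflection_same[OF LD(1,2)] scaleC_minus_right)
  then have "reflection L (orth_proj (pos_part J \<Lambda>) x) = (1/2) *\<^sub>R (x + \<i> *\<^sub>C J x)"
    using assms by (simp add: orth_proj_pos[OF x] blinfun_simps reflection_same[OF LD(1,2)])
  also have "\<dots> = x - (1/2) *\<^sub>R (x - \<i> *\<^sub>C J x)"
    by (simp add: scaleR_add_right scaleR_diff_right algebra_simps flip: scaleR_add_left)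
  finally show ?thesis by (simp add: orth_proj_pos[OF x])
qed

lemma graph_map_eq:
  assumes x: "x \<in> pos_part J \<Lambda>"
  shows "graph_map J \<Lambda> L x = reflection L x"
  unfolding graph_map_def
proof (rule the_equality)
  show "reflection L x \<in> neg_part J \<Lambda> \<and> x + reflection L x \<in> L"
    using reflection_pos_neg[OF x] reflection_add_self[OF LD(1,2)] by simp
  fix z assume z: "z \<in> neg_part J \<Lambda> \<and> x + z \<in> L"
  define d where "d = z - reflection L x"
  have "d = (x + z) - (x + reflection L x)" by (simp add: d_def)
  \<comment> \<open>The form restricted to the negative part is definite: a vector there that also
    lies in an isotropic space must vanish.\<close>
  then have "d \<in> L" using z reflection_add_self[OF LD(1,2)] LD(2) by (metis csubspace_diff)
  then have "cinner (J d) d = 0" by (intro LD(4))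
  moreover have "J d = (- \<i>) *\<^sub>C d"
    using neg_diff z reflection_pos_neg[OF x] unfolding d_def by (simp add: neg_part_def)
  ultimately have "d = 0" by (simp add: cinner_simps cinner_same)
  then show "z = reflection L x" by (simp add: d_def)
qed

lemma inv_into_graph_map:
  assumes "z \<in> neg_part J \<Lambda>"
  shows "inv_into (pos_part J \<Lambda>) (graph_map J \<Lambda> L) z = reflection L z"
proof (rule inv_into_f_eq)
  show "inj_on (graph_map J \<Lambda> L) (pos_part J \<Lambda>)"
    by (rule inj_onI) (metis graph_map_eq reflection_involutive[OF LD(1,2)])
  show "reflection L z \<in> pos_part J \<Lambda>" by (rule reflection_neg_pos[OF assms])
  then show "graph_map J \<Lambda> L (reflection L z) = z" by (simp add: graph_map_eq reflection_involutive[OF LD(1,2)])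
qed

end

context
  fixes L M assumes L: "lagrangian \<Lambda> (sform J) L" and M: "lagrangian \<Lambda> (sform J) M"
begin

lemma pair_unitary_eq: "pair_unitary J \<Lambda> L M = - (reflection M o\<^sub>L (reflection L o\<^sub>L cproj (pos_part J \<Lambda>)))"
proof -
  have "- inv_into (pos_part J \<Lambda>) (graph_map J \<Lambda> M) (graph_map J \<Lambda> L (orth_proj (pos_part J \<Lambda>) x))
      = (- (reflection M o\<^sub>L (reflection L o\<^sub>L cproj (pos_part J \<Lambda>)))) x" for x
    using orth_proj_in[OF pos_part_subspace, of x]
    by (simp add: graph_map_eq[OF L] inv_into_graph_map[OF M] reflection_pos_neg[OF L]
        cproj_apply[OF pos_part_subspace] blinfun.minus_left)
  then show ?thesis
    by (simp add: pair_unitary_def op_on_def blinfun_apply_inverse)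
qed

lemma pair_unitary_apply: "pair_unitary J \<Lambda> L M x = - reflection M (reflection L (orth_proj (pos_part J \<Lambda>) x))"
  by (simp add: pair_unitary_eq blinfun.minus_left cproj_apply[OF pos_part_subspace])

lemma pair_unitary_pos: "x \<in> pos_part J \<Lambda> \<Longrightarrow> pair_unitary J \<Lambda> L M x = - reflection M (reflection L x)"
  by (simp add: pair_unitary_apply orth_proj_same[OF pos_part_subspace])

lemma reflection_comp_pos: "x \<in> pos_part J \<Lambda> \<Longrightarrow> reflection M (reflection L x) \<in> pos_part J \<Lambda>"
  by (intro reflection_neg_pos[OF M] reflection_pos_neg[OF L])

lemma reflection_comp_pos': "x \<in> pos_part J \<Lambda> \<Longrightarrow> reflection L (reflection M x) \<in> pos_part J \<Lambda>"
  by (intro reflection_neg_pos[OF L] reflection_pos_neg[OF M])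

lemma pair_unitary_unitary: "pair_unitary J \<Lambda> L M \<in> unitary_ops (pos_part J \<Lambda>)"
proof -
  let ?W = "pos_part J \<Lambda>" and ?u = "pair_unitary J \<Lambda> L M"
  note Ls = lagrangian_subspace(1,2)[OF L] and Ms = lagrangian_subspace(1,2)[OF M]
  have "clinear_on UNIV ?u"
    by (rule clinear_onI) (simp_all add: blinfun.add_right pair_unitary_apply orth_proj_scaleC[OF pos_part_subspace]
        reflection_scaleC[OF Ls] reflection_scaleC[OF Ms] scaleC_minus_right)
  moreover have "?u ` ?W = ?W"
  proof
    show "?u ` ?W \<subseteq> ?W"
      using reflection_comp_pos by (auto simp: pair_unitary_pos csubspace_neg[OF pos_part_subspace(2)])
    show "?W \<subseteq> ?u ` ?W"
    proof
      fix z assume z: "z \<in> ?W"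
      then have w: "- reflection L (reflection M z) \<in> ?W"
        by (intro csubspace_neg[OF pos_part_subspace(2)] reflection_comp_pos')
      then have "?u (- reflection L (reflection M z)) = z"
        unfolding pair_unitary_pos[OF w]
        by (simp add: blinfun.minus_right reflection_involutive[OF Ls] reflection_involutive[OF Ms])
      then show "z \<in> ?u ` ?W" using w by (metis imageI)
    qed
  qed
  moreover have "cinner (?u x) (?u y) = cinner x y" if "x \<in> ?W" "y \<in> ?W" for x y
    using that by (simp add: pair_unitary_pos cinner_simps reflection_isometry[OF Ls] reflection_isometry[OF Ms])
  moreover have "?u x = 0" if "x \<in> UNIV \<ominus> ?W" for x
    using that by (simp add: pair_unitary_apply orth_diff_def orth_proj_zero[OF pos_part_subspace] blinfun.zero_right)
  ultimately show ?thesis by (simp add: unitary_ops_def)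
qed

text \<open>Kernel: a solution \<open>x\<close> has equal reflections in \<open>L\<close> and
  \<open>M\<close>, so it is the positive part of a vector of \<open>L \<inter> M\<close>. Range: it
  is exactly the intersection of \<open>L + M\<close> with the positive part, since an element
  \<open>l + m\<close> is positive precisely when the negative parts of \<open>l\<close> and
  \<open>m\<close> cancel.\<close>

lemma pair_unitary_UF:
  assumes F: "fredholm_pair \<Lambda> L M"
  shows "pair_unitary J \<Lambda> L M \<in> UF (pos_part J \<Lambda>)"
proof -
  let ?W = "pos_part J \<Lambda>" and ?T = "\<lambda>x. pair_unitary J \<Lambda> L M x + x"
  let ?N = "{x + y |x y. x \<in> L \<and> y \<in> M}"
  note W = pos_part_subspace
  note Ls = lagrangian_subspace[OF L] and Ms = lagrangian_subspace[OF M]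
  have F: "closed ?N" "finite_cdim (L \<inter> M)" "finite_ccodim \<Lambda> ?N"
    using F by (auto simp: fredholm_pair_def)
  have "{x \<in> ?W. ?T x = 0} \<subseteq> orth_proj ?W ` (L \<inter> M)"
  proof clarify
    fix x assume x: "x \<in> ?W" "?T x = 0"
    then have "reflection M (reflection L x) = x" by (simp add: pair_unitary_pos)
    then have eq: "reflection L x = reflection M x" using reflection_involutive[OF Ms(1,2), of "reflection L x"] by simp
    have "x + reflection L x \<in> L" by (rule reflection_add_self[OF Ls(1,2)])
    moreover have "x + reflection L x \<in> M" unfolding eq by (rule reflection_add_self[OF Ms(1,2)])
    moreover have "orth_proj ?W (x + reflection L x) = x"
      by (rule orth_proj_pos_neg[OF x(1) reflection_pos_neg[OF L x(1)]])
    ultimately show "x \<in> orth_proj ?W ` (L \<inter> M)" by (metis IntI image_eqI)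
  qed
  moreover have "finite_cdim (orth_proj ?W ` (L \<inter> M))"
    by (rule finite_cdim_image[OF orth_proj_add[OF W] orth_proj_scaleC[OF W] F(2)])
  ultimately have ker: "finite_cdim {x \<in> ?W. ?T x = 0}" by (rule finite_cdim_mono[rotated])
  have range: "?T ` ?W = ?N \<inter> ?W"
  proof
    show "?T ` ?W \<subseteq> ?N \<inter> ?W"
    proof clarify
      fix x assume x: "x \<in> ?W"
      have "?T x = (x + reflection L x) + - (reflection L x + reflection M (reflection L x))"
        by (simp add: pair_unitary_pos[OF x])
      moreover have "x + reflection L x \<in> L" "- (reflection L x + reflection M (reflection L x)) \<in> M"
        by (intro reflection_add_self[OF Ls(1,2)] csubspace_neg[OF Ms(2)] reflection_add_self[OF Ms(1,2)])+
      ultimately have "?T x \<in> ?N" by blast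
      moreover have "?T x \<in> ?W"
        by (intro csubspace_add[OF W(2)] unitary_opsD(4)[OF pair_unitary_unitary] x)
      ultimately show "?T x \<in> ?N \<inter> ?W" by blast
    qed
    show "?N \<inter> ?W \<subseteq> ?T ` ?W"
    proof clarify
      fix l m assume lm: "l \<in> L" "m \<in> M" "l + m \<in> ?W"
      define a b where "a = orth_proj ?W l" and "b = orth_proj ?W m"
      have ab: "a \<in> ?W" "b \<in> ?W" unfolding a_def b_def by (rule orth_proj_in[OF W])+
      have sum: "l + m = a + b"
        using orth_proj_same[OF W lm(3)] by (simp add: a_def b_def orth_proj_add[OF W])
      have "reflection L a = l - a" "reflection M b = m - b"
        unfolding a_def b_def using lm by (simp_all add: reflection_orth_proj_pos[OF L] reflection_orth_proj_pos[OF M])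
      then have "reflection L a + reflection M b = (l + m) - (a + b)" by simp
      then have "reflection L a = - reflection M b" by (simp add: sum eq_neg_iff_add_eq_0)
      then have "b = - reflection M (reflection L a)" by (simp add: blinfun.minus_right reflection_involutive[OF Ms(1,2)])
      then have "l + m = ?T a" using sum by (simp add: pair_unitary_pos[OF ab(1)])
      then show "l + m \<in> ?T ` ?W" using ab(1) by blast
    qed
  qed
  have "csubspace ?N" using complex_vector.subspace_sums[OF Ls(2) Ms(2)] .
  moreover obtain B where "finite B" "\<Lambda> \<subseteq> cspan (?N \<union> B)" using F(3) by (auto simp: finite_ccodim_def)
  moreover have "?W \<subseteq> \<Lambda>" by (auto simp: pos_part_def)
  ultimately have "finite_ccodim ?W (?N \<inter> ?W)" using W(2) by (intro finite_ccodim_Int[where B = B]) auto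
  moreover have "closed (?N \<inter> ?W)" using F(1) W(1) by (rule closed_Int)
  ultimately show ?thesis
    using ker pair_unitary_unitary by (simp add: UF_def fredholm_on_def range)
qed

end

end

text \<open>The formula by reflections replaces the pointwise definition through graphs and inverses
  by an expression polynomial in the projection onto \<open>L x\<close>.\<close>

lemma continuous_map_pair_unitary:
  assumes J: "skew_adjoint_unitary J"
    and \<Lambda>: "closed \<Lambda>" "csubspace \<Lambda>" "\<And>x. x \<in> \<Lambda> \<Longrightarrow> J x \<in> \<Lambda>"
    and L: "\<And>x. x \<in> topspace X \<Longrightarrow> lagrangian \<Lambda> (sform J) (L x)" and M: "lagrangian \<Lambda> (sform J) M"
    and cont: "continuous_family X L"
  shows "continuous_map X euclidean (\<lambda>x. pair_unitary J \<Lambda> (L x) M)"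
proof (rule continuous_map_eq)
  have "continuous_map X euclidean (\<lambda>x. cproj (L x))"
    using cont by (simp add: continuous_family_def cproj_def)
  then show "continuous_map X euclidean (\<lambda>x. - (reflection M o\<^sub>L (reflection (L x) o\<^sub>L cproj (pos_part J \<Lambda>))))"
    unfolding reflection_def by (intro continuous_map_minus continuous_map_blinfun_intros) auto
  show "- (reflection M o\<^sub>L (reflection (L x) o\<^sub>L cproj (pos_part J \<Lambda>))) = pair_unitary J \<Lambda> (L x) M"
    if "x \<in> topspace X" for x
    using pair_unitary_eq[OF J \<Lambda> L[OF that] M] by simp
qed

text \<open>Transfers the feedback relation from \<open>W\<close> to \<open>H\<close>, where the
  path of unitaries lives. The embedding of \<open>Q\<close> is the restriction of that of
  \<open>W\<close>.\<close>

lemma homotopic_inflate_reduction: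
  fixes V :: "'a::chilbert_space \<Rightarrow>\<^sub>L 'k::chilbert_space" and U f :: "'x \<Rightarrow> 'a \<Rightarrow>\<^sub>L 'a"
  assumes V: "isometry_pair W V V'" and W: "csubspace W"
    and Q: "closed Q" "csubspace Q" "Q \<subseteq> W"
    and U: "\<And>x. x \<in> topspace X \<Longrightarrow> U x \<in> unitary_ops W" "continuous_map X euclidean U"
    and f: "\<And>x. x \<in> topspace X \<Longrightarrow> f x \<in> UF Q"
    and c: "c > 0" "\<And>x v. x \<in> topspace X \<Longrightarrow> v \<in> W \<Longrightarrow> orth_proj Q v = 0 \<Longrightarrow> c * norm v \<le> norm (v + U x v)"
    and red: "\<And>x q. x \<in> topspace X \<Longrightarrow> q \<in> Q \<Longrightarrow> \<exists>b\<in>W. orth_proj Q b = 0 \<and> U x (b + q) = - b + f x q"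
  shows "isometry_pair Q (V o\<^sub>L cproj Q) (cproj Q o\<^sub>L V')"
    "homotopic_with (\<lambda>_. True) X (UF_top UNIV)
      (\<lambda>x. inflate (V o\<^sub>L cproj Q) (cproj Q o\<^sub>L V') (f x)) (\<lambda>x. inflate V V' (U x))"
proof -
  note VD = isometry_pairD[OF V]
  let ?P = "orth_proj Q"
  note P = cproj_apply[OF Q(1,2)]
  note P_in = orth_proj_in[OF Q(1,2)] and P_same = orth_proj_same[OF Q(1,2)]
  show pair: "isometry_pair Q (V o\<^sub>L cproj Q) (cproj Q o\<^sub>L V')"
    using Q(3) P_in by (auto simp: isometry_pair_def P VD(1,3) orth_proj_scaleC[OF Q(1,2)] cinner_orth_proj[OF Q(1,2)]
        P_same VD(5))
  \<comment> \<open>The projection onto the image of the complement of \<open>Q\<close> in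
    \<open>W\<close>. Its kernel contains, besides the image of \<open>Q\<close>, the complement of
    the range of \<open>V\<close>, where both inflated operators are the identity.\<close>
  define p where "p = V o\<^sub>L (V' - (cproj Q o\<^sub>L V'))"
  have p: "p z = V (V' z - ?P (V' z))" for z by (simp add: p_def blinfun_simps P)
  have in_W: "V' z - ?P (V' z) \<in> W" for z using VD(6) P_in Q(3) W by (blast intro: csubspace_diff)
  have V'p: "V' (p z) = V' z - ?P (V' z)" for z by (simp only: p VD(5)[OF in_W])
  have PP: "?P (a - ?P a) = 0" for a
    by (simp add: orth_proj_diff[OF Q(1,2)] P_same[OF P_in])
  have PV'p: "?P (V' (p z)) = 0" for z unfolding V'p by (rule PP)
  have ker: "V' z = ?P (V' z)" "V' z \<in> Q" if "p z = 0" for z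
  proof -
    have "V' (p z) = 0" using that by (simp add: blinfun.zero_right)
    then show "V' z = ?P (V' z)" by (simp add: V'p)
    then show "V' z \<in> Q" using P_in by metis
  qed
  have inf_f: "inflate (V o\<^sub>L cproj Q) (cproj Q o\<^sub>L V') (f x) z = V (f x (?P (V' z))) + (z - V (?P (V' z)))"
    if "x \<in> topspace X" for x z
  proof -
    have "f x (?P (V' z)) \<in> Q"
      using f[OF that] unitary_opsD(4)[of "f x" Q, OF _ P_in] by (simp add: UF_def)
    then show ?thesis by (simp add: inflate_apply P P_same P_same[OF P_in])
  qed
  show "homotopic_with (\<lambda>_. True) X (UF_top UNIV)
      (\<lambda>x. inflate (V o\<^sub>L cproj Q) (cproj Q o\<^sub>L V') (f x)) (\<lambda>x. inflate V V' (U x))"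
  proof (rule homotopic_cayley[where p = p and c = c])
    show "p (p z) = p z" for z using p[of "p z"] PV'p[of z] by (simp only: p VD(5)[OF in_W]) simp
    show "cinner (p w) z = cinner w (p z)" for w z
      by (simp add: p VD(3) VD(4)[of w] cinner_simps cinner_orth_proj[OF Q(1,2)])
    show "p (a *\<^sub>C z) = a *\<^sub>C p z" for a z
      by (simp add: p VD(1,2) orth_proj_scaleC[OF Q(1,2)] flip: scaleC_diff_right)
    show "c > 0" by (rule c)
    show "c * norm z \<le> norm (z + inflate V V' (U x) z)" if x: "x \<in> topspace X" and z: "p z = z" for x z
    proof -
      define v where "v = V' z - ?P (V' z)"
      have v: "v \<in> W" "z = V v" "?P v = 0" using in_W[of z] p[of z] z PP by (simp_all add: v_def)
      have "z + inflate V V' (U x) z = V (v + U x v)"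
        by (simp add: v(2) inflate_apply VD(5)[OF v(1)] blinfun.add_right)
      moreover have "v + U x v \<in> W" by (intro csubspace_add[OF W] v unitary_opsD(4)[OF U(1)[OF x]])
      ultimately show ?thesis
        using c(2)[OF x v(1,3)] by (simp add: norm_isometry[OF V] v(1,2))
    qed
    show "inflate V V' (U x) \<in> unitary_ops UNIV" if "x \<in> topspace X" for x
      by (rule inflate_unitary[OF V U(1)[OF that]])
    show "continuous_map X euclidean (\<lambda>x. inflate V V' (U x))"
      by (intro continuous_map_inflate U(2)) auto
    show "inflate (V o\<^sub>L cproj Q) (cproj Q o\<^sub>L V') (f x) \<in> UF UNIV" if "x \<in> topspace X" for x
      by (rule inflate_UF[OF pair f[OF that] Q(2)])
    show "inflate (V o\<^sub>L cproj Q) (cproj Q o\<^sub>L V') (f x) z = z" if "x \<in> topspace X" "p z = z" for x z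
      using PV'p[of z] that by (simp add: inf_f blinfun.zero_right)
    show "p (inflate (V o\<^sub>L cproj Q) (cproj Q o\<^sub>L V') (f x) z) = 0" if x: "x \<in> topspace X" and z: "p z = 0" for x z
    proof -
      have fQ: "f x (V' z) \<in> Q"
        using f[OF x] unitary_opsD(4)[of "f x" Q, OF _ ker(2)[OF z]] by (simp add: UF_def)
      then have "V' (inflate (V o\<^sub>L cproj Q) (cproj Q o\<^sub>L V') (f x) z) = f x (V' z)"
        using Q(3) VD(5)[of "f x (V' z)"]
        by (simp add: inf_f[OF x] ker(1)[OF z, symmetric] blinfun_simps VD(7) subset_iff)
      then show ?thesis by (simp add: p P_same[OF fQ] blinfun.zero_right)
    qed
    show "\<exists>a. p a = a \<and> inflate V V' (U x) (a + z) = - a + inflate (V o\<^sub>L cproj Q) (cproj Q o\<^sub>L V') (f x) z"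
      if x: "x \<in> topspace X" and z: "p z = 0" for x z
    proof -
      obtain b where b: "b \<in> W" "?P b = 0" "U x (b + V' z) = - b + f x (V' z)"
        using red[OF x ker(2)[OF z]] by blast
      have "p (V b) = V b" by (simp add: p VD(5)[OF b(1)] b(2))
      moreover have "inflate V V' (U x) (V b + z) = - V b + inflate (V o\<^sub>L cproj Q) (cproj Q o\<^sub>L V') (f x) z"
      proof -
        have "V' (V b + z) = b + V' z" by (simp add: blinfun.add_right VD(5)[OF b(1)])
        then show ?thesis
          by (simp add: inflate_apply[of V V'] inf_f[OF x] ker(1)[OF z, symmetric] b(3)
              blinfun.add_right[of V] blinfun.diff_right[of V] blinfun.minus_right[of V])
      qed
      ultimately show ?thesis by blast
    qed
  qed
qed

section \<open>Symplectic reduction\<close>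

text \<open>Uniform boundedness by Baire: the closed sets \<open>A n\<close> cover the space, so one
  of them contains a ball.\<close>

lemma weakly_bounded_imp_bounded:
  fixes Z :: "'a::{real_inner, complete_space} set"
  assumes "\<And>y. \<exists>C. \<forall>z\<in>Z. \<bar>inner z y\<bar> \<le> C"
  shows "\<exists>C. \<forall>z\<in>Z. norm z \<le> C"
proof -
  define A where "A n = {y. \<forall>z\<in>Z. \<bar>inner z y\<bar> \<le> real n}" for n
  have cl: "closed (A n)" for n
  proof -
    have "A n = (\<Inter>z\<in>Z. {y. \<bar>inner z y\<bar> \<le> real n})" by (auto simp: A_def)
    then show ?thesis by (auto intro!: closed_INT closed_Collect_le continuous_intros)
  qed
  have un: "\<Union>(range A) = UNIV"
  proof -
    have "y \<in> \<Union>(range A)" for y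
    proof -
      obtain C where C: "\<forall>z\<in>Z. \<bar>inner z y\<bar> \<le> C" using assms by blast
      obtain n :: nat where "C \<le> real n" using real_arch_simple by blast
      then have "y \<in> A n" using C by (force simp: A_def)
      then show ?thesis by blast
    qed
    then show ?thesis by blast
  qed
  have "\<exists>n. interior (A n) \<noteq> {}"
  proof (rule ccontr)
    assume "\<not> ?thesis"
    then have "Met_TC.mtopology interior_of \<Union>(range A) = {}"
      using cl by (intro Met_TC.metric_Baire_category_alt) (auto simp: complete_UNIV)
    then show False by (simp add: un)
  qed
  then obtain n y r where "r > 0" and ball: "ball y r \<subseteq> A n"
    using open_contains_ball interior_subset open_interior by (metis ex_in_conv subset_trans)
  \<comment> \<open>Test \<open>z\<close> with the vector \<open>w\<close> of norm
    \<open>r / 2\<close> in its own direction. As a difference of two points of \<open>A n\<close>,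
    it has inner product at most \<open>2 * n\<close> with \<open>z\<close>.\<close>
  have "norm z \<le> 4 * n / r" if z: "z \<in> Z" for z
  proof (cases "z = 0")
    case False
    define w where "w = (r / 2 / norm z) *\<^sub>R z"
    have "norm w < r" using False \<open>r > 0\<close> by (simp add: w_def)
    then have "y + w \<in> ball y r" "y \<in> ball y r" using \<open>r > 0\<close> by (simp_all add: dist_norm)
    then have "y + w \<in> A n" "y \<in> A n" using ball by blast+
    then have "\<bar>inner z (y + w)\<bar> \<le> n" "\<bar>inner z y\<bar> \<le> n" using z by (auto simp: A_def)
    then have "inner z w \<le> 2 * n" by (simp add: inner_add_right)
    moreover have "inner z w = r / 2 * norm z"
      using False by (simp add: w_def power2_norm_eq_inner[symmetric] power2_eq_square)
    ultimately show ?thesis using \<open>r > 0\<close> by (simp add: field_simps)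
  qed (use \<open>r > 0\<close> in simp)
  then show ?thesis by blast
qed

lemma cinner_J_commute:
  assumes "skew_adjoint_unitary J"
  shows "cinner (J x) y = - cnj (cinner (J y) x)"
  using skew_adjoint_unitaryD(8)[OF assms, of x y] cinner_commute[of x "J y"] by simp

text \<open>Write \<open>y = a + b\<close> with \<open>a\<close> in \<open>M\<close> and
  \<open>b\<close> in the annihilator of \<open>\<Gamma>\<close>. Pairing \<open>J g\<close> with
  \<open>y\<close> loses \<open>b\<close>, and \<open>g\<close> may be replaced by
  \<open>g - m\<close> because \<open>M\<close> is isotropic. So the vectors \<open>J g\<close>,
  with \<open>g\<close> at distance at most 1 from \<open>M\<close>, are weakly bounded and hence
  bounded.\<close>

lemma transversal_angle:
  assumes J: "skew_adjoint_unitary J" and M: "lagrangian UNIV (sform J) M"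
    and \<Gamma>: "csubspace \<Gamma>" and T: "transversal M \<Gamma> (ann J \<Gamma>)"
  obtains c where "c > 0" "\<And>g m. g \<in> \<Gamma> \<Longrightarrow> m \<in> M \<Longrightarrow> c * norm g \<le> norm (g - m)"
proof -
  note JD = skew_adjoint_unitaryD[OF J]
  note Ms = lagrangian_subspace[OF J closed_UNIV complex_vector.subspace_UNIV UNIV_I M]
  define Z where "Z = J ` {g \<in> \<Gamma>. \<exists>m\<in>M. norm (g - m) \<le> 1}"
  have "\<exists>C. \<forall>z\<in>Z. \<bar>inner z y\<bar> \<le> C" for y
  proof -
    have "y \<in> {x + y |x y. x \<in> M \<and> y \<in> ann J \<Gamma>}" using T by (auto simp: transversal_def)
    then obtain a b where y: "y = a + b" "a \<in> M" "b \<in> ann J \<Gamma>" by blast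
    have "\<bar>inner (J g) y\<bar> \<le> norm a" if g: "g \<in> \<Gamma>" "m \<in> M" "norm (g - m) \<le> 1" for g m
    proof -
      have "cinner (J g) b = 0"
        using cinner_J_commute[OF J, of g b] y(3) g(1) by (simp add: annihilator_def sform_def)
      moreover have "cinner (J m) a = 0" using g(2) y(2) by (rule Ms(4))
      ultimately have "inner (J g) y = inner (J (g - m)) a"
        by (simp add: inner_eq_Re_cinner y(1) cinner_simps JD(3))
      also have "\<bar>\<dots>\<bar> \<le> norm (g - m) * norm a" using Cauchy_Schwarz_ineq2[of "J (g - m)" a] by (simp add: JD(10))
      also have "\<dots> \<le> norm a" using mult_right_mono[OF g(3), of "norm a"] by simp
      finally show ?thesis .
    qed
    then show ?thesis unfolding Z_def by blast
  qed
  then obtain C where C: "\<forall>z\<in>Z. norm z \<le> C" using weakly_bounded_imp_bounded by blast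
  show thesis
  proof (rule that[of "1 / max C 1"])
    fix g m assume g: "g \<in> \<Gamma>" "m \<in> M"
    show "1 / max C 1 * norm g \<le> norm (g - m)"
    proof (cases "g = m")
      case True
      then have "g = 0" using g T unfolding transversal_def by blast
      then show ?thesis by simp
    next
      case False
      define r where "r = 1 / norm (g - m)"
      have "norm (r *\<^sub>R g - r *\<^sub>R m) \<le> 1"
        using False by (simp add: r_def flip: scaleR_diff_right)
      moreover have "r *\<^sub>R g \<in> \<Gamma>" "r *\<^sub>R m \<in> M" using g \<Gamma> Ms(2) by (simp_all add: csubspace_scaleR)
      ultimately have "J (r *\<^sub>R g) \<in> Z" by (auto simp: Z_def)
      then have "norm (r *\<^sub>R g) \<le> max C 1" using C by (force simp: JD(10))
      then have "norm g \<le> max C 1 * norm (g - m)" using False by (simp add: r_def field_simps)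
      moreover have "0 < max C 1" by simp
      ultimately show ?thesis by (simp add: field_simps)
    qed
  qed simp
qed

section \<open>Lagrangian subspaces of the quotient and their representatives\<close>

context
  fixes J :: "'a::chilbert_space \<Rightarrow> 'a" and \<Gamma> :: "'a set"
  assumes J: "skew_adjoint_unitary J" and \<Gamma>: "csubspace \<Gamma>" "closed \<Gamma>" "isotropic UNIV (sform J) \<Gamma>"
begin

lemma ann_iff: "x \<in> ann J \<Gamma> \<longleftrightarrow> (\<forall>y\<in>\<Gamma>. cinner (J x) y = 0)"
  by (simp add: annihilator_def sform_def)

lemma ann_orth: "x \<in> ann J \<Gamma> \<Longrightarrow> y \<in> \<Gamma> \<Longrightarrow> cinner (J x) y = 0 \<and> cinner (J y) x = 0"
  using cinner_J_commute[OF J, of y x] by (simp add: ann_iff)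

lemma ann_subspace: "closed (ann J \<Gamma>)" "csubspace (ann J \<Gamma>)"
proof -
  have "ann J \<Gamma> = {x. \<forall>f\<in>J ` \<Gamma>. cinner x f = 0}"
    by (auto simp: ann_iff skew_adjoint_unitaryD(8)[OF J])
  then show "closed (ann J \<Gamma>)" "csubspace (ann J \<Gamma>)" by (simp_all only: closed_orth_set csubspace_orth_set)
qed

lemma \<Gamma>_ann: "\<Gamma> \<subseteq> ann J \<Gamma>"
  using \<Gamma>(3) by (simp add: isotropic_def)

lemma quot_model_iff: "x \<in> quot_model J \<Gamma> \<longleftrightarrow> x \<in> ann J \<Gamma> \<and> (\<forall>y\<in>\<Gamma>. cinner x y = 0)"
  by (simp add: quot_model_def orth_diff_def)

lemma quot_model_subspace:
  "closed (quot_model J \<Gamma>)" "csubspace (quot_model J \<Gamma>)" "x \<in> quot_model J \<Gamma> \<Longrightarrow> J x \<in> quot_model J \<Gamma>"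
proof -
  have eq: "quot_model J \<Gamma> = ann J \<Gamma> \<inter> {x. \<forall>y\<in>\<Gamma>. cinner x y = 0}" by (auto simp: quot_model_iff)
  show "closed (quot_model J \<Gamma>)" unfolding eq by (intro closed_Int ann_subspace closed_orth_set)
  show "csubspace (quot_model J \<Gamma>)"
    unfolding eq by (intro complex_vector.subspace_inter ann_subspace csubspace_orth_set)
  show "x \<in> quot_model J \<Gamma> \<Longrightarrow> J x \<in> quot_model J \<Gamma>"
    by (simp add: quot_model_iff ann_iff skew_adjoint_unitaryD(9)[OF J] cinner_minus_left)
qed

lemma ann_decompose: "x \<in> ann J \<Gamma> \<Longrightarrow> x - orth_proj \<Gamma> x \<in> quot_model J \<Gamma>"
  using orth_proj_in[OF \<Gamma>(2,1), of x] \<Gamma>_ann ann_subspace(2) orth_proj_orth[OF \<Gamma>(2,1)]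
  by (auto simp: quot_model_iff intro: csubspace_diff)

lemma quot_map_eq_iff: "quot_map \<Gamma> x = quot_map \<Gamma> y \<longleftrightarrow> x - y \<in> \<Gamma>"
proof
  assume "quot_map \<Gamma> x = quot_map \<Gamma> y"
  moreover have "x \<in> quot_map \<Gamma> x" using csubspace_0[OF \<Gamma>(1)] by (force simp: quot_map_def)
  ultimately show "x - y \<in> \<Gamma>" by (auto simp: quot_map_def)
next
  assume xy: "x - y \<in> \<Gamma>"
  have sub: "quot_map \<Gamma> a \<subseteq> quot_map \<Gamma> b" if "a - b \<in> \<Gamma>" for a b
  proof
    fix z assume "z \<in> quot_map \<Gamma> a"
    then obtain g where "g \<in> \<Gamma>" "z = a + g" by (auto simp: quot_map_def)
    then have "z = b + ((a - b) + g)" "(a - b) + g \<in> \<Gamma>" using that \<Gamma>(1) by (simp_all add: csubspace_add)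
    then show "z \<in> quot_map \<Gamma> b" unfolding quot_map_def by blast
  qed
  have "y - x \<in> \<Gamma>" using csubspace_neg[OF \<Gamma>(1) xy] by simp
  with xy show "quot_map \<Gamma> x = quot_map \<Gamma> y" using sub by blast
qed

lemma quot_map_proj: "quot_map \<Gamma> (x - orth_proj \<Gamma> x) = quot_map \<Gamma> x"
  unfolding quot_map_eq_iff using csubspace_neg[OF \<Gamma>(1) orth_proj_in[OF \<Gamma>(2,1)]] by simp

context
  fixes L assumes L: "lagrangian (quot_space J \<Gamma>) (quot_sform J) L"
begin

text \<open>Every coset in the quotient has the representative
  \<open>z - orth_proj \<Gamma> z\<close> in the model, and the form does not depend on
  representatives. Testing against cosets or against lifted vectors is therefore the same.\<close>

lemma lagrangian_quot_lift: "lagrangian (quot_model J \<Gamma>) (sform J) (quot_lift J \<Gamma> L)"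
proof -
  have sform: "quot_sform J (quot_map \<Gamma> x) (quot_map \<Gamma> y) = sform J x y"
    if "x \<in> ann J \<Gamma>" "y \<in> ann J \<Gamma>" for x y
    using quot_sform_quot_map[OF J \<Gamma>(1,3) that] .
  have "x \<in> quot_lift J \<Gamma> L \<longleftrightarrow> x \<in> quot_model J \<Gamma> \<and> (\<forall>y\<in>quot_lift J \<Gamma> L. sform J x y = 0)" for x
  proof (cases "x \<in> quot_model J \<Gamma>")
    case True
    then have x: "x \<in> ann J \<Gamma>" by (simp add: quot_model_iff)
    have "quot_map \<Gamma> x \<in> L \<longleftrightarrow> (\<forall>B\<in>L. quot_sform J (quot_map \<Gamma> x) B = 0)"
      using L x unfolding lagrangian_def annihilator_def quot_space_def by blast
    also have "\<dots> \<longleftrightarrow> (\<forall>y\<in>quot_lift J \<Gamma> L. sform J x y = 0)"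
    proof
      assume a: "\<forall>B\<in>L. quot_sform J (quot_map \<Gamma> x) B = 0"
      show "\<forall>y\<in>quot_lift J \<Gamma> L. sform J x y = 0"
        using a sform[OF x] by (auto simp: quot_lift_def quot_model_iff)
    next
      assume a: "\<forall>y\<in>quot_lift J \<Gamma> L. sform J x y = 0"
      show "\<forall>B\<in>L. quot_sform J (quot_map \<Gamma> x) B = 0"
      proof
        fix B assume B: "B \<in> L"
        then have "B \<in> quot_space J \<Gamma>" using L by (auto simp: lagrangian_def annihilator_def)
        then obtain z where z: "z \<in> ann J \<Gamma>" "B = quot_map \<Gamma> z" by (auto simp: quot_space_def)
        have "z - orth_proj \<Gamma> z \<in> quot_lift J \<Gamma> L"
          using ann_decompose[OF z(1)] B z(2) by (simp add: quot_lift_def quot_map_proj)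
        then have "sform J x (z - orth_proj \<Gamma> z) = 0" "z - orth_proj \<Gamma> z \<in> ann J \<Gamma>"
          using a by (auto simp: quot_lift_def quot_model_iff)
        then show "quot_sform J (quot_map \<Gamma> x) B = 0"
          using sform[OF x, of "z - orth_proj \<Gamma> z"] by (simp add: quot_map_proj z(2))
      qed
    qed
    finally show ?thesis using True by (simp add: quot_lift_def)
  qed (auto simp: quot_lift_def)
  then show ?thesis unfolding lagrangian_def annihilator_def by blast
qed

lemmas quot_lift_subspace =
  lagrangian_subspace[OF J quot_model_subspace lagrangian_quot_lift]

lemma quot_pull_iff: "x \<in> quot_pull J \<Gamma> L \<longleftrightarrow> x \<in> ann J \<Gamma> \<and> x - orth_proj \<Gamma> x \<in> quot_lift J \<Gamma> L"
  using ann_decompose by (auto simp: quot_pull_def quot_lift_def quot_map_proj)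

lemma quot_lift_orth: "l \<in> quot_lift J \<Gamma> L \<Longrightarrow> g \<in> \<Gamma> \<Longrightarrow> cinner l g = 0"
  by (simp add: quot_lift_def quot_model_iff)

lemma quot_lift_ann: "l \<in> quot_lift J \<Gamma> L \<Longrightarrow> l \<in> ann J \<Gamma>"
  by (simp add: quot_lift_def quot_model_iff)

lemma quot_pull_add:
  assumes "g \<in> \<Gamma>" "l \<in> quot_lift J \<Gamma> L"
  shows "g + l \<in> quot_pull J \<Gamma> L"
proof -
  have "orth_proj \<Gamma> (g + l) = g"
    using assms by (intro orth_proj_eqI[OF \<Gamma>(2,1)]) (simp_all add: quot_lift_orth)
  moreover have "g + l \<in> ann J \<Gamma>"
    using assms \<Gamma>_ann ann_subspace(2) quot_lift_ann by (blast intro: csubspace_add)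
  ultimately show ?thesis using assms by (simp add: quot_pull_iff)
qed

text \<open>On the annihilator of \<open>\<Gamma>\<close> the components in \<open>\<Gamma>\<close>
  drop out of the form, so the question reduces to the lift. Vectors annihilating the pullback are
  in the annihilator of \<open>\<Gamma>\<close> because the pullback contains
  \<open>\<Gamma>\<close>.\<close>

lemma lagrangian_quot_pull: "lagrangian UNIV (sform J) (quot_pull J \<Gamma> L)"
proof -
  have sform_add: "cinner (J x) y = cinner (J (x - orth_proj \<Gamma> x)) (y - orth_proj \<Gamma> y)"
    if "x \<in> ann J \<Gamma>" "y \<in> ann J \<Gamma>" for x y
  proof -
    have px: "orth_proj \<Gamma> x \<in> \<Gamma>" and py: "orth_proj \<Gamma> y \<in> \<Gamma>" by (rule orth_proj_in[OF \<Gamma>(2,1)])+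
    then have "cinner (J x) (orth_proj \<Gamma> y) = 0" "cinner (J (orth_proj \<Gamma> x)) y = 0"
      "cinner (J (orth_proj \<Gamma> x)) (orth_proj \<Gamma> y) = 0"
      using ann_orth that \<Gamma>_ann by blast+
    then show ?thesis by (simp add: skew_adjoint_unitaryD(3)[OF J] cinner_simps)
  qed
  have "x \<in> quot_pull J \<Gamma> L \<longleftrightarrow> (\<forall>y\<in>quot_pull J \<Gamma> L. cinner (J x) y = 0)" for x
  proof
    assume "x \<in> quot_pull J \<Gamma> L"
    then show "\<forall>y\<in>quot_pull J \<Gamma> L. cinner (J x) y = 0"
      using sform_add quot_lift_subspace(4) by (auto simp: quot_pull_iff)
  next
    assume a: "\<forall>y\<in>quot_pull J \<Gamma> L. cinner (J x) y = 0"
    have "g \<in> quot_pull J \<Gamma> L" if "g \<in> \<Gamma>" for g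
      using quot_pull_add[OF that csubspace_0[OF quot_lift_subspace(2)]] by simp
    then have x: "x \<in> ann J \<Gamma>" using a by (simp add: ann_iff)
    have "cinner (J (x - orth_proj \<Gamma> x)) l = 0" if l: "l \<in> quot_lift J \<Gamma> L" for l
    proof -
      have "l \<in> quot_pull J \<Gamma> L" using quot_pull_add[OF csubspace_0[OF \<Gamma>(1)] l] by simp
      then have "cinner (J x) l = 0" using a by blast
      moreover have "orth_proj \<Gamma> l = 0" by (rule orth_proj_zero[OF \<Gamma>(2,1)]) (rule quot_lift_orth[OF l])
      ultimately show ?thesis using sform_add[OF x quot_lift_ann[OF l]] by simp
    qed
    then have "x - orth_proj \<Gamma> x \<in> quot_lift J \<Gamma> L"
      by (intro quot_lift_subspace(5) ann_decompose[OF x])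
    then show "x \<in> quot_pull J \<Gamma> L" using x by (simp add: quot_pull_iff)
  qed
  then show ?thesis unfolding lagrangian_def annihilator_def sform_def by blast
qed

lemmas quot_pull_subspace =
  lagrangian_subspace[OF J closed_UNIV complex_vector.subspace_UNIV UNIV_I lagrangian_quot_pull]

text \<open>The pullback is the orthogonal sum of \<open>\<Gamma>\<close> and the lift. This gives
  both continuity of the pulled back family and its reflection.\<close>

lemma orth_proj_quot_pull: "orth_proj (quot_pull J \<Gamma> L) x = orth_proj \<Gamma> x + orth_proj (quot_lift J \<Gamma> L) x"
proof (rule orth_proj_eqI[OF quot_pull_subspace(1,2)])
  let ?g = "orth_proj \<Gamma> x" and ?l = "orth_proj (quot_lift J \<Gamma> L) x"
  have g: "?g \<in> \<Gamma>" and l: "?l \<in> quot_lift J \<Gamma> L"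
    by (rule orth_proj_in[OF \<Gamma>(2,1)], rule orth_proj_in[OF quot_lift_subspace(1,2)])
  then show "?g + ?l \<in> quot_pull J \<Gamma> L" by (rule quot_pull_add)
  fix y assume "y \<in> quot_pull J \<Gamma> L"
  then have y: "y - orth_proj \<Gamma> y \<in> quot_lift J \<Gamma> L" by (simp add: quot_pull_iff)
  have py: "orth_proj \<Gamma> y \<in> \<Gamma>" by (rule orth_proj_in[OF \<Gamma>(2,1)])
  have "cinner (x - (?g + ?l)) (orth_proj \<Gamma> y) = 0"
    using orth_proj_orth[OF \<Gamma>(2,1) py, of x] quot_lift_orth[OF l py] by (simp add: cinner_simps)
  moreover have "cinner (x - (?g + ?l)) (y - orth_proj \<Gamma> y) = 0"
  proof -
    have "cinner ?g (y - orth_proj \<Gamma> y) = 0" using quot_lift_orth[OF y g] cinner_eq_0_commute by blast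
    moreover have "cinner (x - ?l) (y - orth_proj \<Gamma> y) = 0"
      using orth_proj_orth[OF quot_lift_subspace(1,2) y] .
    ultimately show ?thesis by (simp add: cinner_diff_left cinner_add_left)
  qed
  ultimately have "cinner (x - (?g + ?l)) (orth_proj \<Gamma> y + (y - orth_proj \<Gamma> y)) = 0"
    by (simp only: cinner_add_right add_0)
  then show "cinner (x - (?g + ?l)) y = 0" by simp
qed

end

context
  fixes M assumes M: "lagrangian UNIV (sform J) M" and T: "transversal M \<Gamma> (ann J \<Gamma>)"
begin

lemmas MD = lagrangian_subspace[OF J closed_UNIV complex_vector.subspace_UNIV UNIV_I M]

lemma quot_lift_push_iff:
  "x \<in> quot_lift J \<Gamma> (quot_push J \<Gamma> M) \<longleftrightarrow> x \<in> quot_model J \<Gamma> \<and> (\<exists>g\<in>\<Gamma>. x + g \<in> M)"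
proof -
  have "quot_map \<Gamma> x \<in> quot_push J \<Gamma> M \<longleftrightarrow> (\<exists>g\<in>\<Gamma>. x + g \<in> M)" if x: "x \<in> quot_model J \<Gamma>"
  proof
    assume "quot_map \<Gamma> x \<in> quot_push J \<Gamma> M"
    then obtain m where m: "m \<in> M" "quot_map \<Gamma> m = quot_map \<Gamma> x" unfolding quot_push_def by (metis IntE imageE)
    then have "m - x \<in> \<Gamma>" "x + (m - x) \<in> M" by (simp_all add: quot_map_eq_iff)
    then show "\<exists>g\<in>\<Gamma>. x + g \<in> M" by blast
  next
    assume "\<exists>g\<in>\<Gamma>. x + g \<in> M"
    then obtain g where g: "g \<in> \<Gamma>" "x + g \<in> M" by blast
    moreover have "x + g \<in> ann J \<Gamma>"
      using x g(1) \<Gamma>_ann ann_subspace(2) by (auto simp: quot_model_iff intro: csubspace_add)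
    moreover have "quot_map \<Gamma> (x + g) = quot_map \<Gamma> x" using g(1) by (simp add: quot_map_eq_iff)
    ultimately show "quot_map \<Gamma> x \<in> quot_push J \<Gamma> M" unfolding quot_push_def by (metis IntI imageI)
  qed
  then show ?thesis by (auto simp: quot_lift_def)
qed

text \<open>Isotropy is inherited from \<open>M\<close>. For maximality, closedness of
  \<open>M + \<Gamma>\<close> is the key: it turns membership of \<open>x\<close> in
  \<open>M + \<Gamma>\<close> into the vanishing of a projection residual.\<close>

lemma lagrangian_quot_push: "lagrangian (quot_model J \<Gamma>) (sform J) (quot_lift J \<Gamma> (quot_push J \<Gamma> M))"
proof -
  let ?m = "quot_lift J \<Gamma> (quot_push J \<Gamma> M)"
  have iso: "cinner (J x) y = 0" if x: "x \<in> ?m" and y: "y \<in> ?m" for x y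
  proof -
    obtain g h where gh: "g \<in> \<Gamma>" "x + g \<in> M" "h \<in> \<Gamma>" "y + h \<in> M"
      using x y by (auto simp: quot_lift_push_iff)
    have "cinner (J (x + g)) (y + h) = 0" using gh(2,4) by (rule MD(4))
    moreover have "cinner (J x) h = 0" "cinner (J g) y = 0" "cinner (J g) h = 0"
      using ann_orth gh x y \<Gamma>_ann by (auto simp: quot_lift_push_iff quot_model_iff)
    ultimately show ?thesis by (simp add: skew_adjoint_unitaryD(1)[OF J] cinner_simps)
  qed
  moreover have "x \<in> ?m" if x: "x \<in> quot_model J \<Gamma>" and orth: "\<And>y. y \<in> ?m \<Longrightarrow> cinner (J x) y = 0" for x
  proof -
    let ?N = "{x + y |x y. x \<in> M \<and> y \<in> \<Gamma>}"
    have cl: "closed ?N" using T by (simp add: transversal_def)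
    have sub: "csubspace ?N" using complex_vector.subspace_sums[OF MD(2) \<Gamma>(1)] .
    define r where "r = x - orth_proj ?N x"
    have r: "cinner r n = 0" if "n \<in> ?N" for n
      unfolding r_def using cl sub that by (rule orth_proj_orth)
    have M_N: "n \<in> ?N" if "n \<in> M" for n using that csubspace_0[OF \<Gamma>(1)] by force
    have \<Gamma>_N: "n \<in> ?N" if "n \<in> \<Gamma>" for n using that csubspace_0[OF MD(2)] by force
    \<comment> \<open>A residual orthogonal to \<open>M\<close> and \<open>\<Gamma>\<close> is moved
      by \<open>J\<close> into \<open>M\<close> and the annihilator of \<open>\<Gamma>\<close>.
      Subtracting the \<open>\<Gamma>\<close>-component gives a member of \<open>?m\<close>, against
      which \<open>x\<close> may be tested.\<close>
    have "J r \<in> M"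
      by (rule MD(5)) (simp_all add: skew_adjoint_unitaryD(9)[OF J] cinner_minus_left r[OF M_N])
    moreover have Jr: "J r \<in> ann J \<Gamma>"
      by (simp add: ann_iff skew_adjoint_unitaryD(9)[OF J] cinner_minus_left r[OF \<Gamma>_N])
    moreover define h where "h = orth_proj \<Gamma> (J r)"
    moreover have h: "h \<in> \<Gamma>" unfolding h_def by (rule orth_proj_in[OF \<Gamma>(2,1)])
    ultimately have "J r - h \<in> ?m"
      using ann_decompose[OF Jr] by (auto simp: quot_lift_push_iff intro!: bexI[of _ h])
    then have "cinner (J x) (J r - h) = 0" by (rule orth)
    moreover have "cinner (J x) h = 0" using ann_orth x h by (auto simp: quot_model_iff)
    ultimately have "cinner x r = 0" by (simp add: cinner_simps skew_adjoint_unitaryD(7)[OF J])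
    moreover have "cinner r (orth_proj ?N x) = 0" by (rule r[OF orth_proj_in[OF cl sub]])
    then have "cinner (orth_proj ?N x) r = 0" using cinner_eq_0_commute by blast
    ultimately have "cinner r r = 0" by (simp add: r_def cinner_diff_left)
    then have "x = orth_proj ?N x" by (simp add: cinner_same r_def)
    then have "x \<in> ?N" using orth_proj_in[OF cl sub, of x] by simp
    then obtain m g where "x = m + g" "m \<in> M" "g \<in> \<Gamma>" by blast
    then have "x + (- g) \<in> M" "- g \<in> \<Gamma>" using csubspace_neg[OF \<Gamma>(1)] by simp_all
    then show ?thesis using x unfolding quot_lift_push_iff by blast
  qed
  moreover have "?m \<subseteq> quot_model J \<Gamma>" by (auto simp: quot_lift_def)
  ultimately show ?thesis unfolding lagrangian_def annihilator_def sform_def by blast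
qed

section \<open>The unreduced unitary on the positive part and its feedback loop\<close>

context
  fixes L assumes L: "lagrangian (quot_space J \<Gamma>) (quot_sform J) L"
begin

text \<open>
  The element \<open>g \<in> \<Gamma>\<close> that lifts an element of \<open>\<gamma>\<^sub>!M\<close> to \<open>M\<close> provides the solution: its positive part.
\<close>

lemma reduction_solve:
  assumes q: "q \<in> pos_part J (quot_model J \<Gamma>)"
  shows "\<exists>b\<in>pos_part J UNIV. orth_proj (pos_part J (quot_model J \<Gamma>)) b = 0 \<and>
    pair_unitary J UNIV (quot_pull J \<Gamma> L) M (b + q) = - b +
      pair_unitary J (quot_model J \<Gamma>) (quot_lift J \<Gamma> L) (quot_lift J \<Gamma> (quot_push J \<Gamma> M)) q"
    (is "\<exists>b\<in>?W. orth_proj ?Q b = 0 \<and> ?U (b + q) = - b + ?f q")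
proof -
  note UNIV_facts = J closed_UNIV complex_vector.subspace_UNIV UNIV_I
  note model_facts = J quot_model_subspace
  note W_sub = pos_part_subspace[OF UNIV_facts] and Q_sub = pos_part_subspace[OF model_facts]
  have Q_W: "?Q \<subseteq> ?W" by (auto simp: pos_part_def)
  let ?m = "quot_lift J \<Gamma> (quot_push J \<Gamma> M)" and ?N = "quot_pull J \<Gamma> L" and ?l = "quot_lift J \<Gamma> L"
  note ls = quot_lift_subspace[OF L] and Ns = quot_pull_subspace[OF L]
  note ms = lagrangian_subspace[OF model_facts lagrangian_quot_push]
  define q' where "q' = reflection ?l q"
  have q': "q' \<in> neg_part J (quot_model J \<Gamma>)"
    unfolding q'_def using reflection_pos_neg[OF model_facts lagrangian_quot_lift[OF L] q] .
  then have q'_neg: "q' \<in> neg_part J UNIV" by (simp add: neg_part_def)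
  have mq': "reflection ?m q' \<in> ?Q" by (rule reflection_neg_pos[OF model_facts lagrangian_quot_push q'])
  have "q' + reflection ?m q' \<in> ?m" by (rule reflection_add_self[OF ms(1,2)])
  then obtain g where g: "g \<in> \<Gamma>" "q' + reflection ?m q' + g \<in> M" by (auto simp: quot_lift_push_iff)
  define b where "b = orth_proj ?W g"
  have bW: "b \<in> ?W" unfolding b_def by (rule orth_proj_in[OF W_sub])
  have b: "b = (1/2) *\<^sub>R (g - \<i> *\<^sub>C J g)" unfolding b_def by (rule orth_proj_pos[OF UNIV_facts UNIV_I])
  have "orth_proj ?Q b = 0"
  proof (rule orth_proj_zero[OF Q_sub])
    fix y assume y: "y \<in> ?Q"
    then have "cinner g y = 0" "cinner (J g) y = 0"
      using g(1) ann_orth[of y g] cinner_eq_0_commute[of g y] by (auto simp: pos_part_def quot_model_iff)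
    then show "cinner b y = 0" by (simp add: b cinner_simps)
  qed
  moreover have "?U (b + q) = - b + ?f q"
  proof -
    have "g \<in> ?N" using quot_pull_add[OF L g(1) csubspace_0[OF ls(2)]] by simp
    then have Nb: "reflection ?N b = g - b"
      unfolding b_def by (rule reflection_orth_proj_pos[OF UNIV_facts lagrangian_quot_pull[OF L]])
    have "orth_proj \<Gamma> q = 0"
      using q by (intro orth_proj_zero[OF \<Gamma>(2,1)]) (auto simp: pos_part_def quot_model_iff)
    then have Nq: "reflection ?N q = q'"
      by (simp add: q'_def reflection_apply[OF Ns(1,2)] reflection_apply[OF ls(1,2)] orth_proj_quot_pull[OF L])
    have "reflection ?m q' \<in> ?W" using mq' Q_W by blast
    then have "orth_proj ?W (q' + reflection ?m q' + g) = reflection ?m q' + b"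
      using orth_proj_pos_neg[OF UNIV_facts _ q'_neg, of "reflection ?m q'"]
      by (simp add: b_def orth_proj_add[OF W_sub] add.commute)
    \<comment> \<open>The reflection in \<open>M\<close> exchanges the positive and negative parts
      of a vector of \<open>M\<close>. The negative part \<open>q' + g - b\<close> is also the image
      of \<open>b + q\<close> under the reflection in \<open>?N\<close>, so the two reflections can
      be chained.\<close>
    then have "reflection M (reflection ?m q' + b) = q' + g - b"
      using reflection_orth_proj_pos[OF UNIV_facts M g(2)] by simp
    then have "reflection M (q' + g - b) = reflection ?m q' + b"
      using reflection_involutive[OF MD(1,2)] by metis
    moreover have "reflection ?N (b + q) = q' + g - b" by (simp add: blinfun.add_right Nb Nq)
    moreover have "b + q \<in> ?W" using bW q Q_W by (blast intro: csubspace_add[OF W_sub(2)])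
    ultimately have "?U (b + q) = - (reflection ?m q' + b)"
      by (simp add: pair_unitary_pos[OF UNIV_facts lagrangian_quot_pull[OF L] M])
    also have "\<dots> = - b + ?f q"
      by (simp add: pair_unitary_pos[OF model_facts lagrangian_quot_lift[OF L] lagrangian_quot_push q] q'_def)
    finally show ?thesis .
  qed
  ultimately show ?thesis using bW by blast
qed

text \<open>On these \<open>v\<close> only \<open>\<Gamma>\<close> contributes to the reflection in
  the pullback, so \<open>g = v + w\<close> lies in \<open>\<Gamma>\<close> and has positive part
  \<open>v\<close>. Since \<open>v + ?U v\<close> equals \<open>g - (w + reflection M w)\<close>, it
  measures a distance from \<open>g\<close> to \<open>M\<close>.\<close>

lemma reduction_bound:
  assumes c: "c > 0" "\<And>g m. g \<in> \<Gamma> \<Longrightarrow> m \<in> M \<Longrightarrow> c * norm g \<le> norm (g - m)"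
    and v: "v \<in> pos_part J UNIV" "orth_proj (pos_part J (quot_model J \<Gamma>)) v = 0"
  shows "c * norm v \<le> norm (v + pair_unitary J UNIV (quot_pull J \<Gamma> L) M v)"
    (is "_ \<le> norm (v + ?U v)")
proof -
  let ?W = "pos_part J UNIV" and ?Q = "pos_part J (quot_model J \<Gamma>)"
  note UNIV_facts = J closed_UNIV complex_vector.subspace_UNIV UNIV_I
  note model_facts = J quot_model_subspace
  note W_sub = pos_part_subspace[OF UNIV_facts] and Q_sub = pos_part_subspace[OF model_facts]
  let ?N = "quot_pull J \<Gamma> L" and ?l = "quot_lift J \<Gamma> L"
  note ls = quot_lift_subspace[OF L] and Ns = quot_pull_subspace[OF L]
  have Jv: "J v = \<i> *\<^sub>C v" using v(1) by (simp add: pos_part_def)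
  \<comment> \<open>The positive part of \<open>l\<close> lies in \<open>?Q\<close>, to which
    \<open>v\<close> is orthogonal, and the negative part is orthogonal to every positive
    vector.\<close>
  have "orth_proj ?l v = 0"
  proof (rule orth_proj_zero[OF ls(1,2)])
    fix l assume l: "l \<in> ?l"
    then have lm: "l \<in> quot_model J \<Gamma>" by (simp add: quot_lift_def)
    have "cinner v (orth_proj ?Q l) = 0" using v(2) cinner_orth_proj[OF Q_sub, of v l] by simp
    then have "cinner v (l - \<i> *\<^sub>C J l) = 0" 
      by (simp only: orth_proj_pos[OF model_facts lm] cinner_scaleR_right) simp
    moreover have "cinner v (J l) = - \<i> * cinner v l" using skew_adjoint_unitaryD(8)[OF J, of v l] by (simp add: Jv cinner_simps)
    ultimately show "cinner v l = 0" by (simp add: cinner_simps)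
  qed
  then have Nv: "reflection ?N v = 2 *\<^sub>R orth_proj \<Gamma> v - v"
    by (simp add: reflection_apply[OF Ns(1,2)] orth_proj_quot_pull[OF L])
  define w where "w = reflection ?N v"
  define g where "g = v + w"
  have g: "g \<in> \<Gamma>" unfolding g_def w_def Nv
    using csubspace_scaleR[OF \<Gamma>(1) orth_proj_in[OF \<Gamma>(2,1)]] by simp
  have "w \<in> neg_part J UNIV" unfolding w_def by (rule reflection_pos_neg[OF UNIV_facts lagrangian_quot_pull[OF L] v(1)])
  then have "v = orth_proj ?W g" unfolding g_def using orth_proj_pos_neg[OF UNIV_facts v(1)] by simp
  then have "norm v \<le> norm g" using norm_orth_proj_le[OF W_sub] by metis
  then have "c * norm v \<le> c * norm g" using c(1) by simp
  also have "\<dots> \<le> norm (g - (w + reflection M w))" by (intro c(2) g reflection_add_self[OF MD(1,2)])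
  also have "g - (w + reflection M w) = v + ?U v"
    by (simp add: g_def w_def pair_unitary_pos[OF UNIV_facts lagrangian_quot_pull[OF L] M v(1)])
  finally show ?thesis .
qed

end

end

end

theorem theorem13p2:
  fixes J :: "'h::chilbert_space \<Rightarrow> 'h"
    and \<Gamma> M :: "'h set"
    and X :: "'x topology"
    and L :: "'x \<Rightarrow> 'h set set"
  assumes "separable_space (euclidean :: 'h topology)"
    and "\<not> finite_cdim (UNIV :: 'h set)"
    and "separable_space (euclidean :: 'k::chilbert_space topology)"
    and "\<not> finite_cdim (UNIV :: 'k set)"
    and "skew_adjoint_unitary J"
    and "lagrangian UNIV (sform J) M"
    and "csubspace \<Gamma>" and "closed \<Gamma>" and "isotropic UNIV (sform J) \<Gamma>"
    and "transversal M \<Gamma> (ann J \<Gamma>)"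
    and "\<And>x. x \<in> topspace X \<Longrightarrow> lagrangian (quot_space J \<Gamma>) (quot_sform J) (L x)"
    and "continuous_family X (\<lambda>x. quot_lift J \<Gamma> (L x))"
    and "\<And>x. x \<in> topspace X \<Longrightarrow>
      fredholm_pair (quot_model J \<Gamma>) (quot_lift J \<Gamma> (L x)) (quot_lift J \<Gamma> (quot_push J \<Gamma> M))"
  shows "(ind J UNIV X (\<lambda>x. quot_pull J \<Gamma> (L x)) (\<lambda>_. M) :: ('x \<Rightarrow> ('k \<Rightarrow>\<^sub>L 'k)) set) =
         ind J (quot_model J \<Gamma>) X (\<lambda>x. quot_lift J \<Gamma> (L x)) (\<lambda>_. quot_lift J \<Gamma> (quot_push J \<Gamma> M))
    \<and> (ind J UNIV X (\<lambda>x. quot_pull J \<Gamma> (L x)) (\<lambda>_. M) :: ('x \<Rightarrow> ('k \<Rightarrow>\<^sub>L 'k)) set) \<in> K1 X"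
proof -
  note sep = assms(1) and sepk = assms(3) and infk = assms(4) and J = assms(5) and M = assms(6)
    and \<Gamma> = assms(7-9) and T = assms(10) and L = assms(11)
  let ?W = "pos_part J UNIV" and ?Q = "pos_part J (quot_model J \<Gamma>)"
  let ?m = "quot_lift J \<Gamma> (quot_push J \<Gamma> M)"
  define U where "U x = pair_unitary J UNIV (quot_pull J \<Gamma> (L x)) M" for x
  define f where "f x = pair_unitary J (quot_model J \<Gamma>) (quot_lift J \<Gamma> (L x)) ?m" for x
  note UNIV_facts = J closed_UNIV complex_vector.subspace_UNIV UNIV_I
  note model_facts = J quot_model_subspace[OF J \<Gamma>]
  note W = pos_part_subspace[OF UNIV_facts] and Q = pos_part_subspace[OF model_facts]
  note lift = lagrangian_quot_lift[OF J \<Gamma> L] and pull = lagrangian_quot_pull[OF J \<Gamma> L]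
  note push = lagrangian_quot_push[OF J \<Gamma> M T]
  have Q_W: "?Q \<subseteq> ?W" by (auto simp: pos_part_def)
  have f_UF: "f x \<in> UF ?Q" if "x \<in> topspace X" for x
    unfolding f_def using pair_unitary_UF[OF model_facts lift[OF that] push assms(13)[OF that]] .
  have f_cont: "continuous_map X euclidean f"
    unfolding f_def using continuous_map_pair_unitary[OF model_facts lift push assms(12)] .
  have U_unitary: "U x \<in> unitary_ops ?W" if "x \<in> topspace X" for x
    unfolding U_def using pair_unitary_unitary[OF UNIV_facts pull[OF that] M] .
  \<comment> \<open>Pulling back adds the constant operator \<open>cproj \<Gamma>\<close> to the
    continuous family of projections onto the lifts.\<close>
  have "continuous_map X euclidean (\<lambda>x. cproj (quot_pull J \<Gamma> (L x)))"
  proof (rule continuous_map_eq)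
    show "continuous_map X euclidean (\<lambda>x. cproj \<Gamma> + cproj (quot_lift J \<Gamma> (L x)))"
      using assms(12) by (intro continuous_map_add) (auto simp: continuous_family_def cproj_def)
    show "cproj \<Gamma> + cproj (quot_lift J \<Gamma> (L x)) = cproj (quot_pull J \<Gamma> (L x))" if x: "x \<in> topspace X" for x
      by (rule blinfun_eqI)
        (simp add: blinfun.add_left cproj_apply[OF \<Gamma>(2,1)] orth_proj_quot_pull[OF J \<Gamma> L[OF x]]
          cproj_apply[OF quot_lift_subspace(1,2)[OF J \<Gamma> L[OF x]]]
          cproj_apply[OF quot_pull_subspace(1,2)[OF J \<Gamma> L[OF x]]])
  qed
  then have U_cont: "continuous_map X euclidean U"
    unfolding U_def by (intro continuous_map_pair_unitary[OF UNIV_facts pull M])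
      (auto simp: continuous_family_def cproj_def)
  obtain c where c: "c > 0" "\<And>g m. g \<in> \<Gamma> \<Longrightarrow> m \<in> M \<Longrightarrow> c * norm g \<le> norm (g - m)"
    using transversal_angle[OF J M \<Gamma>(1) T] by blast
  obtain V :: "'h \<Rightarrow>\<^sub>L 'k" and V' where V: "isometry_pair ?W V V'" "\<not> finite_cdim {y. V' y = 0}"
    "\<And>f. (\<And>x. x \<in> topspace X \<Longrightarrow> f x \<in> unitary_ops ?W) \<Longrightarrow>
      K1_class X ?W f = htpy_class X (\<lambda>x. inflate V V' (f x))"
    using K1_class_inflate[OF sep sepk infk W] by blast
  obtain S :: "'h \<Rightarrow>\<^sub>L 'k" and S' where S: "isometry_pair ?Q S S'" "\<not> finite_cdim {y. S' y = 0}"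
    "\<And>f. (\<And>x. x \<in> topspace X \<Longrightarrow> f x \<in> unitary_ops ?Q) \<Longrightarrow>
      K1_class X ?Q f = htpy_class X (\<lambda>x. inflate S S' (f x))"
    using K1_class_inflate[OF sep sepk infk Q] by blast
  \<comment> \<open>The embedding of \<open>?Q\<close> inherited from \<open>?W\<close>; in general
    it differs from \<open>S\<close>, which comes from the choice made for \<open>?Q\<close>
    itself.\<close>
  let ?V = "V o\<^sub>L cproj ?Q" and ?V' = "cproj ?Q o\<^sub>L V'"
  have red: "isometry_pair ?Q ?V ?V'"
    "homotopic_with (\<lambda>_. True) X (UF_top UNIV) (\<lambda>x. inflate ?V ?V' (f x)) (\<lambda>x. inflate V V' (U x))"
  proof -
    have bound: "c * norm v \<le> norm (v + U x v)" if "x \<in> topspace X" "v \<in> ?W" "orth_proj ?Q v = 0" for x v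
      unfolding U_def by (rule reduction_bound[OF J \<Gamma> M T L[OF that(1)] c that(2,3)])
    have solve: "\<exists>b\<in>?W. orth_proj ?Q b = 0 \<and> U x (b + q) = - b + f x q"
      if "x \<in> topspace X" "q \<in> ?Q" for x q
      unfolding U_def f_def by (rule reduction_solve[OF J \<Gamma> M T L[OF that(1)] that(2)])
    show "isometry_pair ?Q ?V ?V'"
      "homotopic_with (\<lambda>_. True) X (UF_top UNIV) (\<lambda>x. inflate ?V ?V' (f x)) (\<lambda>x. inflate V V' (U x))"
      using homotopic_inflate_reduction[OF V(1) W(2) Q Q_W U_unitary U_cont f_UF c(1) bound solve] by blast+
  qed
  \<comment> \<open>Restricting the isometry can only enlarge its cokernel, so the two embeddings of
    \<open>?Q\<close> can be compared.\<close>
  have "{y. V' y = 0} \<subseteq> {y. ?V' y = 0}" by (auto simp: blinfun.zero_right)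
  then have ninf: "\<not> finite_cdim {y. ?V' y = 0}" using V(2) finite_cdim_mono by blast
  have "(ind J UNIV X (\<lambda>x. quot_pull J \<Gamma> (L x)) (\<lambda>_. M) :: ('x \<Rightarrow> ('k \<Rightarrow>\<^sub>L 'k)) set)
      = htpy_class X (\<lambda>x. inflate V V' (U x))"
    unfolding ind_def U_def[symmetric] by (rule V(3)) (rule U_unitary)
  moreover have "\<dots> = htpy_class X (\<lambda>x. inflate S S' (f x))"
    using htpy_class_eqI[OF red(2)]
      htpy_class_inflate_unique[OF sepk red(1) ninf S(1,2) Q(2) f_cont f_UF] by simp
  moreover have "\<dots> = ind J (quot_model J \<Gamma>) X (\<lambda>x. quot_lift J \<Gamma> (L x)) (\<lambda>_. ?m)"
    unfolding ind_def f_def[symmetric] by (rule S(3)[symmetric]) (use f_UF in \<open>simp add: UF_def\<close>)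
  \<comment> \<open>The endpoint of a homotopy in \<open>UF\<close> is a map into \<open>UF\<close>.
    Membership in \<open>K1 X\<close>, and with it Fredholmness of the unreduced family, is read off
    here.\<close>
  moreover have "continuous_map X (UF_top UNIV) (\<lambda>x. inflate V V' (U x))"
    using homotopic_with_imp_continuous_maps[OF red(2)] by blast
  ultimately show ?thesis unfolding K1_def by (metis (no_types, lifting) imageI mem_Collect_eq)
qed

end
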